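(* Let $k\in\mathbb{N}$ be fixed and let $\{X=X^{(p)}\}_{p}$ be a sequence of datasets, $X^{(p)}\subset\mathbb{R}^p$, such that: (1) $|X^{(p)}|/p^{3/2}\to\theta$ for some $\theta>0$ as $p\to\infty$; (2) the $k+1$ largest eigenvalues of the covariance matrix $\Sigma(X^{(p)})$ converge, $\lambda_i(\Sigma(X^{(p)}))\to\gamma_i\in[0,\infty)$ for $i=1,\dots,k+1$, with $\Delta:=\gamma_k-\gamma_{k+1}>0$, and the empirical distribution $\frac{1}{p-k}\sum_{i=k+1}^p\delta_{\lambda_i(\Sigma(X^{(p)}))}$ converges weakly to a probability measure $\mu$; (3) $\|x\|\le\sqrt p$ for every $x\in X^{(p)}$. Let $\beta_p\ge 0$ with $\beta_p\to\beta\in[0,\infty)$. Let $U_\star\in\mathbb{R}^{p\times k}$ be the matrix whose columns are the first $k$ eigenvectors of $\Sigma(X)$, and let $\boldsymbol V$ be the output of the exponential mechanism on inputs $(X,\beta_p,k)$, i.e. $\boldsymbol V\sim\nu(\cdot\mid\Sigma(X),\beta_p,k)$. Then, as $p\to\infty$, $$U_\star^\top \boldsymbol V\boldsymbol V^\top U_\star\ \xrightarrow{\ \mathbb P\ }\ \mathrm{Diag}\Big(1-\tfrac{H_\mu(\gamma_1)}{\beta},\,1-\tfrac{H_\mu(\gamma_2)}{\beta},\dots,1-\tfrac{H_\mu(\gamma_k)}{\beta}\Big)_+,$$ where the right-hand side is interpreted as the zero matrix when $\beta=0$.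
   Context: A dataset is a finite collection of points of $\mathbb{R}^p$ (counted with multiplicity), $|X|$ is its number of points, and $\Sigma(X)=\frac1{|X|}\sum_{x\in X}xx^\top$. Eigenvalues of a symmetric matrix are listed in decreasing order $\lambda_1\ge\dots\ge\lambda_p$, with corresponding orthonormal eigenvectors $u_1,\dots,u_p$. $\mathbb O(p,k)$ is the set of $p\times k$ real matrices with orthonormal columns, $\xi_{p,k}$ its uniform (Haar) probability measure. For symmetric $\Sigma\in\mathbb{R}^{p\times p}$, $\beta\ge0$, the Gibbs distribution $\nu(\cdot\mid\Sigma,\beta,k)$ on $\mathbb O(p,k)$ is defined by $\frac{d\nu}{d\xi_{p,k}}(V)\propto\exp\big(\frac{p\beta}{2}\mathrm{Tr}[V^\top\Sigma V]\big)$. The exponential mechanism on inputs $(X,\beta,k)$ outputs a sample from $\nu(\cdot\mid\Sigma(X),\beta,k)$. The Hilbert transform of $\mu$ is $H_\mu(\lambda)=\int\frac{d\mu(t)}{\lambda-t}$ for $\lambda\notin\mathrm{supp}(\mu)$. For a diagonal matrix, $(\cdot)_+$ replaces each diagonal entry $d$ by $\max\{d,0\}$. $\|\cdot\|$ is the Euclidean norm on vectors. Everything ($X$, $U_\star$, $\boldsymbol V$) depends on $p$, $k$ does not. *)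

theory Defs
  imports "HOL-Probability.Probability" "Jordan_Normal_Form.Matrix"
begin

text \<open>
  The dimension \<open>p\<close> tends to infinity, so vectors and matrices are those of
  \<^theory>\<open>Jordan_Normal_Form.Matrix\<close>, with explicit dimensions. Indices start at 0: the
  eigenvalue \<open>\<lambda>\<^sub>i\<close> of the usual decreasing enumeration \<open>\<lambda>\<^sub>1 \<ge> \<dots> \<ge> \<lambda>\<^sub>p\<close> is \<open>lam (i - 1)\<close>.
\<close>

definition euclid_norm :: "real Matrix.vec \<Rightarrow> real" where
  "euclid_norm x = sqrt (scalar_prod x x)"

definition mat_trace :: "real Matrix.mat \<Rightarrow> real" where
  "mat_trace A = (\<Sum>i<dim_row A. A $$ (i, i))"

definition frobenius_norm :: "real Matrix.mat \<Rightarrow> real" where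
  "frobenius_norm A = sqrt (\<Sum>i<dim_row A. \<Sum>j<dim_col A. (A $$ (i, j))\<^sup>2)"

definition data_cov :: "nat \<Rightarrow> real Matrix.vec multiset \<Rightarrow> real Matrix.mat" where
  "data_cov p X = Matrix.mat p p
     (\<lambda>(i, j). (\<Sum>x\<in>#X. vec_index x i * vec_index x j) / real (size X))"

definition ordered_eigensystem ::
  "nat \<Rightarrow> real Matrix.mat \<Rightarrow> (nat \<Rightarrow> real) \<Rightarrow> (nat \<Rightarrow> real Matrix.vec) \<Rightarrow> bool" where
  "ordered_eigensystem p S lam u \<longleftrightarrow>
     (\<forall>i<p. u i \<in> carrier_vec p \<and> S *\<^sub>v u i = lam i \<cdot>\<^sub>v u i) \<and>
     (\<forall>i<p. \<forall>j<p. scalar_prod (u i) (u j) = (if i = j then 1 else 0)) \<and>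
     (\<forall>i j. i \<le> j \<longrightarrow> j < p \<longrightarrow> lam j \<le> lam i)"

definition stiefel :: "nat \<Rightarrow> nat \<Rightarrow> real Matrix.mat set" where
  "stiefel p k = {V \<in> carrier_mat p k. transpose_mat V * V = 1\<^sub>m k}"

text \<open>
  The type of matrices carries no topology; the Borel sets of \<open>\<real>\<^bsup>p\<times>k\<^esup>\<close> are obtained by
  identifying a \<open>p \<times> k\<close> matrix with the family of its entries.
\<close>

definition borel_mat :: "nat \<Rightarrow> nat \<Rightarrow> real Matrix.mat measure" where
  "borel_mat p k = vimage_algebra (carrier_mat p k)
     (\<lambda>A. restrict (\<lambda>ij. A $$ ij) ({..<p} \<times> {..<k}))
     (\<Pi>\<^sub>M ij\<in>{..<p} \<times> {..<k}. borel)"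

definition stiefel_space :: "nat \<Rightarrow> nat \<Rightarrow> real Matrix.mat measure" where
  "stiefel_space p k = restrict_space (borel_mat p k) (stiefel p k)"

text \<open>
  For \<open>k \<le> p\<close> the orthogonal group, \<open>stiefel p p\<close>, acts transitively on \<open>stiefel p k\<close> by left
  multiplication, and the following determines \<open>\<xi>\<close> uniquely.
\<close>

definition uniform_stiefel :: "nat \<Rightarrow> nat \<Rightarrow> real Matrix.mat measure \<Rightarrow> bool" where
  "uniform_stiefel p k \<xi> \<longleftrightarrow>
     prob_space \<xi> \<and> sets \<xi> = sets (stiefel_space p k) \<and>
     (\<forall>Q\<in>stiefel p p. distr \<xi> \<xi> (\<lambda>V. Q * V) = \<xi>)"

definition gibbs_weight ::
  "nat \<Rightarrow> real Matrix.mat \<Rightarrow> real \<Rightarrow> real Matrix.mat \<Rightarrow> real" where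
  "gibbs_weight p S b V = exp (real p * b / 2 * mat_trace (transpose_mat V * S * V))"

text \<open>Here \<open>\<xi>\<close> is the uniform probability measure on \<open>stiefel p k\<close>.\<close>

definition gibbs ::
  "real Matrix.mat measure \<Rightarrow> nat \<Rightarrow> real Matrix.mat \<Rightarrow> real \<Rightarrow> real Matrix.mat measure" where
  "gibbs \<xi> p S b = density \<xi>
     (\<lambda>V. ennreal (gibbs_weight p S b V / (LINT W|\<xi>. gibbs_weight p S b W)))"

definition bulk_distribution :: "nat \<Rightarrow> nat \<Rightarrow> (nat \<Rightarrow> real) \<Rightarrow> real measure" where
  "bulk_distribution p k lam = distr (uniform_count_measure {k..<p}) borel lam"

definition hilbert_transform :: "real measure \<Rightarrow> real \<Rightarrow> real" where
  "hilbert_transform \<mu> l = (LINT t|\<mu>. 1 / (l - t))"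

definition diag_pos_part :: "real Matrix.mat \<Rightarrow> real Matrix.mat" where
  "diag_pos_part A = mat_diag (dim_row A) (\<lambda>i. max (A $$ (i, i)) 0)"

text \<open>
  Convergence in probability to a constant matrix; the \<open>Y p\<close> may live on different
  probability spaces.
\<close>

definition tendsto_in_prob ::
  "(nat \<Rightarrow> 'w measure) \<Rightarrow> (nat \<Rightarrow> 'w \<Rightarrow> real Matrix.mat) \<Rightarrow> real Matrix.mat \<Rightarrow> bool" where
  "tendsto_in_prob M Y D \<longleftrightarrow>
     (\<forall>\<epsilon>>0. (\<lambda>p. measure (M p) {\<omega> \<in> space (M p). \<epsilon> < frobenius_norm (Y p \<omega> - D)})
        \<longlonglongrightarrow> 0)"

end

theory Submission
  imports Defs "HOL-Real_Asymp.Real_Asymp" "Jordan_Normal_Form.Determinant"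
begin

text \<open>
  Let \<open>A\<close> be the matrix of \<open>V V\<^sup>T\<close> in the eigenbasis, a random projection of rank \<open>k\<close>, with
  \<open>a\<^sub>i = A\<^sub>i\<^sub>i\<close>. Invariance of the uniform measure under the rotations in the plane of coordinates
  \<open>i, j\<close> gives integration by parts; applied to \<open>A\<^sub>i\<^sub>j\<close> it yields the exact identity
  \<open>p \<beta> (\<lambda>\<^sub>i - \<lambda>\<^sub>j) E A\<^sub>i\<^sub>j\<^sup>2 = E a\<^sub>i - E a\<^sub>j\<close>. Dividing by \<open>p \<beta> (\<lambda>\<^sub>i - \<lambda>\<^sub>j)\<close> and summing over
  \<open>j\<close> in the bulk, with \<open>A\<^sup>2 = A\<close>, gives
  \<open>E (a\<^sub>i - \<Sum>l<k. A\<^sub>i\<^sub>l\<^sup>2) = H(\<gamma>\<^sub>i) / \<beta> \<cdot> E a\<^sub>i + o(1)\<close>. With \<open>c\<^sub>i = 1 - H(\<gamma>\<^sub>i) / \<beta>\<close> this shows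
  \<open>E a\<^sub>i \<le> max c\<^sub>i 0 + o(1)\<close>, and it turns \<open>E a\<^sub>i \<rightarrow> max c\<^sub>i 0\<close> into the convergence of all overlaps
  in mean square. (For \<open>\<beta> = 0\<close> the identity bounds \<open>E a\<^sub>i\<close> directly.)

  It remains to exclude mass of \<open>a\<^sub>i\<close> near zero when \<open>c\<^sub>i > 0\<close>. If the spikes are separated, this
  follows by induction on \<open>i\<close>, integrating by parts with \<open>q / (d + M / p)\<close>, where \<open>d\<close> and \<open>q\<close> are the
  entries \<open>(i, i)\<close> and \<open>(i, j)\<close> of the Schur complement of \<open>A\<close> with respect to its first \<open>i\<close> rows:
  the resulting integrand is positive at every scale of \<open>d\<close> once \<open>M\<close> is large. The general case is
  reduced to separated spikes by lowering them slightly and using the convexity of the log-partition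
  function.
\<close>

section \<open>Rotations and Schur complements of projection matrices\<close>

text \<open>The mean identity alone is compatible with any mixture of overlaps 0 and c_i, so a finer
  test function is needed. The cutoff M / p has the size of a diagonal entry under the uniform
  measure: at this scale the two corrections of order 1 / p, from the trace and from differentiating
  the denominator, compete with the drift d (c_i - d).

  The denominator is also what forces Schur complements. For i > 0 the corresponding sum for A
  itself leaves the squares of the entries (i, l), l < i. Their mean is of order 1 / p, so division
  by something as small as M / p leaves a term that need not vanish. In the Schur complement these
  entries are zero, and its row i times row i of A sums to d (1 - a_i), whose factor d cancels the
  denominator. The price is a_i - d, the loss in the earlier elimination steps, which vanishes in
  the mean by induction.

  Spikes are lowered, not raised, because only lower bounds on E a_i are missing and convexity
  passes them from the lowered spikes to the given ones. It does so only for a weighted sum of the E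
  a_i; the upper bounds then settle each of them.\<close>

definition rot :: "nat \<Rightarrow> nat \<Rightarrow> real \<Rightarrow> (nat \<Rightarrow> real) \<Rightarrow> nat \<Rightarrow> real" where
  "rot i j t x r = (if r = i then cos t * x i + sin t * x j
     else if r = j then cos t * x j - sin t * x i else x r)"

definition rot2 :: "nat \<Rightarrow> nat \<Rightarrow> real \<Rightarrow> (nat \<Rightarrow> nat \<Rightarrow> real) \<Rightarrow> nat \<Rightarrow> nat \<Rightarrow> real" where
  "rot2 i j t A r s = rot i j t (\<lambda>r. rot i j t (A r) s) r"

text \<open>
  For the Gram matrix \<open>A\<close> of vectors \<open>w\<^sub>0, w\<^sub>1, \<dots>\<close>, \<open>schur A m\<close> is the Gram matrix of their
  projections to the orthogonal complement of \<open>w\<^sub>0, \<dots>, w\<^bsub>m-1\<^esub>\<close>. A vanishing pivot gives \<open>x / 0 = 0\<close>,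
  which is the right value: the projected \<open>w\<^sub>m\<close> is then zero.
\<close>

fun schur :: "(nat \<Rightarrow> nat \<Rightarrow> real) \<Rightarrow> nat \<Rightarrow> nat \<Rightarrow> nat \<Rightarrow> real" where
  "schur A 0 r s = A r s"
| "schur A (Suc m) r s = schur A m r s - schur A m r m * schur A m s m / schur A m m m"

text \<open>The squared length of the component of vector r along direction l of the Gram-Schmidt
  process, that is, what elimination step l takes away from the diagonal entry (r, r).\<close>

definition gain :: "(nat \<Rightarrow> nat \<Rightarrow> real) \<Rightarrow> nat \<Rightarrow> nat \<Rightarrow> real" where
  "gain A r l = (schur A l r l)\<^sup>2 / schur A l l l"

lemma rot_diff_mult: "rot i j t (\<lambda>r. x r - y r * c) r = rot i j t x r - rot i j t y r * c"
  by (auto simp: rot_def algebra_simps)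

lemma rot2_diff_mult:
  "rot2 i j t (\<lambda>r s. B r s - f r * (f s * c)) r s = rot2 i j t B r s - rot i j t f r * (rot i j t f s * c)"
proof -
  have "rot i j t (\<lambda>s. B r s - f r * (f s * c)) s = rot i j t (B r) s - f r * (rot i j t f s * c)" for r
    using rot_diff_mult[of i j t "B r" f "f r * c" s] by (simp add: mult_ac)
  then show ?thesis
    using rot_diff_mult[of i j t "\<lambda>r. rot i j t (B r) s" f "rot i j t f s * c" r]
    by (simp add: rot2_def)
qed

text \<open>The pivots have index below i, so the rotation fixes them. Each elimination step
  subtracts a multiple of the outer product of a column with itself, and \<open>rot2\<close> turns
  this into the outer product of the rotated column.\<close>

lemma schur_rot2:
  assumes "m \<le> i" "i < j"
  shows "schur (rot2 i j t A) m = rot2 i j t (schur A m)"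
  using assms
proof (induction m)
  case (Suc m)
  then have IH: "schur (rot2 i j t A) m = rot2 i j t (schur A m)"
    and m: "m \<noteq> i" "m \<noteq> j" by auto
  have col: "rot2 i j t B r m = rot i j t (\<lambda>r. B r m) r" "rot i j t (\<lambda>r. B r m) m = B m m" for B r
    using m by (simp_all add: rot2_def rot_def)
  have eq: "schur A (Suc m) = (\<lambda>r s. schur A m r s - schur A m r m * (schur A m s m * (1 / schur A m m m)))"
    by (simp add: fun_eq_iff)
  have "rot2 i j t (schur A (Suc m)) r s = schur (rot2 i j t A) (Suc m) r s" for r s
    using m by (simp only: eq rot2_diff_mult schur.simps IH col) simp
  then show ?case by (intro ext) (rule sym)
qed (simp add: fun_eq_iff rot2_def rot_def)

lemma sum_tail:
  fixes f :: "nat \<Rightarrow> real"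
  assumes "i < p"
  shows "(\<Sum>j\<in>{i<..<p}. f j) = (\<Sum>j<p. f j) - (\<Sum>j<i. f j) - f i"
proof -
  have "{..<p} = insert i ({..<i} \<union> {i<..<p})" using assms by auto
  then have "sum f {..<p} = f i + sum f ({..<i} \<union> {i<..<p})" by simp
  also have "sum f ({..<i} \<union> {i<..<p}) = sum f {..<i} + sum f {i<..<p}"
    by (rule sum.union_disjoint) auto
  finally show ?thesis by simp
qed

section \<open>Symmetric idempotent matrices of trace k and their Schur complements\<close>

locale proj_mat =
  fixes p k :: nat and A :: "nat \<Rightarrow> nat \<Rightarrow> real"
  assumes sym: "A r s = A s r"
    and idem: "r < p \<Longrightarrow> s < p \<Longrightarrow> (\<Sum>m<p. A r m * A m s) = A r s"
    and trace: "(\<Sum>r<p. A r r) = real k"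
begin

lemma sum_square: "r < p \<Longrightarrow> (\<Sum>s<p. (A r s)\<^sup>2) = A r r"
  using idem[of r r] sym by (simp add: power2_eq_square)

lemma diag_nonneg: "r < p \<Longrightarrow> 0 \<le> A r r"
  unfolding sum_square[symmetric] by (simp add: sum_nonneg)

lemma square_le_diag: "r < p \<Longrightarrow> s < p \<Longrightarrow> (A r s)\<^sup>2 \<le> A r r"
  unfolding sum_square[symmetric] by (rule member_le_sum) auto

lemma diag_le_one:
  assumes "r < p" shows "A r r \<le> 1"
proof (rule ccontr)
  assume "\<not> A r r \<le> 1"
  then have "A r r * 1 < A r r * A r r" by (intro mult_strict_left_mono) auto
  with square_le_diag[OF assms assms] show False by (simp add: power2_eq_square)
qed

lemma abs_le_one: "r < p \<Longrightarrow> s < p \<Longrightarrow> \<bar>A r s\<bar> \<le> 1"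
  using square_le_diag[of r s] diag_le_one[of r] abs_le_square_iff[of "A r s" 1] by simp

lemma schur_sym: "schur A m r s = schur A m s r"
  by (induction m arbitrary: r s) (auto simp: sym mult.commute)

text \<open>If g is column m of a symmetric idempotent G and d its pivot, then G g = g and g . g =
  d, so G - g g^T / d squares to G - 2 g g^T / d + d g g^T / d^2, which is the same matrix. For d =
  0 the subtracted term is zero.\<close>

lemma schur_idem:
  assumes "m \<le> p" "r < p" "s < p"
  shows "(\<Sum>l<p. schur A m r l * schur A m l s) = schur A m r s"
  using assms
proof (induction m arbitrary: r s)
  case 0 then show ?case using idem by simp
next
  case (Suc m)
  let ?G = "schur A m"
  have IH: "(\<Sum>l<p. ?G r l * ?G l s) = ?G r s" if "r < p" "s < p" for r s
    using Suc that by simp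
  have m: "m < p" using Suc.prems by simp
  let ?d = "?G m m"
  have G_m: "?G m l = ?G l m" for l by (rule schur_sym)
  have *: "(\<Sum>l<p. (?G r l - ?G r m * ?G l m / ?d) * (?G l s - ?G l m * ?G s m / ?d))
     = (\<Sum>l<p. ?G r l * ?G l s) - (?G s m / ?d) * (\<Sum>l<p. ?G r l * ?G l m)
       - (?G r m / ?d) * (\<Sum>l<p. ?G m l * ?G l s)
       + (?G r m / ?d) * (?G s m / ?d) * (\<Sum>l<p. ?G m l * ?G l m)"
    unfolding sum_distrib_left sum.distrib[symmetric] sum_subtractf[symmetric]
    by (rule sum.cong[OF refl], subst (1 2) G_m) (simp add: algebra_simps)
  show ?case
    unfolding schur.simps * IH[OF Suc.prems(2,3)] IH[OF Suc.prems(2) m] IH[OF m Suc.prems(3)] IH[OF m m]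
      schur_sym[of m m s]
    by (cases "?d = 0") (auto simp: field_simps)
qed

text \<open>Every row of a Schur complement is a linear combination of rows of A, and right
  multiplication by the projection A fixes those.\<close>

lemma schur_mult:
  assumes "m \<le> p" "r < p" "s < p"
  shows "(\<Sum>l<p. schur A m r l * A l s) = schur A m r s"
  using assms
proof (induction m arbitrary: r s)
  case 0 then show ?case using idem by simp
next
  case (Suc m)
  let ?G = "schur A m"
  have G_m: "?G m l = ?G l m" for l by (rule schur_sym)
  have *: "(\<Sum>l<p. (?G r l - ?G r m * ?G l m / ?G m m) * A l s)
     = (\<Sum>l<p. ?G r l * A l s) - (?G r m / ?G m m) * (\<Sum>l<p. ?G m l * A l s)"
    unfolding sum_distrib_left sum_subtractf[symmetric]
    by (rule sum.cong[OF refl], subst (2) G_m) (simp add: algebra_simps)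
  show ?case
    unfolding schur.simps * using Suc by (simp add: schur_sym[of m m s])
qed

lemma schur_sum_square:
  assumes "m \<le> p" "r < p" shows "(\<Sum>s<p. (schur A m r s)\<^sup>2) = schur A m r r"
  using schur_idem[OF assms(1,2,2)] schur_sym[of m] by (simp add: power2_eq_square)

lemma schur_diag_nonneg: "m \<le> p \<Longrightarrow> r < p \<Longrightarrow> 0 \<le> schur A m r r"
  unfolding schur_sum_square[symmetric] by (simp add: sum_nonneg)

lemma schur_cauchy_schwarz:
  assumes "m \<le> p" "r < p" "s < p"
  shows "(schur A m r s)\<^sup>2 \<le> schur A m r r * schur A m s s"
proof -
  have "(schur A m r s)\<^sup>2 = (\<Sum>l<p. schur A m r l * schur A m s l)\<^sup>2"
    using schur_idem[OF assms] schur_sym[of m] by simp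
  also have "\<dots> \<le> (\<Sum>l<p. (schur A m r l)\<^sup>2) * (\<Sum>l<p. (schur A m s l)\<^sup>2)"
    by (rule Cauchy_Schwarz_ineq_sum)
  finally show ?thesis using assms by (simp add: schur_sum_square)
qed

text \<open>A vanishing pivot is no exception: by Cauchy-Schwarz its column has vanished
  already.\<close>

lemma schur_zero:
  assumes "m \<le> p" "r < p" "l < m" shows "schur A m r l = 0"
  using assms
proof (induction m arbitrary: r)
  case (Suc m)
  show ?case
  proof (cases "l = m")
    case True
    have "schur A m m m = 0 \<Longrightarrow> schur A m r m = 0"
      using schur_cauchy_schwarz[of m r m] Suc.prems by simp
    then show ?thesis using True by auto
  next
    case False
    then have "l < m" using Suc.prems by simp
    then have "schur A m r l = 0" "schur A m m l = 0" using Suc by auto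
    then show ?thesis using schur_sym[of m l m] by simp
  qed
qed simp

lemma gain_nonneg: "l < p \<Longrightarrow> 0 \<le> gain A r l"
  by (simp add: gain_def schur_diag_nonneg)

lemma schur_diag: "schur A m r r = A r r - (\<Sum>l<m. gain A r l)"
  by (induction m) (auto simp: gain_def power2_eq_square)

lemma schur_diag_le: "m \<le> p \<Longrightarrow> schur A m r r \<le> A r r"
  unfolding schur_diag using sum_nonneg[of "{..<m}" "gain A r"] gain_nonneg by simp

lemma schur_diag_le_one: "m \<le> p \<Longrightarrow> r < p \<Longrightarrow> schur A m r r \<le> 1"
  using schur_diag_le[of m r] diag_le_one[of r] by simp

lemma schur_square_le_diag:
  "m \<le> p \<Longrightarrow> r < p \<Longrightarrow> s < p \<Longrightarrow> (schur A m r s)\<^sup>2 \<le> schur A m r r"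
  unfolding schur_sum_square[symmetric] by (rule member_le_sum) auto

lemma schur_abs_le_one:
  assumes "m \<le> p" "r < p" "s < p" shows "\<bar>schur A m r s\<bar> \<le> 1"
  using schur_square_le_diag[OF assms] schur_diag_le_one[OF assms(1,2)]
    abs_le_square_iff[of "schur A m r s" 1] by simp

lemma gain_le_one:
  assumes "l < p" "r < p" shows "gain A r l \<le> 1"
proof (cases "schur A l l l = 0")
  case False
  then have "0 < schur A l l l" using schur_diag_nonneg[of l l] assms by simp
  moreover have "(schur A l r l)\<^sup>2 \<le> 1 * schur A l l l"
    using schur_cauchy_schwarz[of l r l] schur_diag_le_one[of l r] assms schur_diag_nonneg[of l l]
    by (meson less_imp_le_nat mult_right_mono order_trans)
  ultimately show ?thesis by (simp add: gain_def field_simps)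
qed (simp add: gain_def)

text \<open>Column m has squared norm equal to the pivot, so step m lowers the trace by exactly 1,
  or by 0 if the pivot vanishes; hence an inequality.\<close>

lemma schur_trace:
  assumes "m \<le> p" shows "real k - real m \<le> (\<Sum>r<p. schur A m r r)"
  using assms
proof (induction m)
  case 0 then show ?case using trace by simp
next
  case (Suc m)
  have "(\<Sum>r<p. (schur A m r m)\<^sup>2) = schur A m m m"
    using schur_sum_square[of m m] Suc.prems by (subst schur_sym) simp
  then have "(\<Sum>r<p. (schur A m r m)\<^sup>2) / schur A m m m \<le> 1" by simp
  then have "(\<Sum>r<p. gain A r m) \<le> 1" by (simp add: gain_def sum_divide_distrib)
  then show ?case using Suc by (simp add: sum_subtractf gain_def power2_eq_square)
qed

text \<open>The full row sum is d = \<open>schur A i i i\<close> by \<open>schur_mult\<close>; the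
  entries before i vanish, and entry i contributes d times \<open>A i i\<close>.\<close>

lemma schur_tail_mult:
  assumes "i < p"
  shows "(\<Sum>j\<in>{i<..<p}. schur A i i j * A i j) = schur A i i i * (1 - A i i)"
proof -
  have "(\<Sum>j<p. schur A i i j * A i j) = schur A i i i"
    using schur_mult[of i i i] assms by (subst sym) simp
  then show ?thesis using assms schur_zero[of i i]
    by (simp add: sum_tail algebra_simps)
qed

lemma schur_tail_square:
  assumes "i < p"
  shows "(\<Sum>j\<in>{i<..<p}. (schur A i i j)\<^sup>2) \<le> schur A i i i"
proof -
  have "(\<Sum>j\<in>{i<..<p}. (schur A i i j)\<^sup>2) \<le> (\<Sum>j<p. (schur A i i j)\<^sup>2)"
    by (rule sum_mono2) auto
  then show ?thesis using schur_sum_square[of i i] assms by simp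
qed

text \<open>After i < k eliminations at least one unit of trace is left, none of it at the indices
  below i. This is the source of the term that pushes the pivot away from 0.\<close>

lemma schur_tail_trace:
  assumes "i < k" "i < p"
  shows "1 - schur A i i i \<le> (\<Sum>j\<in>{i<..<p}. schur A i j j)"
proof -
  have "schur A i j j = 0" if "j < i" for j using schur_zero[of i j j] that assms by auto
  then have "(\<Sum>j\<in>{i<..<p}. schur A i j j) = (\<Sum>j<p. schur A i j j) - schur A i i i"
    using assms by (simp add: sum_tail)
  moreover have "1 \<le> real k - real i" using assms by linarith
  ultimately show ?thesis using schur_trace[of i] assms by simp
qed

text \<open>Unrolling the recursion gives \<open>A i l\<close> minus l correction terms. The square
  of correction m is \<open>gain A i m\<close> times \<open>gain A l m\<close>, and the second
  factor is at most 1. Cauchy-Schwarz over l + 1 terms accounts for the prefactor.\<close>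

lemma schur_sq_le:
  assumes "l < p" "i < p"
  shows "(schur A l i l)\<^sup>2 \<le> (real l + 1) * ((A i l)\<^sup>2 + (\<Sum>m<l. gain A i m))"
proof -
  define f where "f m = schur A m i m * schur A m l m / schur A m m m" for m
  have eq: "schur A n i l = A i l - (\<Sum>m<n. f m)" for n
    by (induction n) (auto simp: f_def)
  have f2: "(f m)\<^sup>2 \<le> gain A i m" if "m < l" for m
  proof -
    have "(f m)\<^sup>2 = gain A i m * gain A l m" by (simp add: f_def gain_def power_divide power_mult_distrib power2_eq_square)
    also have "\<dots> \<le> gain A i m * 1" using gain_le_one[of m l] gain_nonneg that assms by (intro mult_left_mono) auto
    finally show ?thesis by simp
  qed
  define g where "g m = (if m = l then A i l else - f m)" for m
  have "(schur A l i l)\<^sup>2 = (\<Sum>m\<le>l. 1 * g m)\<^sup>2"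
    unfolding eq[of l] lessThan_Suc_atMost[symmetric] by (simp add: g_def sum_negf)
  also have "\<dots> \<le> (\<Sum>m\<le>l. 1\<^sup>2) * (\<Sum>m\<le>l. (g m)\<^sup>2)" by (rule Cauchy_Schwarz_ineq_sum)
  also have "(\<Sum>m\<le>l. (g m)\<^sup>2) = (A i l)\<^sup>2 + (\<Sum>m<l. (f m)\<^sup>2)"
    unfolding lessThan_Suc_atMost[symmetric] by (simp add: g_def)
  also have "(\<Sum>m\<le>l. 1\<^sup>2::real) * ((A i l)\<^sup>2 + (\<Sum>m<l. (f m)\<^sup>2)) \<le> (real l + 1) * ((A i l)\<^sup>2 + (\<Sum>m<l. gain A i m))"
    using f2 by (simp add: add.commute) (intro mult_left_mono add_left_mono sum_mono; simp)
  finally show ?thesis .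
qed

text \<open>Makes gains small once the pivot is close to c. If the pivot is below c / 2, the first
  term on the right is already at least 1 and bounds every gain; otherwise the denominator of the
  gain is at least c / 2 and \<open>schur_sq_le\<close> applies.\<close>

lemma gain_bound:
  assumes "l < p" "i < p" "0 < c"
  shows "gain A i l \<le> 4 / c\<^sup>2 * (schur A l l l - c)\<^sup>2
     + 2 / c * (real l + 1) * ((A i l)\<^sup>2 + (\<Sum>m<l. gain A i m))"
proof -
  let ?X = "(A i l)\<^sup>2 + (\<Sum>m<l. gain A i m)"
  have X: "0 \<le> ?X" using gain_nonneg assms by (auto intro!: add_nonneg_nonneg sum_nonneg)
  show ?thesis
  proof (cases "schur A l l l < c / 2")
    case True
    then have "(c/2)\<^sup>2 \<le> (c - schur A l l l)\<^sup>2" using assms by (intro power_mono) auto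
    then have "1 \<le> 4 / c\<^sup>2 * (schur A l l l - c)\<^sup>2" using assms by (simp add: field_simps power2_eq_square)
    then show ?thesis using gain_le_one[OF assms(1,2)] X assms
      by (smt (verit) divide_nonneg_pos mult_nonneg_nonneg of_nat_0_le_iff)
  next
    case False
    then have d: "c / 2 \<le> schur A l l l" by simp
    have "gain A i l \<le> (schur A l i l)\<^sup>2 / (c/2)"
      unfolding gain_def using d assms by (intro divide_left_mono) auto
    also have "\<dots> \<le> ((real l + 1) * ?X) / (c/2)"
      using schur_sq_le[OF assms(1,2)] assms by (intro divide_right_mono) auto
    also have "\<dots> = 2 / c * (real l + 1) * ?X" using assms by (simp add: field_simps)
    finally show ?thesis by (smt (verit) divide_nonneg_nonneg mult_nonneg_nonneg zero_le_power2)
  qed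
qed

end

text \<open>
  The right-hand side is the integrand of \<open>schur_inequality\<close> below, with \<open>d\<close> in place of \<open>A\<^sub>i\<^sub>i\<close>. At the
  scale \<open>d \<approx> 1 / p\<close> the term with \<open>c\<^sub>0\<close> keeps it bounded away from zero, so that \<open>d\<close> cannot
  concentrate at the spurious root \<open>0\<close> of \<open>d (c - d)\<close>.
\<close>

lemma real_quadratic_pointwise:
  fixes c c\<^sub>1 C c\<^sub>0 d M p :: real
  assumes "0 < c\<^sub>1" "c\<^sub>1 \<le> c" "c \<le> 1" "0 \<le> d" "d \<le> 1" "0 < C" "0 < c\<^sub>0"
    and M: "M = 16 * C / c\<^sub>1" and p: "0 < p" "4 * M \<le> c\<^sub>1 * p"
  defines "\<epsilon> \<equiv> M / p"
  shows "d * (c - d) / c + min 1 (min (c\<^sub>1 / 16) (c\<^sub>0 / (2 * M))) * (c - d)\<^sup>2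
       - (2 * M / c\<^sub>1 + 2 * C / c\<^sub>1) / p
     \<le> d / (d + \<epsilon>) * (c - d) + c\<^sub>0 / p * ((1 - d) / (d + \<epsilon>)) - C / p * (d / (d + \<epsilon>)\<^sup>2)"
proof -
  define \<delta> where "\<delta> = min 1 (min (c\<^sub>1 / 16) (c\<^sub>0 / (2 * M)))"
  have M0: "0 < M" using assms by simp
  have \<epsilon>: "0 < \<epsilon>" "\<epsilon> \<le> c\<^sub>1 / 4" using M0 p by (auto simp: \<epsilon>_def field_simps)
  have M_eq: "C / M = c\<^sub>1 / 16" using assms by simp
  have \<epsilon>_eq: "\<epsilon> = M / p" by (simp add: \<epsilon>_def)
  note assms = assms(1-7) and \<epsilon>_def = \<epsilon>_eq
  have \<delta>: "0 \<le> \<delta>" "\<delta> \<le> 1" "\<delta> \<le> c\<^sub>1 / 16" "\<delta> \<le> c\<^sub>0 / (2 * M)"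
    using assms M0 by (auto simp: \<delta>_def)
  have c: "0 < c" using assms by simp
  have dpos: "0 < d + \<epsilon>" using \<epsilon>(1) \<open>0 \<le> d\<close> by (rule add_nonneg_pos[rotated])
  have cd: "\<bar>c - d\<bar> \<le> 1" using assms by auto
  have cd2: "(c - d)\<^sup>2 \<le> 1" using cd by (simp add: abs_square_le_1)
  \<comment> \<open>For d \<ge> c / 2 everything involving \<epsilon> or 1 / p is an error of order
    1 / p, and the surplus of c - d over d (c - d) / c is (c - d)^2 / c. Below c / 2 the positivity
    comes from the drift and the term with \<open>c\<^sub>0\<close>.\<close>
  show ?thesis
  proof (cases "c / 2 \<le> d")
    case True
    have split: "c - d = d * (c - d) / c + (c - d)\<^sup>2 / c" using c by (simp add: field_simps power2_eq_square)
    have "\<delta> * (c - d)\<^sup>2 \<le> 1 * (c - d)\<^sup>2" using \<delta> by (intro mult_right_mono) auto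
    also have "\<dots> \<le> (c - d)\<^sup>2 / c" using c assms by (simp add: le_divide_eq mult_left_le)
    finally have 1: "\<delta> * (c - d)\<^sup>2 \<le> (c - d)\<^sup>2 / c" .
    have d1: "c\<^sub>1 / 2 \<le> d" using True assms by simp
    have psi: "d / (d + \<epsilon>) * (c - d) = (c - d) - \<epsilon> / (d + \<epsilon>) * (c - d)"
      using dpos by (simp add: field_simps)
    have "\<epsilon> / (d + \<epsilon>) * (c - d) \<le> \<epsilon> / (d + \<epsilon>) * 1"
      using cd \<epsilon> dpos by (intro mult_left_mono) auto
    also have "\<dots> \<le> \<epsilon> / (c\<^sub>1/2)" using d1 \<epsilon> assms
      by (simp only: mult_1_right) (intro divide_left_mono mult_pos_pos; simp)
    finally have 2: "\<epsilon> / (d + \<epsilon>) * (c - d) \<le> 2 * M / c\<^sub>1 / p" by (simp add: \<epsilon>_def mult_ac)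
    have "d / (d + \<epsilon>)\<^sup>2 \<le> (d + \<epsilon>) / (d + \<epsilon>)\<^sup>2" using \<epsilon> by (intro divide_right_mono) auto
    also have "\<dots> = 1 / (d + \<epsilon>)" using dpos by (simp add: power2_eq_square)
    also have "\<dots> \<le> 1 / (c\<^sub>1/2)" using d1 \<epsilon> assms by (intro divide_left_mono mult_pos_pos) auto
    finally have "C / p * (d / (d + \<epsilon>)\<^sup>2) \<le> C / p * (2 / c\<^sub>1)" using p assms by (intro mult_left_mono) auto
    then have 3: "C / p * (d / (d + \<epsilon>)\<^sup>2) \<le> 2 * C / c\<^sub>1 / p" by (simp add: mult_ac)
    have 4: "0 \<le> c\<^sub>0 / p * ((1 - d) / (d + \<epsilon>))" using assms dpos p by simp
    have "(2 * M / c\<^sub>1 + 2 * C / c\<^sub>1) / p = 2 * M / c\<^sub>1 / p + 2 * C / c\<^sub>1 / p" by (simp add: add_divide_distrib)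
    then show ?thesis unfolding \<delta>_def[symmetric] using 1 2 3 4 split psi by linarith
  next
    case False
    then have d: "d < c / 2" by simp
    have eq: "d / (d + \<epsilon>) * (c - d) - d * (c - d) / c = (c - d) * (d / (d + \<epsilon>) * ((c - d - \<epsilon>) / c))"
      using c dpos by (simp add: field_simps)
    \<comment> \<open>Here c - d \<ge> c / 2, and since \<epsilon> \<le> c / 4 also c - d -
      \<epsilon> \<ge> c / 4.\<close>
    have "c / 2 * (d / (d + \<epsilon>) * (1 / 4)) \<le> (c - d) * (d / (d + \<epsilon>) * ((c - d - \<epsilon>) / c))"
      using d c \<epsilon> dpos assms by (intro mult_mono) (auto simp: field_simps)
    then have 1: "c\<^sub>1 / 8 * (d / (d + \<epsilon>)) \<le> d / (d + \<epsilon>) * (c - d) - d * (c - d) / c"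
      using eq mult_right_mono[of "c\<^sub>1/8" "c/8" "d / (d + \<epsilon>)"] assms dpos by simp
    \<comment> \<open>The choice of M makes this cost \<open>c\<^sub>1 / 16\<close> times d / (d +
      \<epsilon>), half of the surplus just obtained; the other half is kept for \<delta>.\<close>
    have "C / p * (d / (d + \<epsilon>)\<^sup>2) = (d / (d + \<epsilon>)) * (C / (p * (d + \<epsilon>)))"
      by (simp add: power2_eq_square mult_ac)
    also have "\<dots> \<le> (d / (d + \<epsilon>)) * (C / M)"
    proof (intro mult_left_mono divide_left_mono)
      show "M \<le> p * (d + \<epsilon>)" using p assms by (simp add: \<epsilon>_def field_simps)
    qed (use assms M0 dpos p in auto)
    also note M_eq
    finally have 2: "C / p * (d / (d + \<epsilon>)\<^sup>2) \<le> c\<^sub>1 / 16 * (d / (d + \<epsilon>))" by (simp add: mult_ac)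
    have "c\<^sub>0 / p * ((1/2) / (d + \<epsilon>)) \<le> c\<^sub>0 / p * ((1 - d) / (d + \<epsilon>))"
      using d assms dpos p by (intro mult_left_mono divide_right_mono) auto
    moreover have "c\<^sub>0 / p * ((1/2) / (d + \<epsilon>)) = c\<^sub>0 / (2 * p) / (d + \<epsilon>)" by simp
    ultimately have 3: "c\<^sub>0 / (2 * p) / (d + \<epsilon>) \<le> c\<^sub>0 / p * ((1 - d) / (d + \<epsilon>))" by (simp only:)
    \<comment> \<open>The two remaining gains pay for the two summands of d + \<epsilon>: the drift
      for \<delta> d, the term with \<open>c\<^sub>0\<close> for \<delta> M / p. This explains the
      last two entries in the minimum defining \<delta>.\<close>
    have "\<delta> * (d + \<epsilon>) = \<delta> * d + \<delta> * M / p" by (simp add: \<epsilon>_def algebra_simps)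
    also have "\<dots> \<le> c\<^sub>1 / 16 * d + c\<^sub>0 / (2 * M) * M / p"
      using \<delta> assms M0 p by (intro add_mono mult_right_mono divide_right_mono) auto
    also have "\<dots> = c\<^sub>1 / 16 * d + c\<^sub>0 / (2 * p)" using M0 by simp
    finally have "\<delta> \<le> (c\<^sub>1 / 16 * d + c\<^sub>0 / (2 * p)) / (d + \<epsilon>)" using dpos by (simp add: le_divide_eq)
    then have 4: "\<delta> \<le> c\<^sub>1 / 16 * (d / (d + \<epsilon>)) + c\<^sub>0 / (2 * p) / (d + \<epsilon>)" by (simp add: add_divide_distrib)
    have 5: "\<delta> * (c - d)\<^sup>2 \<le> \<delta>" using cd2 \<delta> by (simp add: mult_left_le)
    have 6: "0 \<le> (2 * M / c\<^sub>1 + 2 * C / c\<^sub>1) / p" using assms M0 p by simp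
    show ?thesis unfolding \<delta>_def[symmetric] using 1 2 3 4 5 6 by linarith
  qed
qed

section \<open>Integration by parts along rotations\<close>

lemma rot2_0 [simp]: "rot2 i j 0 A = A"
  by (auto simp: fun_eq_iff rot2_def rot_def)

lemma rot2_deriv:
  assumes "i \<noteq> j" "A j i = A i j"
  shows "((\<lambda>t. rot2 i j t A i i) has_real_derivative 2 * rot2 i j t A i j) (at t)"
    and "((\<lambda>t. rot2 i j t A j j) has_real_derivative - 2 * rot2 i j t A i j) (at t)"
    and "((\<lambda>t. rot2 i j t A i j) has_real_derivative rot2 i j t A j j - rot2 i j t A i i) (at t)"
  using assms unfolding rot2_def rot_def
  by (auto intro!: derivative_eq_intros simp: algebra_simps)

lemma rot2_deriv_diag_sum:
  assumes "i < j" "j < p" "A j i = A i j"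
  shows "((\<lambda>t. \<Sum>l<p. lam l * rot2 i j t A l l) has_real_derivative
    2 * (lam i - lam j) * rot2 i j t A i j) (at t)"
proof -
  let ?q = "2 * rot2 i j t A i j"
  have "((\<lambda>t. rot2 i j t A l l) has_real_derivative
      (if l = i then ?q else 0) - (if l = j then ?q else 0)) (at t)" for l
  proof -
    consider "l = i" | "l = j" | "l \<noteq> i" "l \<noteq> j" by blast
    then show ?thesis
      using rot2_deriv(1,2)[of i j A t] assms by cases (auto simp: rot2_def rot_def)
  qed
  from DERIV_cmult[OF this, of "lam l" l for l]
  have "((\<lambda>t. \<Sum>l<p. lam l * rot2 i j t A l l) has_real_derivative
      (\<Sum>l<p. lam l * ((if l = i then ?q else 0) - (if l = j then ?q else 0)))) (at t)"
    by (intro DERIV_sum)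
  also have "(\<Sum>l<p. lam l * ((if l = i then ?q else 0) - (if l = j then ?q else 0)))
      = (\<Sum>l<p. if l = i then lam l * ?q else 0) - (\<Sum>l<p. if l = j then lam l * ?q else 0)"
    unfolding sum_subtractf[symmetric] by (rule sum.cong) auto
  also have "\<dots> = 2 * (lam i - lam j) * rot2 i j t A i j"
    using assms by (simp add: algebra_simps)
  finally show ?thesis .
qed

text \<open>What the analysis uses of the uniform measure. Rotations are lifted to measure
  preserving maps of the underlying space because the measure lives on frames V, while A is a
  function of V.\<close>

locale rotation_invariant_projection = prob_space M for M :: "'v measure" +
  fixes p k :: nat and A :: "'v \<Rightarrow> nat \<Rightarrow> nat \<Rightarrow> real"
  assumes proj: "x \<in> space M \<Longrightarrow> proj_mat p k (A x)"
    and measurable_entry [measurable]: "(\<lambda>x. A x r s) \<in> borel_measurable M"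
    and rotation: "i < j \<Longrightarrow> j < p \<Longrightarrow>
      \<exists>T. T \<in> M \<rightarrow>\<^sub>M M \<and> distr M M T = M \<and> (\<forall>x\<in>space M. A (T x) = rot2 i j t (A x))"
begin

text \<open>The mean of \<open>F (A x)\<close> does not change when x moves along the lifted
  rotations, so the derivative at angle 0 has mean 0. Dominated convergence of difference quotients
  exchanges derivative and integral.\<close>

lemma integration_by_parts:
  fixes F F' :: "(nat \<Rightarrow> nat \<Rightarrow> real) \<Rightarrow> real"
  assumes ij: "i < j" "j < p"
    and F [measurable]: "(\<lambda>x. F (A x)) \<in> borel_measurable M"
    and F' [measurable]: "(\<lambda>x. F' (A x)) \<in> borel_measurable M"
    and bF: "\<And>x. x \<in> space M \<Longrightarrow> \<bar>F (A x)\<bar> \<le> B"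
    and bF': "\<And>x. x \<in> space M \<Longrightarrow> \<bar>F' (A x)\<bar> \<le> B'"
    and der: "\<And>x t. x \<in> space M \<Longrightarrow>
      ((\<lambda>t. F (rot2 i j t (A x))) has_real_derivative F' (rot2 i j t (A x))) (at t)"
  shows "(\<integral>x. F' (A x) \<partial>M) = 0"
proof -
  obtain T where T [measurable]: "\<And>t. T t \<in> M \<rightarrow>\<^sub>M M"
    and inv: "\<And>t. distr M M (T t) = M"
    and AT: "\<And>t x. x \<in> space M \<Longrightarrow> A (T t x) = rot2 i j t (A x)"
    using rotation[OF ij] by metis
  have T_in: "T t x \<in> space M" if "x \<in> space M" for t x
    using measurable_space[OF T that] .
  define h :: "nat \<Rightarrow> real" where "h n = inverse (real (Suc n))" for n
  have h: "0 < h n" for n by (simp add: h_def)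
  define D where "D n x = (F (A (T (h n) x)) - F (A x)) / h n" for n x
  have D_meas [measurable]: "D n \<in> borel_measurable M" for n
    unfolding D_def using measurable_compose[OF T F] by measurable
  have int_F: "integrable M (\<lambda>x. F (A x))"
    using bF by (intro integrable_const_bound[where B = B]) auto
  have int_FT: "integrable M (\<lambda>x. F (A (T t x)))" for t
    using bF T_in measurable_compose[OF T F] by (intro integrable_const_bound[where B = B]) auto
  have "(\<integral>x. F (A (T t x)) \<partial>M) = (\<integral>x. F (A x) \<partial>M)" for t
    using integral_distr[OF T F, of t] by (simp add: inv)
  then have D0: "(\<integral>x. D n x \<partial>M) = 0" for n
    unfolding D_def using int_F int_FT by simp
  have lim: "(\<lambda>n. D n x) \<longlonglongrightarrow> F' (A x)" if x: "x \<in> space M" for x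
  proof -
    have "((\<lambda>s. (F (rot2 i j (0 + s) (A x)) - F (rot2 i j 0 (A x))) / s) \<longlongrightarrow> F' (rot2 i j 0 (A x))) (at 0)"
      using der[OF x, of 0] unfolding DERIV_def .
    moreover have "filterlim h (at 0) sequentially"
      unfolding filterlim_at using LIMSEQ_inverse_real_of_nat h
      by (auto simp: h_def[abs_def])
    ultimately show ?thesis
      unfolding D_def AT[OF x] by (auto dest: filterlim_compose)
  qed
  have bound: "\<bar>D n x\<bar> \<le> B'" if x: "x \<in> space M" for n x
  proof -
    \<comment> \<open>The derivative is taken at an intermediate angle z, but \<open>T z x\<close>
      lies in the space again, so the bound on \<open>F' (A _)\<close> covers it.\<close>
    obtain z where "F (rot2 i j (h n) (A x)) - F (rot2 i j 0 (A x)) = (h n - 0) * F' (rot2 i j z (A x))"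
      using MVT2[OF h[of n], where f = "\<lambda>t. F (rot2 i j t (A x))" and f' = "\<lambda>t. F' (rot2 i j t (A x))"]
        der[OF x] by blast
    then have "D n x = F' (A (T z x))" using h[of n] x by (simp add: D_def AT)
    then show ?thesis using bF'[OF T_in[OF x]] by simp
  qed
  have "(\<lambda>n. \<integral>x. D n x \<partial>M) \<longlonglongrightarrow> (\<integral>x. F' (A x) \<partial>M)"
    by (rule integral_dominated_convergence[where w = "\<lambda>_. B'"]) (use lim bound in auto)
  then show ?thesis unfolding D0 by (simp add: LIMSEQ_const_iff)
qed

text \<open>A class closed under all operations that occur below, so that measurability and
  integrability of an observable follow from its syntax.\<close>

definition bdd :: "('v \<Rightarrow> real) \<Rightarrow> bool" where
  "bdd f \<longleftrightarrow> f \<in> borel_measurable M \<and> (\<exists>B. \<forall>x\<in>space M. \<bar>f x\<bar> \<le> B)"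

lemma bdd_I: "f \<in> borel_measurable M \<Longrightarrow> (\<And>x. x \<in> space M \<Longrightarrow> \<bar>f x\<bar> \<le> B) \<Longrightarrow> bdd f"
  by (auto simp: bdd_def)

lemma bdd_const: "bdd (\<lambda>x. c)"
  by (rule bdd_I[of _ "\<bar>c\<bar>"]) auto

lemma bdd_add: "bdd f \<Longrightarrow> bdd g \<Longrightarrow> bdd (\<lambda>x. f x + g x)"
  unfolding bdd_def by (auto, meson abs_triangle_ineq add_mono order_trans)

lemma bdd_mult:
  assumes "bdd f" "bdd g" shows "bdd (\<lambda>x. f x * g x)"
proof -
  obtain B C where "\<forall>x\<in>space M. \<bar>f x\<bar> \<le> B" "\<forall>x\<in>space M. \<bar>g x\<bar> \<le> C"
    using assms by (auto simp: bdd_def)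
  then have "\<bar>f x * g x\<bar> \<le> \<bar>B\<bar> * \<bar>C\<bar>" if "x \<in> space M" for x
    unfolding abs_mult using that by (intro mult_mono) fastforce+
  then show ?thesis using assms by (intro bdd_I) (auto simp: bdd_def)
qed

lemma bdd_minus: "bdd f \<Longrightarrow> bdd (\<lambda>x. - f x)"
  by (auto simp: bdd_def)

lemma bdd_diff: "bdd f \<Longrightarrow> bdd g \<Longrightarrow> bdd (\<lambda>x. f x - g x)"
  using bdd_add[OF _ bdd_minus] by simp

lemma bdd_divide: "bdd f \<Longrightarrow> bdd (\<lambda>x. f x / c)"
  using bdd_mult[OF _ bdd_const[of "1 / c"], of f] by simp

lemma bdd_power: "bdd f \<Longrightarrow> bdd (\<lambda>x. f x ^ n)"
  by (induction n) (auto intro: bdd_mult bdd_const)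

lemma bdd_sum: "(\<And>i. i \<in> I \<Longrightarrow> bdd (f i)) \<Longrightarrow> bdd (\<lambda>x. \<Sum>i\<in>I. f i x)"
  by (induction I rule: infinite_finite_induct) (auto intro: bdd_add bdd_const)

lemma bdd_exp:
  assumes "bdd f" shows "bdd (\<lambda>x. exp (f x))"
proof -
  obtain B where "\<forall>x\<in>space M. \<bar>f x\<bar> \<le> B" using assms by (auto simp: bdd_def)
  then have "\<bar>exp (f x)\<bar> \<le> exp B" if "x \<in> space M" for x using that by fastforce
  then show ?thesis using assms by (intro bdd_I) (auto simp: bdd_def)
qed

lemma measurable_schur [measurable]: "(\<lambda>x. schur (A x) m r s) \<in> borel_measurable M"
  by (induction m arbitrary: r s) simp_all

lemma bdd_schur: "m \<le> p \<Longrightarrow> r < p \<Longrightarrow> s < p \<Longrightarrow> bdd (\<lambda>x. schur (A x) m r s)"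
  using proj_mat.schur_abs_le_one[OF proj] by (intro bdd_I) auto

lemma bdd_entry: "r < p \<Longrightarrow> s < p \<Longrightarrow> bdd (\<lambda>x. A x r s)"
  using proj_mat.abs_le_one[OF proj] by (intro bdd_I) auto

lemma bdd_gain: "l < p \<Longrightarrow> r < p \<Longrightarrow> bdd (\<lambda>x. gain (A x) r l)"
  using proj_mat.gain_le_one[OF proj] proj_mat.gain_nonneg[OF proj]
  by (intro bdd_I[of _ 1]) (auto simp: abs_of_nonneg, simp add: gain_def)

lemmas bdd_intros = bdd_const bdd_add bdd_mult bdd_minus bdd_diff bdd_divide bdd_power bdd_sum
  bdd_exp bdd_schur bdd_entry bdd_gain

end

section \<open>Exponentially tilted measures\<close>

context rotation_invariant_projection
begin

lemma rot2_in:
  assumes "i < j" "j < p" "x \<in> space M"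
  obtains y where "y \<in> space M" "rot2 i j t (A x) = A y"
proof -
  obtain T where "T \<in> M \<rightarrow>\<^sub>M M" "A (T x) = rot2 i j t (A x)" using rotation[OF assms(1,2), of t] assms(3) by auto
  then show ?thesis using that[of "T x"] measurable_space[of T M M x] assms(3) by auto
qed

text \<open>The exponent of the Gibbs weight in the eigenbasis, where Tr (V^T S V) involves only the
  diagonal entries of the projection; see \<open>mat_trace_eigenbasis\<close>.\<close>

definition energy :: "real \<Rightarrow> (nat \<Rightarrow> real) \<Rightarrow> 'v \<Rightarrow> real" where
  "energy b lam x = real p * b / 2 * (\<Sum>l<p. lam l * A x l l)"

definition partition_fun :: "real \<Rightarrow> (nat \<Rightarrow> real) \<Rightarrow> real" where
  "partition_fun b lam = (\<integral>x. exp (energy b lam x) \<partial>M)"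

definition tilted :: "real \<Rightarrow> (nat \<Rightarrow> real) \<Rightarrow> 'v measure" where
  "tilted b lam = density M (\<lambda>x. ennreal (exp (energy b lam x) / partition_fun b lam))"

lemma space_tilted [simp]: "space (tilted b lam) = space M"
  and sets_tilted [simp]: "sets (tilted b lam) = sets M"
  by (simp_all add: tilted_def)

lemma measurable_tilted [simp]: "borel_measurable (tilted b lam) = borel_measurable M"
  by (rule measurable_cong_sets) simp_all

lemma bdd_energy: "bdd (energy b lam)"
  unfolding energy_def by (intro bdd_intros) auto

lemma bdd_integrable:
  assumes "bdd f" shows "integrable M f"
proof -
  from assms obtain B where "f \<in> borel_measurable M" "\<forall>x\<in>space M. \<bar>f x\<bar> \<le> B" by (auto simp: bdd_def)
  then show ?thesis by (intro integrable_const_bound[of _ B] AE_I2) auto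
qed

lemma partition_fun_pos: "0 < partition_fun b lam"
proof -
  obtain B where B: "\<forall>x\<in>space M. \<bar>energy b lam x\<bar> \<le> B" using bdd_energy[of b lam] by (auto simp: bdd_def)
  have "0 < exp (- B)" by simp
  also have "exp (- B) = (\<integral>x. exp (- B) \<partial>M)" by (simp add: prob_space)
  also have "\<dots> \<le> partition_fun b lam"
    unfolding partition_fun_def
    using B by (intro integral_mono bdd_integrable bdd_intros bdd_energy) fastforce+
  finally show ?thesis .
qed

lemma prob_space_tilted: "prob_space (tilted b lam)"
proof
  have "emeasure (tilted b lam) (space M)
      = (\<integral>\<^sup>+x. ennreal (exp (energy b lam x) / partition_fun b lam) * indicator (space M) x \<partial>M)"
    using bdd_energy[of b lam] unfolding tilted_def by (intro emeasure_density) (auto simp: bdd_def)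
  also have "\<dots> = (\<integral>\<^sup>+x. ennreal (exp (energy b lam x) / partition_fun b lam) \<partial>M)"
    by (intro nn_integral_cong) simp
  also have "\<dots> = ennreal (\<integral>x. exp (energy b lam x) / partition_fun b lam \<partial>M)"
    using partition_fun_pos[of b lam]
    by (intro nn_integral_eq_integral bdd_integrable bdd_intros bdd_energy) auto
  also have "\<dots> = 1" using partition_fun_pos[of b lam] by (simp add: partition_fun_def)
  finally show "emeasure (tilted b lam) (space (tilted b lam)) = 1" by simp
qed

lemma integrable_tilted: "bdd f \<Longrightarrow> integrable (tilted b lam) f"
proof -
  assume f: "bdd f"
  interpret T: prob_space "tilted b lam" by (rule prob_space_tilted)
  from f obtain B where "f \<in> borel_measurable M" "\<forall>x\<in>space M. \<bar>f x\<bar> \<le> B" by (auto simp: bdd_def)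
  then show ?thesis by (intro T.integrable_const_bound[of _ B] AE_I2) auto
qed

lemma integral_tilted:
  assumes "bdd f"
  shows "(\<integral>x. f x \<partial>tilted b lam) = (\<integral>x. f x * exp (energy b lam x) \<partial>M) / partition_fun b lam"
proof -
  have "(\<integral>x. f x \<partial>tilted b lam) = (\<integral>x. exp (energy b lam x) / partition_fun b lam * f x \<partial>M)"
    unfolding tilted_def using assms bdd_energy[of b lam] partition_fun_pos[of b lam]
    by (intro integral_real_density) (auto simp: bdd_def)
  also have "\<dots> = (\<integral>x. (f x * exp (energy b lam x)) / partition_fun b lam \<partial>M)"
    by (simp add: mult.commute)
  finally show ?thesis by simp
qed

lemma integral_tilted_mono:
  "bdd f \<Longrightarrow> bdd g \<Longrightarrow> (\<And>x. x \<in> space M \<Longrightarrow> f x \<le> g x) \<Longrightarrow>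
    (\<integral>x. f x \<partial>tilted b lam) \<le> (\<integral>x. g x \<partial>tilted b lam)"
  by (intro integral_mono integrable_tilted) auto

lemma measure_tilted_space [simp]: "measure (tilted b lam) (space M) = 1"
  using prob_space.prob_space[OF prob_space_tilted] by simp

lemma integral_tilted_add: "bdd f \<Longrightarrow> bdd g \<Longrightarrow>
    (\<integral>x. f x + g x \<partial>tilted b lam) = (\<integral>x. f x \<partial>tilted b lam) + (\<integral>x. g x \<partial>tilted b lam)"
  by (intro Bochner_Integration.integral_add integrable_tilted)

lemma integral_tilted_diff: "bdd f \<Longrightarrow> bdd g \<Longrightarrow>
    (\<integral>x. f x - g x \<partial>tilted b lam) = (\<integral>x. f x \<partial>tilted b lam) - (\<integral>x. g x \<partial>tilted b lam)"
  by (intro Bochner_Integration.integral_diff integrable_tilted)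

lemma integral_tilted_sum: "(\<And>i. i \<in> I \<Longrightarrow> bdd (f i)) \<Longrightarrow>
    (\<integral>x. (\<Sum>i\<in>I. f i x) \<partial>tilted b lam) = (\<Sum>i\<in>I. \<integral>x. f i x \<partial>tilted b lam)"
  by (intro Bochner_Integration.integral_sum integrable_tilted)

text \<open>Integration by parts for F times the Gibbs weight: the rotation changes the exponent at
  the rate \<open>real p * b * (lam i - lam j) * A x i j\<close>, and the product rule adds this to
  F'.\<close>

lemma tilted_by_parts:
  fixes F F' :: "(nat \<Rightarrow> nat \<Rightarrow> real) \<Rightarrow> real"
  assumes ij: "i < j" "j < p"
    and F: "bdd (\<lambda>x. F (A x))" and F': "bdd (\<lambda>x. F' (A x))"
    and der: "\<And>x t. x \<in> space M \<Longrightarrow>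
      ((\<lambda>t. F (rot2 i j t (A x))) has_real_derivative F' (rot2 i j t (A x))) (at t)"
  shows "(\<integral>x. F' (A x) + F (A x) * (real p * b * (lam i - lam j) * A x i j) \<partial>tilted b lam) = 0"
proof -
  define W where "W B = exp (real p * b / 2 * (\<Sum>l<p. lam l * B l l))" for B :: "nat \<Rightarrow> nat \<Rightarrow> real"
  define G where "G B = (F' B + F B * (real p * b * (lam i - lam j) * B i j)) * W B" for B
  have W: "bdd (\<lambda>x. W (A x))" unfolding W_def by (intro bdd_intros) auto
  have WA: "W (A x) = exp (energy b lam x)" for x by (simp add: W_def energy_def)
  have FW: "bdd (\<lambda>x. F (A x) * W (A x))" by (intro bdd_intros F W)
  have bL: "bdd (\<lambda>x. F' (A x) + F (A x) * (real p * b * (lam i - lam j) * A x i j))"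
    using ij by (intro bdd_intros F F') auto
  have G: "bdd (\<lambda>x. G (A x))" unfolding G_def by (intro bdd_mult bL W)
  obtain B where B: "\<forall>x\<in>space M. \<bar>F (A x) * W (A x)\<bar> \<le> B" using FW by (auto simp: bdd_def)
  obtain B' where B': "\<forall>x\<in>space M. \<bar>G (A x)\<bar> \<le> B'" using G by (auto simp: bdd_def)
  have "((\<lambda>t. F (rot2 i j t (A x)) * W (rot2 i j t (A x))) has_real_derivative
      G (rot2 i j t (A x))) (at t)" if x: "x \<in> space M" for x t
  proof -
    have "A x j i = A x i j" using proj_mat.sym[OF proj[OF x]] .
    note dW = rot2_deriv_diag_sum[OF ij this, of lam t]
    have "((\<lambda>t. W (rot2 i j t (A x))) has_real_derivative
       W (rot2 i j t (A x)) * (real p * b / 2 * (2 * (lam i - lam j) * rot2 i j t (A x) i j))) (at t)"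
      unfolding W_def by (intro DERIV_fun_exp DERIV_cmult dW)
    from DERIV_mult[OF der[OF x] this]
    show ?thesis by (simp add: G_def algebra_simps)
  qed
  then have "(\<integral>x. G (A x) \<partial>M) = 0"
    using FW G B B' by (intro integration_by_parts[OF ij, where F = "\<lambda>B. F B * W B" and B = B and B' = B'])
      (auto simp: bdd_def)
  then show ?thesis
    unfolding integral_tilted[OF bL] by (simp add: G_def WA)
qed

text \<open>
  The rotation in the plane of coordinates \<open>i, j\<close> does not change the rows with index below \<open>m\<close>, so
  \<open>schur A m\<close> transforms like \<open>A\<close> and the projection need not be differentiated.
\<close>

lemma schur_identity:
  assumes ij: "m \<le> i" "i < j" "j < p"
    and \<phi>: "\<And>t. 0 \<le> t \<Longrightarrow> (\<phi> has_real_derivative \<phi>' t) (at t)"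
    and b\<phi>: "bdd (\<lambda>x. \<phi> (schur (A x) m i i))" and b\<phi>': "bdd (\<lambda>x. \<phi>' (schur (A x) m i i))"
  shows "(\<integral>x. 2 * \<phi>' (schur (A x) m i i) * (schur (A x) m i j)\<^sup>2
      + \<phi> (schur (A x) m i i) * (schur (A x) m j j - schur (A x) m i i)
      + \<phi> (schur (A x) m i i) * schur (A x) m i j * (real p * b * (lam i - lam j) * A x i j)
      \<partial>tilted b lam) = 0"
proof (rule tilted_by_parts[OF ij(2,3),
    where F = "\<lambda>B. \<phi> (schur B m i i) * schur B m i j" and F' = "\<lambda>B. 2 * \<phi>' (schur B m i i) * (schur B m i j)\<^sup>2
      + \<phi> (schur B m i i) * (schur B m j j - schur B m i i)"])
  show "bdd (\<lambda>x. \<phi> (schur (A x) m i i) * schur (A x) m i j)"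
    "bdd (\<lambda>x. 2 * \<phi>' (schur (A x) m i i) * (schur (A x) m i j)\<^sup>2
      + \<phi> (schur (A x) m i i) * (schur (A x) m j j - schur (A x) m i i))"
    using ij by (intro bdd_intros b\<phi> b\<phi>'; simp)+
next
  fix x t assume x: "x \<in> space M"
  have rot: "schur (rot2 i j t (A x)) m = rot2 i j t (schur (A x) m)" for t
    using ij by (intro schur_rot2) auto
  obtain y where y: "y \<in> space M" "rot2 i j t (A x) = A y" using rot2_in[OF ij(2,3) x] by blast
  \<comment> \<open>The derivative of \<phi> is given for nonnegative arguments. The rotated pivot
    is one, being the pivot of another point of the space.\<close>
  have "0 \<le> rot2 i j t (schur (A x) m) i i"
    using proj_mat.schur_diag_nonneg[OF proj[OF y(1)], of m i] y(2) rot[of t] ij by simp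
  note nonneg = this
  have sym: "schur (A x) m j i = schur (A x) m i j" and "i \<noteq> j"
    using proj_mat.schur_sym[OF proj[OF x]] ij by auto
  note dG = rot2_deriv[where A = "schur (A x) m" and t = t, OF this(2,1)]
  have "((\<lambda>t. \<phi> (rot2 i j t (schur (A x) m) i i)) has_real_derivative
      \<phi>' (rot2 i j t (schur (A x) m) i i) * (2 * rot2 i j t (schur (A x) m) i j)) (at t)"
    by (rule DERIV_chain2[OF \<phi>[OF nonneg] dG(1)])
  from DERIV_mult[OF this dG(3)]
  show "((\<lambda>t. \<phi> (schur (rot2 i j t (A x)) m i i) * schur (rot2 i j t (A x)) m i j) has_real_derivative
      2 * \<phi>' (schur (rot2 i j t (A x)) m i i) * (schur (rot2 i j t (A x)) m i j)\<^sup>2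
      + \<phi> (schur (rot2 i j t (A x)) m i i) * (schur (rot2 i j t (A x)) m j j - schur (rot2 i j t (A x)) m i i)) (at t)"
    unfolding rot by (simp add: power2_eq_square algebra_simps)
qed

lemma entry_identity:
  assumes "i < j" "j < p"
  shows "real p * b * (lam i - lam j) * (\<integral>x. (A x i j)\<^sup>2 \<partial>tilted b lam)
    = (\<integral>x. A x i i \<partial>tilted b lam) - (\<integral>x. A x j j \<partial>tilted b lam)"
proof -
  have "(\<integral>x. (A x j j - A x i i) + real p * b * (lam i - lam j) * (A x i j)\<^sup>2 \<partial>tilted b lam) = 0"
    using schur_identity[of 0 i j "\<lambda>_. 1" "\<lambda>_. 0" b lam] assms
    by (simp add: bdd_const power2_eq_square mult_ac)
  then show ?thesis
    using assms by (subst (asm) integral_tilted_add, simp_all add: bdd_intros integral_tilted_diff)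
qed

end

section \<open>Inequalities in fixed dimension\<close>

context rotation_invariant_projection
begin

lemma bdd_inverse_shift:
  assumes "bdd f" "\<And>x. x \<in> space M \<Longrightarrow> 0 \<le> f x" "0 < \<epsilon>"
  shows "bdd (\<lambda>x. 1 / (f x + \<epsilon>))"
proof (rule bdd_I[of _ "1 / \<epsilon>"])
  fix x assume "x \<in> space M"
  then show "\<bar>1 / (f x + \<epsilon>)\<bar> \<le> 1 / \<epsilon>"
    using assms(2)[of x] assms(3) by (auto intro!: divide_left_mono simp: add_nonneg_pos)
qed (use assms(1) in \<open>auto simp: bdd_def\<close>)

lemma sum_diag_tail_le:
  assumes "x \<in> space M" shows "(\<Sum>j\<in>{m..<p}. A x j j) \<le> real k"
proof -
  interpret proj_mat p k "A x" by (rule proj[OF assms])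
  have "(\<Sum>j\<in>{m..<p}. A x j j) \<le> (\<Sum>j<p. A x j j)"
    by (rule sum_mono2) (auto simp: diag_nonneg)
  then show ?thesis using trace by simp
qed

lemma integral_diag_tail_le: "(\<Sum>j\<in>{m..<p}. \<integral>x. A x j j \<partial>tilted b lam) \<le> real k"
proof -
  have "(\<Sum>j\<in>{m..<p}. \<integral>x. A x j j \<partial>tilted b lam) = (\<integral>x. (\<Sum>j\<in>{m..<p}. A x j j) \<partial>tilted b lam)"
    by (rule integral_tilted_sum[symmetric]) (simp add: bdd_entry)
  also have "\<dots> \<le> (\<integral>x. real k \<partial>tilted b lam)"
    by (intro integral_tilted_mono bdd_intros sum_diag_tail_le) auto
  finally show ?thesis by simp
qed

lemma integral_diag_nonneg: "i < p \<Longrightarrow> 0 \<le> (\<integral>x. A x i i \<partial>tilted b lam)"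
  by (intro integral_nonneg_AE AE_I2) (simp add: proj_mat.diag_nonneg[OF proj])

lemma integral_diag_le_one: "i < p \<Longrightarrow> (\<integral>x. A x i i \<partial>tilted b lam) \<le> 1"
  using integral_tilted_mono[of "\<lambda>x. A x i i" "\<lambda>_. 1" b lam] proj_mat.diag_le_one[OF proj]
  by (simp add: bdd_intros)

lemma integral_row:
  assumes "i < p" "m \<le> p"
  shows "(\<integral>x. A x i i \<partial>tilted b lam)
    = (\<Sum>j<m. \<integral>x. (A x i j)\<^sup>2 \<partial>tilted b lam) + (\<Sum>j\<in>{m..<p}. \<integral>x. (A x i j)\<^sup>2 \<partial>tilted b lam)"
proof -
  have "(\<integral>x. A x i i \<partial>tilted b lam) = (\<integral>x. (\<Sum>j<p. (A x i j)\<^sup>2) \<partial>tilted b lam)"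
    by (intro Bochner_Integration.integral_cong) (auto simp: proj_mat.sum_square[OF proj] assms)
  also have "\<dots> = (\<Sum>j<p. \<integral>x. (A x i j)\<^sup>2 \<partial>tilted b lam)"
    using assms by (intro integral_tilted_sum bdd_intros) auto
  also have "{..<p} = {..<m} \<union> {m..<p}" using assms by auto
  also have "sum f \<dots> = sum f {..<m} + sum f {m..<p}" for f :: "nat \<Rightarrow> real"
    by (rule sum.union_disjoint) auto
  finally show ?thesis .
qed

text \<open>The identity is summed over the bulk without dividing by b, so the bound stays useful as
  b tends to 0. The trace bounds the sum of the E \<open>A x j j\<close>, the row norm that of the E
  \<open>(A x i j)\<^sup>2\<close>.\<close>

lemma diag_bound_high_temperature:
  assumes "i < k" "k \<le> p" "0 \<le> b" "0 \<le> lam i" and nonneg: "\<And>j. k \<le> j \<Longrightarrow> j < p \<Longrightarrow> 0 \<le> lam j"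
  shows "(real p - real k) * (\<integral>x. A x i i \<partial>tilted b lam) \<le> real k + real p * b * lam i"
proof -
  let ?E = "\<lambda>f. \<integral>x. f x \<partial>tilted b lam"
  have "?E (\<lambda>x. A x i i) \<le> ?E (\<lambda>x. A x j j) + real p * b * lam i * ?E (\<lambda>x. (A x i j)\<^sup>2)"
    if "j \<in> {k..<p}" for j
  proof -
    have "0 \<le> ?E (\<lambda>x. (A x i j)\<^sup>2)" by simp
    then have "real p * b * (lam i - lam j) * ?E (\<lambda>x. (A x i j)\<^sup>2) \<le> real p * b * lam i * ?E (\<lambda>x. (A x i j)\<^sup>2)"
      using assms that nonneg[of j] by (intro mult_right_mono mult_left_mono) auto
    moreover have "real p * b * (lam i - lam j) * ?E (\<lambda>x. (A x i j)\<^sup>2)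
        = ?E (\<lambda>x. A x i i) - ?E (\<lambda>x. A x j j)"
      using that assms by (intro entry_identity) auto
    ultimately show ?thesis by linarith
  qed
  then have "(\<Sum>j\<in>{k..<p}. ?E (\<lambda>x. A x i i))
      \<le> (\<Sum>j\<in>{k..<p}. ?E (\<lambda>x. A x j j) + real p * b * lam i * ?E (\<lambda>x. (A x i j)\<^sup>2))"
    by (rule sum_mono)
  also have "\<dots> = (\<Sum>j\<in>{k..<p}. ?E (\<lambda>x. A x j j)) + real p * b * lam i * (\<Sum>j\<in>{k..<p}. ?E (\<lambda>x. (A x i j)\<^sup>2))"
    by (simp add: sum.distrib sum_distrib_left)
  also have "(\<Sum>j\<in>{k..<p}. ?E (\<lambda>x. (A x i j)\<^sup>2)) \<le> 1"
    using integral_row[of i k b lam] integral_diag_le_one[of i b lam] assms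
      sum_nonneg[of "{..<k}" "\<lambda>j. ?E (\<lambda>x. (A x i j)\<^sup>2)"] by simp
  finally show ?thesis
    using integral_diag_tail_le[where m = k and b = b and lam = lam] assms by (simp add: mult_left_mono of_nat_diff)
qed

text \<open>For m = k this is H(\<gamma> i) / \<beta> at finite p. The start m is variable because
  the argument for separated spikes sums over all j > i, lower spikes included.\<close>

definition shift :: "real \<Rightarrow> (nat \<Rightarrow> real) \<Rightarrow> nat \<Rightarrow> nat \<Rightarrow> real" where
  "shift b lam m i = (\<Sum>j\<in>{m..<p}. 1 / (lam i - lam j)) / (real p * b)"

text \<open>\<open>entry_identity\<close>, divided by its coefficient and summed over j \<ge> m,
  leaves one error: a weighted sum of the E \<open>A x j j\<close>. It is nonnegative, and at most k
  / (p b g) because the weights are at most 1 / (p b g) and the trace is k.\<close>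

lemma overlap_bounds:
  assumes "i < m" "m \<le> p" "0 < b" "0 < g" and gap: "\<And>j. m \<le> j \<Longrightarrow> j < p \<Longrightarrow> g \<le> lam i - lam j"
  shows "(1 - shift b lam m i) * (\<integral>x. A x i i \<partial>tilted b lam) \<le> (\<Sum>l<m. \<integral>x. (A x i l)\<^sup>2 \<partial>tilted b lam)"
    and "(\<Sum>l<m. \<integral>x. (A x i l)\<^sup>2 \<partial>tilted b lam)
      \<le> (1 - shift b lam m i) * (\<integral>x. A x i i \<partial>tilted b lam) + real k / (real p * b * g)"
proof -
  let ?E = "\<lambda>f. \<integral>x. f x \<partial>tilted b lam"
  have p: "0 < real p" using assms by simp
  define w where "w j = 1 / (real p * b * (lam i - lam j))" for j
  have pos: "0 < lam i - lam j" if "j \<in> {m..<p}" for j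
    using less_le_trans[OF assms(4) gap[of j]] that by simp
  have "?E (\<lambda>x. (A x i j)\<^sup>2) = w j * ?E (\<lambda>x. A x i i) - w j * ?E (\<lambda>x. A x j j)" if "j \<in> {m..<p}" for j
  proof -
    let ?c = "real p * b * (lam i - lam j)"
    have "?c \<noteq> 0" using pos[OF that] assms p by simp
    moreover have "?c * ?E (\<lambda>x. (A x i j)\<^sup>2) = ?E (\<lambda>x. A x i i) - ?E (\<lambda>x. A x j j)"
      using that assms by (intro entry_identity) auto
    ultimately have "?E (\<lambda>x. (A x i j)\<^sup>2) = (?E (\<lambda>x. A x i i) - ?E (\<lambda>x. A x j j)) / ?c"
      by (metis nonzero_mult_div_cancel_left)
    then show ?thesis by (simp add: w_def diff_divide_distrib)
  qed
  then have tail: "(\<Sum>j\<in>{m..<p}. ?E (\<lambda>x. (A x i j)\<^sup>2))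
      = (\<Sum>j\<in>{m..<p}. w j) * ?E (\<lambda>x. A x i i) - (\<Sum>j\<in>{m..<p}. w j * ?E (\<lambda>x. A x j j))"
    by (simp add: sum_subtractf sum_distrib_right)
  have sw: "(\<Sum>j\<in>{m..<p}. w j) = shift b lam m i"
    by (simp add: shift_def w_def sum_divide_distrib mult_ac)
  have w0: "0 \<le> w j" "w j \<le> 1 / (real p * b * g)" if "j \<in> {m..<p}" for j
    using pos[OF that] gap[of j] that assms p by (auto simp: w_def intro!: divide_left_mono mult_left_mono)
  have "0 \<le> (\<Sum>j\<in>{m..<p}. w j * ?E (\<lambda>x. A x j j))"
    using w0 integral_diag_nonneg by (intro sum_nonneg mult_nonneg_nonneg) auto
  moreover have "(\<Sum>j\<in>{m..<p}. w j * ?E (\<lambda>x. A x j j)) \<le> (\<Sum>j\<in>{m..<p}. 1 / (real p * b * g) * ?E (\<lambda>x. A x j j))"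
    using w0 integral_diag_nonneg by (intro sum_mono mult_right_mono) auto
  moreover have "\<dots> = 1 / (real p * b * g) * (\<Sum>j\<in>{m..<p}. ?E (\<lambda>x. A x j j))" by (simp add: sum_distrib_left)
  moreover have "\<dots> \<le> 1 / (real p * b * g) * real k"
    using assms p by (intro mult_left_mono integral_diag_tail_le) auto
  ultimately show "(1 - shift b lam m i) * ?E (\<lambda>x. A x i i) \<le> (\<Sum>l<m. ?E (\<lambda>x. (A x i l)\<^sup>2))"
    and "(\<Sum>l<m. ?E (\<lambda>x. (A x i l)\<^sup>2)) \<le> (1 - shift b lam m i) * ?E (\<lambda>x. A x i i) + real k / (real p * b * g)"
    using integral_row[of i m b lam] tail sw assms by (simp_all add: algebra_simps)
qed

lemma shift_nonneg:
  assumes "0 < b" "\<And>j. m \<le> j \<Longrightarrow> j < p \<Longrightarrow> lam j \<le> lam i"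
  shows "0 \<le> shift b lam m i"
  unfolding shift_def using assms by (intro divide_nonneg_nonneg sum_nonneg) auto

text \<open>\<open>schur_identity\<close> for 1 / (t + \<epsilon>) is divided by p b (lam i - lam j)
  and summed over j > i. The weights are replaced by their upper bound 1 / (p b g) where they
  multiply the negative squares of row i, and by their lower bound 1 / (p b \<Lambda>) where they
  multiply the positive diagonal; in the drift they add up to \<open>shift\<close>.\<close>

lemma schur_inequality:
  assumes i: "i < k" "i < p" and b: "0 < b" and g: "0 < g" and \<epsilon>: "0 < \<epsilon>"
    and gap: "\<And>j. i < j \<Longrightarrow> j < p \<Longrightarrow> g \<le> lam i - lam j \<and> lam i - lam j \<le> \<Lambda>"
    and \<Lambda>: "0 < \<Lambda>"
  shows "(\<integral>x. schur (A x) i i i / (schur (A x) i i i + \<epsilon>) * (1 - shift b lam (Suc i) i - A x i i)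
     + 1 / (b * \<Lambda>) / real p * ((1 - schur (A x) i i i) / (schur (A x) i i i + \<epsilon>))
     - 2 / (b * g) / real p * (schur (A x) i i i / (schur (A x) i i i + \<epsilon>)\<^sup>2) \<partial>tilted b lam) \<le> 0"
proof -
  let ?E = "\<lambda>f. \<integral>x. f x \<partial>tilted b lam"
  define d where "d x = schur (A x) i i i" for x
  define P where "P x = 1 / (d x + \<epsilon>)" for x
  define q where "q j x = schur (A x) i i j" for j x
  define r where "r j x = schur (A x) i j j" for j x
  define w where "w j = 1 / (real p * b * (lam i - lam j))" for j
  define J where "J = {Suc i..<p}"
  have J: "J = {i<..<p}" by (auto simp: J_def)
  have p: "0 < real p" using i by simp
  have d0: "0 \<le> d x" "d x \<le> 1" if "x \<in> space M" for x
    using proj_mat.schur_diag_nonneg[OF proj[OF that]] proj_mat.schur_diag_le_one[OF proj[OF that]] i by (auto simp: d_def)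
  have bd: "bdd d" unfolding d_def[abs_def] using i by (intro bdd_schur) auto
  have bP: "bdd P" unfolding P_def[abs_def] by (intro bdd_inverse_shift bd d0 \<epsilon>)
  have bq: "bdd (q j)" and br: "bdd (r j)" and bA: "bdd (\<lambda>x. A x i j)" if "j \<in> J" for j
    unfolding q_def[abs_def] r_def[abs_def] using that i by (auto intro!: bdd_schur bdd_entry simp: J)
  have bAi: "bdd (\<lambda>x. A x i i)" using i by (intro bdd_entry)
  note bdds = bdd_intros bd bP bq br bA bAi
  have P_alt: "P x = 1 / (d x + \<epsilon>)" "P x * P x = 1 / (d x + \<epsilon>)\<^sup>2" for x
    by (simp_all add: P_def power2_eq_square)
  have eq: "?E (\<lambda>x. P x * q j x * A x i j) = w j * ?E (\<lambda>x. 2 * (P x * P x) * (q j x)\<^sup>2 - P x * r j x + P x * d x)"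
    if j: "j \<in> J" for j
  proof -
    let ?c = "real p * b * (lam i - lam j)"
    have gj: "0 < lam i - lam j" using gap[of j] j g by (auto simp: J)
    have "0 = ?E (\<lambda>x. 2 * (- (1 / (d x + \<epsilon>)\<^sup>2)) * (q j x)\<^sup>2 + 1 / (d x + \<epsilon>) * (r j x - d x)
        + 1 / (d x + \<epsilon>) * q j x * (?c * A x i j))"
      unfolding d_def q_def r_def
    proof (rule schur_identity[symmetric, where \<phi> = "\<lambda>t. 1 / (t + \<epsilon>)" and \<phi>' = "\<lambda>t. - (1 / (t + \<epsilon>)\<^sup>2)"])
      show "((\<lambda>t. 1 / (t + \<epsilon>)) has_real_derivative - (1 / (t + \<epsilon>)\<^sup>2)) (at t)" if "0 \<le> t" for t
        using that \<epsilon> by (auto intro!: derivative_eq_intros simp: power2_eq_square)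
      show "bdd (\<lambda>x. 1 / (schur (A x) i i i + \<epsilon>))" using bP unfolding P_def[abs_def] d_def .
      show "bdd (\<lambda>x. - (1 / (schur (A x) i i i + \<epsilon>)\<^sup>2))"
        using bdd_minus[OF bdd_power[OF bP, of 2]] unfolding P_def[abs_def] d_def by (simp add: power_divide)
    qed (use j in \<open>auto simp: J\<close>)
    also have "\<dots> = ?E (\<lambda>x. ?c * (P x * q j x * A x i j) - (2 * (P x * P x) * (q j x)\<^sup>2 - P x * r j x + P x * d x))"
      unfolding P_alt(2)[symmetric] P_alt(1)[symmetric] by (simp add: algebra_simps)
    also have "\<dots> = ?c * ?E (\<lambda>x. P x * q j x * A x i j) - ?E (\<lambda>x. 2 * (P x * P x) * (q j x)\<^sup>2 - P x * r j x + P x * d x)"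
      using j by (subst integral_tilted_diff) (auto intro!: bdds)
    finally show ?thesis using gj p b by (simp add: w_def field_simps)
  qed
  have w: "0 \<le> w j" "w j \<le> 1 / (real p * b * g)" "1 / (real p * b * \<Lambda>) \<le> w j" if "j \<in> J" for j
  proof -
    have "g \<le> lam i - lam j" "lam i - lam j \<le> \<Lambda>" using gap[of j] that by (auto simp: J)
    then show "0 \<le> w j" "w j \<le> 1 / (real p * b * g)" "1 / (real p * b * \<Lambda>) \<le> w j"
      using g b p \<Lambda> by (auto simp: w_def intro!: divide_left_mono mult_left_mono)
  qed
  have sw: "(\<Sum>j\<in>J. w j) = shift b lam (Suc i) i"
    by (simp add: shift_def w_def J_def sum_divide_distrib mult_ac)
  \<comment> \<open>G has mean exactly 0, and the integrand of the claim lies below it at every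
    point.\<close>
  define G where "G x = (\<Sum>j\<in>J. P x * q j x * A x i j - w j * (2 * (P x * P x) * (q j x)\<^sup>2 - P x * r j x + P x * d x))" for x
  have bG: "bdd G" unfolding G_def[abs_def] by (intro bdds) auto
  have "?E G = (\<Sum>j\<in>J. ?E (\<lambda>x. P x * q j x * A x i j - w j * (2 * (P x * P x) * (q j x)\<^sup>2 - P x * r j x + P x * d x)))"
    unfolding G_def by (intro integral_tilted_sum bdds) auto
  also have "\<dots> = (\<Sum>j\<in>J. ?E (\<lambda>x. P x * q j x * A x i j) - w j * ?E (\<lambda>x. 2 * (P x * P x) * (q j x)\<^sup>2 - P x * r j x + P x * d x))"
    by (intro sum.cong refl, subst integral_tilted_diff) (auto intro!: bdds)
  also have "\<dots> = 0" by (simp add: eq)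
  finally have EG: "?E G = 0" .
  have "d x * P x * (1 - shift b lam (Suc i) i - A x i i) + 1 / (b * \<Lambda>) / real p * ((1 - d x) * P x)
     - 2 / (b * g) / real p * (d x * (P x * P x)) \<le> G x" if x: "x \<in> space M" for x
  proof -
    interpret proj_mat p k "A x" by (rule proj[OF x])
    have Px: "0 \<le> P x" using d0[OF x] \<epsilon> by (simp add: P_def)
    have r0: "0 \<le> r j x" if "j \<in> J" for j using that i by (auto simp: r_def J intro!: schur_diag_nonneg)
    have 1: "(\<Sum>j\<in>J. P x * q j x * A x i j) = P x * (d x * (1 - A x i i))"
      unfolding mult.assoc sum_distrib_left[symmetric] using schur_tail_mult[OF i(2)] by (simp add: J q_def d_def)
    have "(\<Sum>j\<in>J. w j * (2 * (P x * P x) * (q j x)\<^sup>2)) \<le> (\<Sum>j\<in>J. 1 / (real p * b * g) * (2 * (P x * P x) * (q j x)\<^sup>2))"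
      using w by (intro sum_mono mult_right_mono) auto
    also have "\<dots> = 2 / (b * g) / real p * (P x * P x) * (\<Sum>j\<in>J. (q j x)\<^sup>2)"
      by (simp add: sum_distrib_left sum_divide_distrib mult_ac)
    also have "\<dots> \<le> 2 / (b * g) / real p * (P x * P x) * d x"
      using schur_tail_square[OF i(2)] p b g unfolding J q_def d_def by (intro mult_left_mono) auto
    finally have 2: "(\<Sum>j\<in>J. w j * (2 * (P x * P x) * (q j x)\<^sup>2)) \<le> 2 / (b * g) / real p * (d x * (P x * P x))"
      by (simp add: mult_ac)
    have "1 / (b * \<Lambda>) / real p * ((1 - d x) * P x) \<le> 1 / (b * \<Lambda>) / real p * ((\<Sum>j\<in>J. r j x) * P x)"
      using schur_tail_trace[OF i] p b \<Lambda> Px unfolding J r_def d_def by (intro mult_left_mono mult_right_mono) auto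
    also have "\<dots> = (\<Sum>j\<in>J. 1 / (real p * b * \<Lambda>) * (P x * r j x))"
      by (simp add: sum_distrib_left sum_distrib_right sum_divide_distrib mult_ac)
    also have "\<dots> \<le> (\<Sum>j\<in>J. w j * (P x * r j x))"
      using w r0 Px by (intro sum_mono mult_right_mono mult_nonneg_nonneg) auto
    finally have 3: "1 / (b * \<Lambda>) / real p * ((1 - d x) * P x) \<le> (\<Sum>j\<in>J. w j * (P x * r j x))" .
    have 4: "(\<Sum>j\<in>J. w j * (P x * d x)) = shift b lam (Suc i) i * (P x * d x)"
      by (simp add: sw[symmetric] sum_distrib_right)
    have "G x = (\<Sum>j\<in>J. P x * q j x * A x i j) - (\<Sum>j\<in>J. w j * (2 * (P x * P x) * (q j x)\<^sup>2))
       + (\<Sum>j\<in>J. w j * (P x * r j x)) - (\<Sum>j\<in>J. w j * (P x * d x))"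
      by (simp add: G_def sum_subtractf[symmetric] sum.distrib[symmetric] algebra_simps)
    then show ?thesis using 1 2 3 4 by (simp add: algebra_simps)
  qed
  then have "?E (\<lambda>x. d x * P x * (1 - shift b lam (Suc i) i - A x i i) + 1 / (b * \<Lambda>) / real p * ((1 - d x) * P x)
     - 2 / (b * g) / real p * (d x * (P x * P x))) \<le> ?E G"
    by (intro integral_tilted_mono bG bdds)
  then show ?thesis unfolding EG P_alt d_def by (simp add: power2_eq_square)
qed


text \<open>Write a for \<open>A x i i\<close> and d for the pivot. Up to O(1 / p) and a multiple of
  a - d, the integrand of \<open>schur_inequality\<close> is at least a (c - a) / c plus a multiple
  of (d - c)^2. Its mean is at most 0, whereas E a (c - a) \<ge> - O(1 / p); this leaves no room for
  the square.\<close>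

lemma schur_concentration:
  assumes i: "i < k" "i < p" and b: "0 < b" and g: "0 < g"
    and gap: "\<And>j. i < j \<Longrightarrow> j < p \<Longrightarrow> g \<le> lam i - lam j \<and> lam i - lam j \<le> \<Lambda>"
    and \<Lambda>: "0 < \<Lambda>"
    and c: "c = 1 - shift b lam (Suc i) i" and c1: "0 < c\<^sub>1" "c\<^sub>1 \<le> c"
    and M_def: "M' = 32 / (b * g * c\<^sub>1)" and pM: "4 * M' \<le> c\<^sub>1 * real p"
  shows "min 1 (min (c\<^sub>1 / 16) (1 / (b * \<Lambda>) / (2 * M'))) * (\<integral>x. (schur (A x) i i i - c)\<^sup>2 \<partial>tilted b lam)
    \<le> (1 + 1 / c\<^sub>1) * (\<integral>x. A x i i - schur (A x) i i i \<partial>tilted b lam)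
      + (2 * M' / c\<^sub>1 + 4 / (b * g) / c\<^sub>1 + real k / (b * g) / c\<^sub>1) / real p"
proof -
  let ?E = "\<lambda>f. \<integral>x. f x \<partial>tilted b lam"
  define d where "d x = schur (A x) i i i" for x
  define a where "a x = A x i i" for x
  define \<epsilon> where "\<epsilon> = M' / real p"
  define \<delta> where "\<delta> = min 1 (min (c\<^sub>1 / 16) (1 / (b * \<Lambda>) / (2 * M')))"
  define K where "K = (2 * M' / c\<^sub>1 + 2 * (2 / (b * g)) / c\<^sub>1) / real p"
  have p: "0 < real p" using i by simp
  have M': "0 < M'" using M_def b g c1 by simp
  have \<epsilon>: "0 < \<epsilon>" using M' p by (simp add: \<epsilon>_def)
  have "0 \<le> shift b lam (Suc i) i"
  proof (rule shift_nonneg[OF b])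
    fix j assume "Suc i \<le> j" "j < p"
    then show "lam j \<le> lam i" using gap[of j] g by auto
  qed
  then have c_le: "c \<le> 1" using c by simp
  have c0: "0 < c" using c1 by simp
  have d0: "0 \<le> d x" "d x \<le> a x" "a x \<le> 1" if "x \<in> space M" for x
    using proj_mat.schur_diag_nonneg[OF proj[OF that]] proj_mat.schur_diag_le[OF proj[OF that]]
      proj_mat.diag_le_one[OF proj[OF that]] i by (auto simp: d_def a_def)
  have bd: "bdd d" unfolding d_def[abs_def] using i by (intro bdd_schur) auto
  have ba: "bdd a" unfolding a_def[abs_def] using i by (intro bdd_entry) auto
  have bP: "bdd (\<lambda>x. 1 / (d x + \<epsilon>))" by (intro bdd_inverse_shift bd d0 \<epsilon>)
  have bQ: "bdd (\<lambda>x. f x / (d x + \<epsilon>))" "bdd (\<lambda>x. f x / (d x + \<epsilon>)\<^sup>2)" if "bdd f" for f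
    using bdd_mult[OF that bP] bdd_mult[OF that bdd_power[OF bP, of 2]] by (simp_all add: power_divide)
  define G where "G x = d x / (d x + \<epsilon>) * (c - a x) + 1 / (b * \<Lambda>) / real p * ((1 - d x) / (d x + \<epsilon>))
     - 2 / (b * g) / real p * (d x / (d x + \<epsilon>)\<^sup>2)" for x
  have bG: "bdd G" unfolding G_def[abs_def] by (intro bdd_intros bQ bd ba)
  have EG: "?E G \<le> 0"
    unfolding G_def d_def a_def c using i b g \<epsilon> gap \<Lambda> by (rule schur_inequality)
  have "\<delta> * (d x - c)\<^sup>2 + a x * (c - a x) / c - (1 + 1 / c\<^sub>1) * (a x - d x) - K \<le> G x" if x: "x \<in> space M" for x
  proof -
    note d0 = d0[OF x]
    have dx1: "d x \<le> 1" using d0 by simp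
    \<comment> \<open>\<open>M'\<close> is the M of \<open>real_quadratic_pointwise\<close> for C =
      2 / (b g), hence the 32 in its definition.\<close>
    have M16: "M' = 16 * (2 / (b * g)) / c\<^sub>1" using b g c1 by (simp add: M_def)
    have 1: "d x * (c - d x) / c + \<delta> * (c - d x)\<^sup>2 - K
       \<le> d x / (d x + \<epsilon>) * (c - d x) + 1 / (b * \<Lambda>) / real p * ((1 - d x) / (d x + \<epsilon>))
         - 2 / (b * g) / real p * (d x / (d x + \<epsilon>)\<^sup>2)"
      unfolding \<delta>_def K_def \<epsilon>_def
      by (rule real_quadratic_pointwise[OF c1 c_le d0(1) dx1 _ _ M16 p pM]) (use b g \<Lambda> in auto)
    have "d x / (d x + \<epsilon>) * (a x - d x) \<le> 1 * (a x - d x)"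
      using d0 \<epsilon> by (intro mult_right_mono) auto
    then have 2: "d x / (d x + \<epsilon>) * (c - d x) \<le> d x / (d x + \<epsilon>) * (c - a x) + (a x - d x)"
      by (simp add: algebra_simps diff_divide_distrib)
    have "a x * (c - a x) - d x * (c - d x) = (a x - d x) * (c - a x - d x)" by (simp add: algebra_simps)
    also have "\<dots> \<le> (a x - d x) * c" using d0 by (intro mult_left_mono) auto
    also have "\<dots> \<le> (a x - d x) * 1" using d0 c_le by (intro mult_left_mono) auto
    finally have "(a x * (c - a x) - d x * (c - d x)) / c \<le> (a x - d x) / c"
      using c0 by (intro divide_right_mono) auto
    also have "\<dots> \<le> (a x - d x) / c\<^sub>1" using d0 c1 by (intro divide_left_mono) auto
    finally have 3: "a x * (c - a x) / c - d x * (c - d x) / c \<le> (1 / c\<^sub>1) * (a x - d x)" by (simp add: diff_divide_distrib)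
    show ?thesis using 1 2 3 by (simp add: G_def power2_commute[of "d x"] algebra_simps)
  qed
  then have "?E (\<lambda>x. \<delta> * (d x - c)\<^sup>2 + a x * (c - a x) / c - (1 + 1 / c\<^sub>1) * (a x - d x) - K) \<le> ?E G"
    by (intro integral_tilted_mono bG bdd_intros bd ba)
  also have "?E (\<lambda>x. \<delta> * (d x - c)\<^sup>2 + a x * (c - a x) / c - (1 + 1 / c\<^sub>1) * (a x - d x) - K)
      = \<delta> * ?E (\<lambda>x. (d x - c)\<^sup>2) + ?E (\<lambda>x. a x * (c - a x)) / c - (1 + 1 / c\<^sub>1) * ?E (\<lambda>x. a x - d x) - K"
    by (simp only: integral_tilted_add integral_tilted_diff bdd_intros bd ba) (simp add: integral_tilted_diff bd ba)
  finally have main: "\<delta> * ?E (\<lambda>x. (d x - c)\<^sup>2) \<le> (1 + 1 / c\<^sub>1) * ?E (\<lambda>x. a x - d x) + K - ?E (\<lambda>x. a x * (c - a x)) / c"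
    using EG by simp
  \<comment> \<open>E a^2 is the term l = i of this sum, so the bound yields E a^2 \<le> c E a + O(1
    / p).\<close>
  have "(\<Sum>l<Suc i. ?E (\<lambda>x. (A x i l)\<^sup>2)) \<le> c * ?E a + real k / (real p * b * g)"
    unfolding a_def c using i b g gap by (intro overlap_bounds(2)) auto
  moreover have "?E (\<lambda>x. (a x)\<^sup>2) \<le> (\<Sum>l<Suc i. ?E (\<lambda>x. (A x i l)\<^sup>2))"
    unfolding a_def by (rule member_le_sum[of i "{..<Suc i}" "\<lambda>l. ?E (\<lambda>x. (A x i l)\<^sup>2)"]) auto
  moreover have "?E (\<lambda>x. a x * (c - a x)) = c * ?E a - ?E (\<lambda>x. (a x)\<^sup>2)"
    by (simp add: right_diff_distrib integral_tilted_diff bdd_intros ba power2_eq_square mult.commute)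
  ultimately have "- ?E (\<lambda>x. a x * (c - a x)) \<le> real k / (real p * b * g)" by simp
  then have "- ?E (\<lambda>x. a x * (c - a x)) / c \<le> real k / (real p * b * g) / c"
    using c0 by (intro divide_right_mono) auto
  also have "\<dots> \<le> real k / (real p * b * g) / c\<^sub>1"
    using c1 c0 b g p by (intro divide_left_mono) auto
  also have "\<dots> = real k / (b * g) / c\<^sub>1 / real p" by simp
  finally have "- ?E (\<lambda>x. a x * (c - a x)) / c \<le> real k / (b * g) / c\<^sub>1 / real p" .
  with main show ?thesis
    unfolding \<delta>_def[symmetric] d_def a_def by (simp add: K_def add_divide_distrib)
qed

lemma square_integral_tilted_le:
  assumes "bdd f"
  shows "(\<integral>x. f x \<partial>tilted b lam)\<^sup>2 \<le> (\<integral>x. (f x)\<^sup>2 \<partial>tilted b lam)"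
proof -
  let ?m = "\<integral>x. f x \<partial>tilted b lam"
  have "0 \<le> (\<integral>x. (f x - ?m)\<^sup>2 \<partial>tilted b lam)" by simp
  also have "\<dots> = (\<integral>x. (f x)\<^sup>2 - 2 * ?m * f x + ?m\<^sup>2 \<partial>tilted b lam)"
    by (intro Bochner_Integration.integral_cong refl) (simp add: power2_eq_square algebra_simps)
  also have "\<dots> = (\<integral>x. (f x)\<^sup>2 \<partial>tilted b lam) - 2 * ?m * ?m + ?m\<^sup>2"
    by (simp only: integral_tilted_add integral_tilted_diff bdd_intros assms) simp
  finally show ?thesis by (simp add: power2_eq_square)
qed

text \<open>The change of parameters multiplies the weight by exp (s T) with s \<ge> 0, which
  favours large values of T. With t0 the original mean, (T - t0) (exp (s T) - exp (s t0)) is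
  nonnegative at every point, and integrating it against the original weight gives the
  claim.\<close>

lemma tilted_monotone:
  fixes \<tau> :: "nat \<Rightarrow> real"
  assumes "0 \<le> b" "0 \<le> \<eta>"
  defines "T \<equiv> \<lambda>x. \<Sum>l<p. \<tau> l * A x l l"
  shows "(\<integral>x. T x \<partial>tilted b lam) \<le> (\<integral>x. T x \<partial>tilted b (\<lambda>l. lam l + \<eta> * \<tau> l))"
proof -
  define s where "s = real p * b / 2 * \<eta>"
  have s: "0 \<le> s" using assms by (simp add: s_def)
  let ?lam' = "\<lambda>l. lam l + \<eta> * \<tau> l"
  have en: "energy b ?lam' x = energy b lam x + s * T x" for x
    by (simp add: energy_def T_def s_def sum.distrib sum_distrib_left algebra_simps)
  have bT: "bdd T" unfolding T_def by (intro bdd_intros) auto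
  define t0 where "t0 = (\<integral>x. T x \<partial>tilted b lam)"
  have Z: "0 < partition_fun b lam" "0 < partition_fun b ?lam'" by (rule partition_fun_pos)+
  note bdds = bdd_intros bT bdd_energy
  have i1: "(\<integral>x. T x * exp (energy b lam x) \<partial>M) = t0 * partition_fun b lam"
    using integral_tilted[OF bT, of b lam] Z by (simp add: t0_def)
  have "0 = exp (s * t0) * ((\<integral>x. T x * exp (energy b lam x) \<partial>M) - t0 * (\<integral>x. exp (energy b lam x) \<partial>M))"
    unfolding i1 by (simp add: partition_fun_def)
  also have "\<dots> = (\<integral>x. exp (s * t0) * (T x * exp (energy b lam x) - t0 * exp (energy b lam x)) \<partial>M)"
    by (simp add: bdd_integrable bdds)
  also have "\<dots> \<le> (\<integral>x. (T x - t0) * exp (energy b ?lam' x) \<partial>M)"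
  proof (intro integral_mono bdd_integrable bdds)
    fix x
    have "0 \<le> (T x - t0) * (exp (s * T x) - exp (s * t0))"
    proof (cases "t0 \<le> T x")
      case True
      then have "s * t0 \<le> s * T x" using s by (rule mult_left_mono)
      then show ?thesis using True by (intro mult_nonneg_nonneg) auto
    next
      case False
      then have "s * T x \<le> s * t0" using s by (intro mult_left_mono) auto
      then show ?thesis using False by (intro mult_nonpos_nonpos) auto
    qed
    then have "0 \<le> exp (energy b lam x) * ((T x - t0) * (exp (s * T x) - exp (s * t0)))" by simp
    then show "exp (s * t0) * (T x * exp (energy b lam x) - t0 * exp (energy b lam x)) \<le> (T x - t0) * exp (energy b ?lam' x)"
      unfolding en exp_add by (simp add: algebra_simps)
  qed
  also have "\<dots> = (\<integral>x. T x * exp (energy b ?lam' x) \<partial>M) - t0 * partition_fun b ?lam'"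
    by (simp add: left_diff_distrib bdd_integrable bdds partition_fun_def)
  finally have "t0 \<le> (\<integral>x. T x * exp (energy b ?lam' x) \<partial>M) / partition_fun b ?lam'"
    using Z by (simp add: le_divide_eq)
  then show ?thesis unfolding integral_tilted[OF bT] t0_def .
qed

end

section \<open>Separated spikes\<close>

locale gibbs_sequence =
  fixes k :: nat and M :: "nat \<Rightarrow> 'v measure" and A :: "nat \<Rightarrow> 'v \<Rightarrow> nat \<Rightarrow> nat \<Rightarrow> real"
    and b :: "nat \<Rightarrow> real" and \<beta> :: real
  assumes rip: "k < p \<Longrightarrow> rotation_invariant_projection (M p) p k (A p)"
    and b_lim: "b \<longlonglongrightarrow> \<beta>" and \<beta>_pos: "0 < \<beta>"
begin

definition gibbs_mean :: "(nat \<Rightarrow> nat \<Rightarrow> real) \<Rightarrow> nat \<Rightarrow> ('v \<Rightarrow> real) \<Rightarrow> real" where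
  "gibbs_mean lam p f = (\<integral>x. f x \<partial>rotation_invariant_projection.tilted (M p) p (A p) (b p) (lam p))"

definition shift_seq :: "(nat \<Rightarrow> nat \<Rightarrow> real) \<Rightarrow> nat \<Rightarrow> nat \<Rightarrow> nat \<Rightarrow> real" where
  "shift_seq lam p m i = (\<Sum>j\<in>{m..<p}. 1 / (lam p i - lam p j)) / (real p * b p)"

lemma b_pos: "\<forall>\<^sub>F p in sequentially. 0 < b p"
  using order_tendstoD(1)[OF b_lim \<beta>_pos] .

lemma null_over_p: "a \<longlonglongrightarrow> l \<Longrightarrow> (\<lambda>p. a p / real p) \<longlonglongrightarrow> 0"
  by (rule tendsto_divide_0) (auto intro: filterlim_at_top_imp_at_infinity filterlim_real_sequentially)

lemma null_gap: "(\<lambda>p. c / (real p * b p * g)) \<longlonglongrightarrow> 0"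
proof -
  have "(\<lambda>p. (c / g / b p) / real p) \<longlonglongrightarrow> 0"
    using \<beta>_pos b_lim by (intro null_over_p[of _ "c / g / \<beta>"] tendsto_intros) auto
  then show ?thesis by (simp add: mult_ac)
qed

text \<open>The additional summands are fewer than k and each is at most 1 / g, so after division by
  p b they vanish: lower spikes do not enter the limit.\<close>

lemma shift_seq_Suc:
  assumes "i < k" "0 < g"
    and gap: "\<forall>\<^sub>F p in sequentially. \<forall>j. i < j \<longrightarrow> j < p \<longrightarrow> g \<le> lam p i - lam p j"
    and lim: "(\<lambda>p. shift_seq lam p k i) \<longlonglongrightarrow> h"
  shows "(\<lambda>p. shift_seq lam p (Suc i) i) \<longlonglongrightarrow> h"
proof -
  have eq: "shift_seq lam p (Suc i) i = (\<Sum>j\<in>{Suc i..<k}. 1 / (lam p i - lam p j)) / (real p * b p) + shift_seq lam p k i"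
    if "k < p" for p
  proof -
    have "{Suc i..<p} = {Suc i..<k} \<union> {k..<p}" using assms that by auto
    then have "(\<Sum>j\<in>{Suc i..<p}. 1 / (lam p i - lam p j))
        = (\<Sum>j\<in>{Suc i..<k}. 1 / (lam p i - lam p j)) + (\<Sum>j\<in>{k..<p}. 1 / (lam p i - lam p j))"
      by (simp only:) (rule sum.union_disjoint; auto)
    then show ?thesis by (simp add: shift_seq_def add_divide_distrib)
  qed
  have "(\<lambda>p. (\<Sum>j\<in>{Suc i..<k}. 1 / (lam p i - lam p j)) / (real p * b p)) \<longlonglongrightarrow> 0"
  proof (rule Lim_null_comparison[OF _ null_gap[of "real k" g]])
    show "\<forall>\<^sub>F p in sequentially. norm ((\<Sum>j\<in>{Suc i..<k}. 1 / (lam p i - lam p j)) / (real p * b p))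
        \<le> real k / (real p * b p * g)"
      using gap b_pos eventually_gt_at_top[of k]
    proof eventually_elim
      case (elim p)
      have le: "0 \<le> 1 / (lam p i - lam p j) \<and> 1 / (lam p i - lam p j) \<le> 1 / g" if "j \<in> {Suc i..<k}" for j
      proof -
        have "g \<le> lam p i - lam p j" using elim that by auto
        then show ?thesis using assms(2) by (auto intro!: divide_left_mono)
      qed
      then have "(\<Sum>j\<in>{Suc i..<k}. 1 / (lam p i - lam p j)) \<le> of_nat (card {Suc i..<k}) * (1 / g)"
        by (intro sum_bounded_above) auto
      also have "\<dots> \<le> real k * (1 / g)" using assms(2) by (intro mult_right_mono) auto
      finally have "(\<Sum>j\<in>{Suc i..<k}. 1 / (lam p i - lam p j)) / (real p * b p) \<le> real k * (1 / g) / (real p * b p)"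
        using elim by (intro divide_right_mono) auto
      moreover have "0 \<le> (\<Sum>j\<in>{Suc i..<k}. 1 / (lam p i - lam p j))" using le by (intro sum_nonneg) auto
      ultimately show ?case using elim by (simp add: mult_ac)
    qed
  qed
  from tendsto_add[OF this lim] have "(\<lambda>p. (\<Sum>j\<in>{Suc i..<k}. 1 / (lam p i - lam p j)) / (real p * b p) + shift_seq lam p k i) \<longlonglongrightarrow> h"
    by simp
  moreover have "\<forall>\<^sub>F p in sequentially. (\<Sum>j\<in>{Suc i..<k}. 1 / (lam p i - lam p j)) / (real p * b p) + shift_seq lam p k i
      = shift_seq lam p (Suc i) i"
    using eventually_gt_at_top[of k] by eventually_elim (simp add: eq)
  ultimately show ?thesis by (rule Lim_transform_eventually)
qed

text \<open>The two claims support each other. The gains of row i in earlier steps add up to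
  \<open>A i i\<close> minus the pivot, so their vanishing lets \<open>schur_concentration\<close>
  act at i. Concentration of pivot i at a positive value then makes the gains of later rows in step
  i vanish by \<open>gain_bound\<close>, since separation gives E \<open>(A r i)\<^sup>2\<close>
  \<le> 1 / (p b g).\<close>

lemma schur_limit:
  assumes gap: "0 < g" "0 < \<Lambda>" "\<forall>\<^sub>F p in sequentially. \<forall>i<k. \<forall>j. i < j \<longrightarrow> j < p \<longrightarrow>
      g \<le> lam p i - lam p j \<and> lam p i - lam p j \<le> \<Lambda>"
    and shift: "\<And>i. i < k \<Longrightarrow> (\<lambda>p. shift_seq lam p k i) \<longlonglongrightarrow> h i"
  shows "i < k \<Longrightarrow> (\<And>l. l \<le> i \<Longrightarrow> h l < 1) \<Longrightarrow>
      (\<lambda>p. gibbs_mean lam p (\<lambda>x. (schur (A p x) i i i - (1 - h i))\<^sup>2)) \<longlonglongrightarrow> 0 \<and>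
      (\<forall>r. i < r \<longrightarrow> r < k \<longrightarrow> (\<lambda>p. gibbs_mean lam p (\<lambda>x. gain (A p x) r i)) \<longlonglongrightarrow> 0)"
proof (induction i rule: less_induct)
  case (less i)
  then have ik: "i < k" and hl: "\<And>l. l \<le> i \<Longrightarrow> h l < 1" by auto
  have IH: "(\<lambda>p. gibbs_mean lam p (\<lambda>x. gain (A p x) r l)) \<longlonglongrightarrow> 0" if "l < i" "l < r" "r < k" for l r
    using less.IH[of l] that ik hl by auto
  define c where "c = 1 - h i"
  have c: "0 < c" using hl by (simp add: c_def)
  \<comment> \<open>At finite p the centre is \<open>cp p\<close>, which only tends to c; halving c
    gives a lower bound that holds eventually.\<close>
  define c\<^sub>1 where "c\<^sub>1 = c / 2"
  have c1: "0 < c\<^sub>1" "c\<^sub>1 < c" using c by (auto simp: c\<^sub>1_def)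
  define cp where "cp p = 1 - shift_seq lam p (Suc i) i" for p
  have gap_i: "\<forall>\<^sub>F p in sequentially. \<forall>j. i < j \<longrightarrow> j < p \<longrightarrow> g \<le> lam p i - lam p j"
    using gap(3) by eventually_elim (use ik in auto)
  have cp: "cp \<longlonglongrightarrow> c"
    unfolding cp_def[abs_def] c_def by (intro tendsto_intros shift_seq_Suc[OF ik gap(1) gap_i] shift ik)
  define M' where "M' t = 32 / (t * g * c\<^sub>1)" for t
  define \<delta> where "\<delta> t = min 1 (min (c\<^sub>1 / 16) (1 / (t * \<Lambda>) / (2 * M' t)))" for t
  define K where "K t = 2 * M' t / c\<^sub>1 + 4 / (t * g) / c\<^sub>1 + real k / (t * g) / c\<^sub>1" for t
  have M'_lim: "(\<lambda>p. M' (b p)) \<longlonglongrightarrow> M' \<beta>"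
    unfolding M'_def using \<beta>_pos gap c1 by (intro tendsto_intros b_lim) auto
  have M'_pos: "0 < M' t" if "0 < t" for t using that gap c1 by (simp add: M'_def)
  have \<delta>_lim: "(\<lambda>p. \<delta> (b p)) \<longlonglongrightarrow> \<delta> \<beta>"
    unfolding \<delta>_def using \<beta>_pos gap c1 M'_pos[OF \<beta>_pos] by (intro tendsto_intros b_lim M'_lim tendsto_min) auto
  have \<delta>_pos: "0 < \<delta> t" if "0 < t" for t using that M'_pos[OF that] gap c1 by (simp add: \<delta>_def)
  have K_lim: "(\<lambda>p. K (b p)) \<longlonglongrightarrow> K \<beta>"
    unfolding K_def using \<beta>_pos gap c1 by (intro tendsto_intros b_lim M'_lim) auto
  have ev_M: "\<forall>\<^sub>F p in sequentially. 4 * M' (b p) \<le> c\<^sub>1 * real p"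
  proof -
    have "(\<lambda>p. 4 * M' (b p) / real p) \<longlonglongrightarrow> 0" by (intro null_over_p[of _ "4 * M' \<beta>"] tendsto_intros M'_lim)
    from order_tendstoD(2)[OF this c1(1)] show ?thesis
      using eventually_gt_at_top[of 0] by eventually_elim (simp add: divide_less_eq)
  qed
  have ad: "(\<lambda>p. gibbs_mean lam p (\<lambda>x. A p x i i - schur (A p x) i i i)) \<longlonglongrightarrow> 0"
  proof -
    have "(\<lambda>p. \<Sum>l<i. gibbs_mean lam p (\<lambda>x. gain (A p x) i l)) \<longlonglongrightarrow> 0"
      using ik by (intro tendsto_null_sum IH) auto
    moreover have "\<forall>\<^sub>F p in sequentially. (\<Sum>l<i. gibbs_mean lam p (\<lambda>x. gain (A p x) i l))
        = gibbs_mean lam p (\<lambda>x. A p x i i - schur (A p x) i i i)"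
      using eventually_gt_at_top[of k]
    proof eventually_elim
      case (elim p)
      interpret R: rotation_invariant_projection "M p" p k "A p" by (rule rip[OF elim])
      have "gibbs_mean lam p (\<lambda>x. A p x i i - schur (A p x) i i i) = gibbs_mean lam p (\<lambda>x. \<Sum>l<i. gain (A p x) i l)"
        unfolding gibbs_mean_def
        by (intro Bochner_Integration.integral_cong refl) (simp add: proj_mat.schur_diag[OF R.proj])
      then show ?case unfolding gibbs_mean_def using elim ik R.integral_tilted_sum[of "{..<i}" "\<lambda>l x. gain (A p x) i l" "b p" "lam p"]
        by (simp add: R.bdd_gain)
    qed
    ultimately show ?thesis by (rule Lim_transform_eventually)
  qed
  have lim_p: "(\<lambda>p. gibbs_mean lam p (\<lambda>x. (schur (A p x) i i i - cp p)\<^sup>2)) \<longlonglongrightarrow> 0"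
  proof (rule tendsto_sandwich)
    show "\<forall>\<^sub>F p in sequentially. 0 \<le> gibbs_mean lam p (\<lambda>x. (schur (A p x) i i i - cp p)\<^sup>2)"
      by (simp add: gibbs_mean_def)
    show "(\<lambda>p. ((1 + 1 / c\<^sub>1) * gibbs_mean lam p (\<lambda>x. A p x i i - schur (A p x) i i i) + K (b p) / real p) / \<delta> (b p)) \<longlonglongrightarrow> 0"
      using tendsto_divide[OF tendsto_add[OF tendsto_mult_right_zero[OF ad, of "1 + 1 / c\<^sub>1"]
          null_over_p[OF K_lim]] \<delta>_lim] \<delta>_pos[OF \<beta>_pos] by simp
    show "\<forall>\<^sub>F p in sequentially. gibbs_mean lam p (\<lambda>x. (schur (A p x) i i i - cp p)\<^sup>2)
        \<le> ((1 + 1 / c\<^sub>1) * gibbs_mean lam p (\<lambda>x. A p x i i - schur (A p x) i i i) + K (b p) / real p) / \<delta> (b p)"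
      using eventually_gt_at_top[of k] gap(3) b_pos ev_M order_tendstoD(1)[OF cp c1(2)]
    proof eventually_elim
      case (elim p)
      interpret R: rotation_invariant_projection "M p" p k "A p" by (rule rip[OF elim(1)])
      have "\<delta> (b p) * gibbs_mean lam p (\<lambda>x. (schur (A p x) i i i - cp p)\<^sup>2)
        \<le> (1 + 1 / c\<^sub>1) * gibbs_mean lam p (\<lambda>x. A p x i i - schur (A p x) i i i) + K (b p) / real p"
        unfolding gibbs_mean_def \<delta>_def K_def
      proof (rule R.schur_concentration[where g = g])
        show "cp p = 1 - R.shift (b p) (lam p) (Suc i) i" by (simp add: cp_def shift_seq_def R.shift_def)
        show "M' (b p) = 32 / (b p * g * c\<^sub>1)" by (simp add: M'_def)
        show "g \<le> lam p i - lam p j \<and> lam p i - lam p j \<le> \<Lambda>" if "i < j" "j < p" for j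
          using elim(2) ik that by auto
      qed (use elim ik gap c1 in auto)
      then show ?case using \<delta>_pos[OF elim(3)] by (simp add: le_divide_eq mult.commute)
    qed
  qed simp
  have lim: "(\<lambda>p. gibbs_mean lam p (\<lambda>x. (schur (A p x) i i i - c)\<^sup>2)) \<longlonglongrightarrow> 0"
  proof (rule tendsto_sandwich)
    show "\<forall>\<^sub>F p in sequentially. 0 \<le> gibbs_mean lam p (\<lambda>x. (schur (A p x) i i i - c)\<^sup>2)"
      by (simp add: gibbs_mean_def)
    show "(\<lambda>p. 2 * gibbs_mean lam p (\<lambda>x. (schur (A p x) i i i - cp p)\<^sup>2) + 2 * (cp p - c)\<^sup>2) \<longlonglongrightarrow> 0"
      by (rule tendsto_eq_intros lim_p cp refl | simp)+
    show "\<forall>\<^sub>F p in sequentially. gibbs_mean lam p (\<lambda>x. (schur (A p x) i i i - c)\<^sup>2)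
        \<le> 2 * gibbs_mean lam p (\<lambda>x. (schur (A p x) i i i - cp p)\<^sup>2) + 2 * (cp p - c)\<^sup>2"
      using eventually_gt_at_top[of k]
    proof eventually_elim
      case (elim p)
      interpret R: rotation_invariant_projection "M p" p k "A p" by (rule rip[OF elim])
      have sq: "(s - c)\<^sup>2 \<le> 2 * (s - cp p)\<^sup>2 + 2 * (cp p - c)\<^sup>2" for s
      proof -
        have "0 \<le> ((s - cp p) - (cp p - c))\<^sup>2" by simp
        then show ?thesis by (simp add: power2_eq_square algebra_simps)
      qed
      have bs: "R.bdd (\<lambda>x. schur (A p x) i i i)" using elim ik by (intro R.bdd_schur) auto
      have "gibbs_mean lam p (\<lambda>x. (schur (A p x) i i i - c)\<^sup>2)
          \<le> gibbs_mean lam p (\<lambda>x. 2 * (schur (A p x) i i i - cp p)\<^sup>2 + 2 * (cp p - c)\<^sup>2)"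
        unfolding gibbs_mean_def by (intro R.integral_tilted_mono R.bdd_intros bs sq)
      also have "\<dots> = 2 * gibbs_mean lam p (\<lambda>x. (schur (A p x) i i i - cp p)\<^sup>2) + 2 * (cp p - c)\<^sup>2"
        unfolding gibbs_mean_def by (subst R.integral_tilted_add) (simp_all add: R.bdd_intros bs)
      finally show ?case .
    qed
  qed simp
  have "(\<lambda>p. gibbs_mean lam p (\<lambda>x. gain (A p x) r i)) \<longlonglongrightarrow> 0" if r: "i < r" "r < k" for r
  proof -
    have entry: "(\<lambda>p. gibbs_mean lam p (\<lambda>x. (A p x r i)\<^sup>2)) \<longlonglongrightarrow> 0"
    proof (rule tendsto_sandwich[OF _ _ tendsto_const null_gap[of 1 g]])
      show "\<forall>\<^sub>F p in sequentially. 0 \<le> gibbs_mean lam p (\<lambda>x. (A p x r i)\<^sup>2)" by (simp add: gibbs_mean_def)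
      show "\<forall>\<^sub>F p in sequentially. gibbs_mean lam p (\<lambda>x. (A p x r i)\<^sup>2) \<le> 1 / (real p * b p * g)"
        using eventually_gt_at_top[of k] gap(3) b_pos
      proof eventually_elim
        case (elim p)
        interpret R: rotation_invariant_projection "M p" p k "A p" by (rule rip[OF elim(1)])
        have eq: "gibbs_mean lam p (\<lambda>x. (A p x r i)\<^sup>2) = gibbs_mean lam p (\<lambda>x. (A p x i r)\<^sup>2)"
          unfolding gibbs_mean_def by (intro Bochner_Integration.integral_cong refl) (simp add: proj_mat.sym[OF R.proj, of _ r i])
        have "real p * b p * g * gibbs_mean lam p (\<lambda>x. (A p x i r)\<^sup>2)
            \<le> real p * b p * (lam p i - lam p r) * gibbs_mean lam p (\<lambda>x. (A p x i r)\<^sup>2)"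
          using elim r ik by (intro mult_right_mono mult_left_mono) (auto simp: gibbs_mean_def)
        also have "\<dots> = gibbs_mean lam p (\<lambda>x. A p x i i) - gibbs_mean lam p (\<lambda>x. A p x r r)"
          unfolding gibbs_mean_def using elim r by (intro R.entry_identity) auto
        also have "\<dots> \<le> 1"
          using R.integral_diag_le_one[of i "b p" "lam p"] R.integral_diag_nonneg[of r "b p" "lam p"] elim r
          by (simp add: gibbs_mean_def)
        finally show ?case unfolding eq using elim gap(1) by (simp add: le_divide_eq mult.commute)
      qed
    qed
    show ?thesis
    proof (rule tendsto_sandwich)
      show "\<forall>\<^sub>F p in sequentially. 0 \<le> gibbs_mean lam p (\<lambda>x. gain (A p x) r i)"
        using eventually_gt_at_top[of k]
      proof eventually_elim
        case (elim p)
        interpret R: rotation_invariant_projection "M p" p k "A p" by (rule rip[OF elim(1)])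
        show ?case unfolding gibbs_mean_def
          using elim ik by (intro integral_nonneg_AE AE_I2) (auto intro: proj_mat.gain_nonneg[OF R.proj])
      qed
      show "(\<lambda>p. 4 / c\<^sup>2 * gibbs_mean lam p (\<lambda>x. (schur (A p x) i i i - c)\<^sup>2)
          + 2 / c * (real i + 1) * (gibbs_mean lam p (\<lambda>x. (A p x r i)\<^sup>2) + (\<Sum>m<i. gibbs_mean lam p (\<lambda>x. gain (A p x) r m)))) \<longlonglongrightarrow> 0"
      proof -
        have "(\<lambda>p. \<Sum>m<i. gibbs_mean lam p (\<lambda>x. gain (A p x) r m)) \<longlonglongrightarrow> 0"
          using r by (intro tendsto_null_sum IH) auto
        from tendsto_add[OF tendsto_mult_right_zero[OF lim, of "4 / c\<^sup>2"]
            tendsto_mult_right_zero[OF tendsto_add_zero[OF entry this], of "2 / c * (real i + 1)"]]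
        show ?thesis by simp
      qed
      show "\<forall>\<^sub>F p in sequentially. gibbs_mean lam p (\<lambda>x. gain (A p x) r i)
          \<le> 4 / c\<^sup>2 * gibbs_mean lam p (\<lambda>x. (schur (A p x) i i i - c)\<^sup>2)
          + 2 / c * (real i + 1) * (gibbs_mean lam p (\<lambda>x. (A p x r i)\<^sup>2) + (\<Sum>m<i. gibbs_mean lam p (\<lambda>x. gain (A p x) r m)))"
        using eventually_gt_at_top[of k]
      proof eventually_elim
        case (elim p)
        interpret R: rotation_invariant_projection "M p" p k "A p" by (rule rip[OF elim(1)])
        have bs: "R.bdd (\<lambda>x. schur (A p x) i i i)" "R.bdd (\<lambda>x. A p x r i)"
          and bg: "m \<le> i \<Longrightarrow> R.bdd (\<lambda>x. gain (A p x) r m)" for m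
          using elim ik r by (auto intro!: R.bdd_schur R.bdd_entry R.bdd_gain)
        have bsum: "R.bdd (\<lambda>x. \<Sum>m<i. gain (A p x) r m)" by (intro R.bdd_sum bg) auto
        have lin: "(\<integral>x. s * f x + t * (u x + v x) \<partial>R.tilted (b p) (lam p))
            = s * (\<integral>x. f x \<partial>R.tilted (b p) (lam p))
              + t * ((\<integral>x. u x \<partial>R.tilted (b p) (lam p)) + (\<integral>x. v x \<partial>R.tilted (b p) (lam p)))"
          if "R.bdd f" "R.bdd u" "R.bdd v" for s t f u v
          using that by (simp add: R.integral_tilted_add R.bdd_add R.bdd_mult R.bdd_const)
        have "gibbs_mean lam p (\<lambda>x. gain (A p x) r i) \<le> gibbs_mean lam p (\<lambda>x. 4 / c\<^sup>2 * (schur (A p x) i i i - c)\<^sup>2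
            + 2 / c * (real i + 1) * ((A p x r i)\<^sup>2 + (\<Sum>m<i. gain (A p x) r m)))"
          unfolding gibbs_mean_def using elim ik r c
          by (intro R.integral_tilted_mono R.bdd_intros bs bg bsum proj_mat.gain_bound[OF R.proj]) auto
        also have "\<dots> = 4 / c\<^sup>2 * gibbs_mean lam p (\<lambda>x. (schur (A p x) i i i - c)\<^sup>2)
          + 2 / c * (real i + 1) * (gibbs_mean lam p (\<lambda>x. (A p x r i)\<^sup>2) + gibbs_mean lam p (\<lambda>x. \<Sum>m<i. gain (A p x) r m))"
          unfolding gibbs_mean_def by (intro lin R.bdd_intros bs bsum)
        also have "gibbs_mean lam p (\<lambda>x. \<Sum>m<i. gain (A p x) r m) = (\<Sum>m<i. gibbs_mean lam p (\<lambda>x. gain (A p x) r m))"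
          unfolding gibbs_mean_def by (intro R.integral_tilted_sum bg) auto
        finally show ?case .
      qed
    qed simp
  qed
  with lim show ?case by (simp add: c_def)
qed

end

section \<open>Convergence of the bulk to the Hilbert transform\<close>

lemma bulk_tendsto:
  fixes f :: "real \<Rightarrow> real"
  assumes \<mu>: "real_distribution \<mu>" "weak_conv_m (\<lambda>p. bulk_distribution p k (lam p)) \<mu>"
    and f: "\<And>x. isCont f x" "\<And>x. norm (f x) \<le> B"
  shows "(\<lambda>p. (\<Sum>j\<in>{k..<p}. f (lam p j)) / real p) \<longlonglongrightarrow> (\<integral>t. f t \<partial>\<mu>)"
\<comment> \<open>For p \<le> k the bulk is empty and its distribution is no probability measure,
  hence the offset k + 1. The factor (n + 1) / (n + k + 1) below turns the average over p - k
  eigenvalues into a sum divided by p.\<close>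
proof (rule LIMSEQ_offset[where k = "Suc k"])
  define \<nu> where "\<nu> n = bulk_distribution (n + Suc k) k (lam (n + Suc k))" for n
  have meas: "lam p \<in> uniform_count_measure {k..<p} \<rightarrow>\<^sub>M borel" for p
    by (auto simp: measurable_def space_uniform_count_measure sets_uniform_count_measure)
  have f_meas: "f \<in> borel_measurable borel"
    using f(1) by (intro borel_measurable_continuous_onI continuous_at_imp_continuous_on) auto
  have "real_distribution (\<nu> n)" for n
  proof -
    interpret prob_space "uniform_count_measure {k..<n + Suc k}"
      by (rule prob_space_uniform_count_measure) auto
    show ?thesis unfolding \<nu>_def bulk_distribution_def using meas by (rule real_distribution_distr)
  qed
  moreover have "weak_conv_m \<nu> \<mu>"
    unfolding \<nu>_def weak_conv_m_def weak_conv_def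
  proof (intro allI impI)
    fix x assume "isCont (cdf \<mu>) x"
    then have "(\<lambda>n. cdf (bulk_distribution n k (lam n)) x) \<longlonglongrightarrow> cdf \<mu> x"
      using \<mu>(2) by (simp add: weak_conv_m_def weak_conv_def)
    then show "(\<lambda>n. cdf (bulk_distribution (n + Suc k) k (lam (n + Suc k))) x) \<longlonglongrightarrow> cdf \<mu> x"
      by (rule LIMSEQ_ignore_initial_segment)
  qed
  ultimately have "(\<lambda>n. integral\<^sup>L (\<nu> n) f) \<longlonglongrightarrow> integral\<^sup>L \<mu> f"
    using \<mu>(1) f by (intro weak_conv_imp_integral_bdd_continuous_conv)
  moreover have "(\<lambda>n. real (Suc n) / real (n + Suc k)) \<longlonglongrightarrow> 1"
    by real_asymp
  ultimately have "(\<lambda>n. integral\<^sup>L (\<nu> n) f * (real (Suc n) / real (n + Suc k))) \<longlonglongrightarrow> integral\<^sup>L \<mu> f * 1"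
    by (rule tendsto_mult)
  moreover have "integral\<^sup>L (\<nu> n) f * (real (Suc n) / real (n + Suc k))
      = (\<Sum>j\<in>{k..<n + Suc k}. f (lam (n + Suc k) j)) / real (n + Suc k)" for n
  proof -
    have "card {k..<n + Suc k} = Suc n" by simp
    then show ?thesis
      unfolding \<nu>_def bulk_distribution_def integral_distr[OF meas f_meas]
        integral_uniform_count_measure[OF finite_atLeastLessThan]
      by (simp del: sum.op_ivl_Suc of_nat_Suc)
  qed
  ultimately show "(\<lambda>n. (\<Sum>j\<in>{k..<n + Suc k}. f (lam (n + Suc k) j)) / real (n + Suc k)) \<longlonglongrightarrow> integral\<^sup>L \<mu> f"
    by simp
qed

lemma inverse_diff_bound:
  fixes x y t c :: real
  assumes "0 < c" "c \<le> x - t" "c \<le> y - t"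
  shows "\<bar>1 / (y - t) - 1 / (x - t)\<bar> \<le> \<bar>y - x\<bar> / c\<^sup>2"
proof -
  have "1 / (y - t) - 1 / (x - t) = (x - y) / ((y - t) * (x - t))"
    using assms by (simp add: field_simps)
  then have "\<bar>1 / (y - t) - 1 / (x - t)\<bar> = \<bar>y - x\<bar> / ((y - t) * (x - t))"
    using assms by (simp add: abs_divide abs_mult abs_minus_commute)
  also have "\<dots> \<le> \<bar>y - x\<bar> / (c * c)"
    using assms by (intro divide_left_mono mult_mono mult_pos_pos) auto
  finally show ?thesis by (simp add: power2_eq_square)
qed

section \<open>The upper edge l of the bulk, limit of its largest eigenvalue\<close>

context
  fixes \<mu> :: "real measure" and k :: nat and lam :: "nat \<Rightarrow> nat \<Rightarrow> real" and l :: real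
  assumes \<mu>: "real_distribution \<mu>" "weak_conv_m (\<lambda>p. bulk_distribution p k (lam p)) \<mu>"
    and sorted: "\<And>p i j. i \<le> j \<Longrightarrow> j < p \<Longrightarrow> lam p j \<le> lam p i"
    and edge: "(\<lambda>p. lam p k) \<longlonglongrightarrow> l"
begin

lemma eventually_bulk_le:
  assumes "l < m"
  shows "\<forall>\<^sub>F p in sequentially. \<forall>j. k \<le> j \<longrightarrow> j < p \<longrightarrow> lam p j \<le> m"
  using order_tendstoD(2)[OF edge assms]
  by eventually_elim (meson sorted less_imp_le order_trans)

text \<open>A bounded continuous function that is positive exactly beyond m vanishes on the bulk
  eventually, so its integral against the weak limit is 0.\<close>

lemma AE_bulk_le:
  assumes "l < m" shows "AE t in \<mu>. t \<le> m"
proof -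
  interpret real_distribution \<mu> by (rule \<mu>)
  define g where "g t = max 0 (min 1 (t - m))" for t :: real
  have g: "isCont g t" "norm (g t) \<le> 1" for t
    unfolding g_def by (auto intro!: continuous_intros)
  have "(\<lambda>p. (\<Sum>j\<in>{k..<p}. g (lam p j)) / real p) \<longlonglongrightarrow> integral\<^sup>L \<mu> g"
    by (rule bulk_tendsto[OF \<mu> g])
  moreover have "\<forall>\<^sub>F p in sequentially. (\<Sum>j\<in>{k..<p}. g (lam p j)) / real p = 0"
    using eventually_bulk_le[OF assms] by eventually_elim (auto simp: g_def intro!: sum.neutral)
  ultimately have "integral\<^sup>L \<mu> g = 0"
    using LIMSEQ_unique[OF _ tendsto_eventually] by blast
  moreover have "g \<in> borel_measurable \<mu>" by (auto simp: g_def[abs_def])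
  moreover have "integrable \<mu> g" using g(2) calculation(2) by (intro integrable_const_bound[of _ 1]) auto
  ultimately have "AE t in \<mu>. g t = 0"
    using integral_nonneg_eq_0_iff_AE[of \<mu> g] by (auto simp: g_def)
  then show ?thesis by eventually_elim (auto simp: g_def max_def min_def split: if_splits)
qed

text \<open>The kernel 1 / (x - t) is not an admissible test function because of its pole. Capping t
  at a level m between l and x removes the pole and changes nothing \<mu>-almost everywhere or,
  eventually, at the bulk eigenvalues. Moving the argument from x to \<open>xs p\<close> costs a
  Lipschitz error.\<close>

lemma bulk_hilbert:
  assumes "l < x" "xs \<longlonglongrightarrow> x"
  shows "(\<lambda>p. (\<Sum>j\<in>{k..<p}. 1 / (xs p - lam p j)) / real p) \<longlonglongrightarrow> hilbert_transform \<mu> x"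
proof -
  interpret real_distribution \<mu> by (rule \<mu>)
  \<comment> \<open>With m at distance d above l and x at distance 3 d above m, any argument within
    d of x still stays more than d above m.\<close>
  define d where "d = (x - l) / 4"
  define m where "m = l + d"
  have d: "0 < d" "l < m" "x = m + 3 * d" using assms(1) by (auto simp: d_def m_def field_simps)
  define f where "f t = 1 / (x - min t m)" for t
  have pos: "3 * d \<le> x - min t m" for t using d by auto
  have nz: "x - min t m \<noteq> 0" for t using pos[of t] d by auto
  have f: "isCont f t" "norm (f t) \<le> 1 / (3 * d)" for t
    using pos[of t] nz[of t] d unfolding f_def by (auto intro!: continuous_intros divide_left_mono)
  have "AE t in \<mu>. f t = 1 / (x - t)" using AE_bulk_le[OF d(2)] by eventually_elim (simp add: f_def)
  moreover have "f \<in> borel_measurable \<mu>" by (auto simp: f_def[abs_def])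
  ultimately have fH: "integral\<^sup>L \<mu> f = hilbert_transform \<mu> x"
    unfolding hilbert_transform_def by (intro integral_cong_AE) auto
  have lim: "(\<lambda>p. (\<Sum>j\<in>{k..<p}. f (lam p j)) / real p) \<longlonglongrightarrow> hilbert_transform \<mu> x"
    unfolding fH[symmetric] by (rule bulk_tendsto[OF \<mu> f])
  have "(\<lambda>p. (\<Sum>j\<in>{k..<p}. 1 / (xs p - lam p j)) / real p - (\<Sum>j\<in>{k..<p}. f (lam p j)) / real p) \<longlonglongrightarrow> 0"
  proof (rule Lim_null_comparison)
    have "(\<lambda>p. \<bar>xs p - x\<bar> / d\<^sup>2) \<longlonglongrightarrow> \<bar>x - x\<bar> / d\<^sup>2" using d by (intro tendsto_intros assms(2)) auto
    then show "(\<lambda>p. \<bar>xs p - x\<bar> / d\<^sup>2) \<longlonglongrightarrow> 0" by simp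
    have "x - d < x" using d by simp
    from eventually_bulk_le[OF d(2)] order_tendstoD(1)[OF assms(2) this]
    show "\<forall>\<^sub>F p in sequentially. norm ((\<Sum>j\<in>{k..<p}. 1 / (xs p - lam p j)) / real p - (\<Sum>j\<in>{k..<p}. f (lam p j)) / real p)
        \<le> \<bar>xs p - x\<bar> / d\<^sup>2"
      using eventually_gt_at_top[of 0]
    proof eventually_elim
      case (elim p)
      have "\<bar>\<Sum>j\<in>{k..<p}. 1 / (xs p - lam p j) - f (lam p j)\<bar> \<le> (\<Sum>j\<in>{k..<p}. \<bar>1 / (xs p - lam p j) - f (lam p j)\<bar>)"
        by (rule sum_abs)
      also have "\<dots> \<le> of_nat (card {k..<p}) * (\<bar>xs p - x\<bar> / d\<^sup>2)"
      proof (rule sum_bounded_above)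
        fix j assume "j \<in> {k..<p}"
        then have j: "lam p j \<le> m" using elim by auto
        then have "f (lam p j) = 1 / (x - lam p j)" by (simp add: f_def)
        then show "\<bar>1 / (xs p - lam p j) - f (lam p j)\<bar> \<le> \<bar>xs p - x\<bar> / d\<^sup>2"
          using inverse_diff_bound[of d x "lam p j" "xs p"] j d elim by simp
      qed
      also have "\<dots> \<le> real p * (\<bar>xs p - x\<bar> / d\<^sup>2)" by (intro mult_right_mono) auto
      finally have "\<bar>\<Sum>j\<in>{k..<p}. 1 / (xs p - lam p j) - f (lam p j)\<bar> / real p \<le> \<bar>xs p - x\<bar> / d\<^sup>2"
        using elim by (simp add: divide_le_eq mult.commute)
      then show ?case by (simp add: sum_subtractf diff_divide_distrib[symmetric])
    qed
  qed
  from tendsto_add[OF this lim] show ?thesis by simp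
qed

text \<open>Used in \<open>diag_sum_lower\<close> to let the lowered spikes return to their
  limits.\<close>

lemma isCont_hilbert_transform:
  assumes "l < x" shows "isCont (hilbert_transform \<mu>) x"
proof -
  interpret real_distribution \<mu> by (rule \<mu>)
  define d where "d = (x - l) / 4"
  define m where "m = l + d"
  have d: "0 < d" "l < m" "x = m + 3 * d" using assms(1) by (auto simp: d_def m_def field_simps)
  have int: "integrable \<mu> (\<lambda>t. 1 / (y - t))" if "m + d < y" for y
  proof (rule integrable_const_bound[of _ "1 / d"])
    show "AE t in \<mu>. norm (1 / (y - t)) \<le> 1 / d"
      using AE_bulk_le[OF d(2)]
      by eventually_elim (use that d in \<open>auto intro!: divide_left_mono\<close>)
  qed auto
  have bound: "\<bar>hilbert_transform \<mu> y - hilbert_transform \<mu> x\<bar> \<le> \<bar>y - x\<bar> / d\<^sup>2" if y: "m + d < y" for y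
  proof -
    have x: "m + d < x" using d by simp
    have "hilbert_transform \<mu> y - hilbert_transform \<mu> x = (\<integral>t. 1 / (y - t) - 1 / (x - t) \<partial>\<mu>)"
      unfolding hilbert_transform_def using int[OF y] int[OF x] by simp
    also have "\<bar>\<dots>\<bar> \<le> (\<integral>t. \<bar>1 / (y - t) - 1 / (x - t)\<bar> \<partial>\<mu>)" by (rule integral_abs_bound)
    also have "\<dots> \<le> (\<integral>t. \<bar>y - x\<bar> / d\<^sup>2 \<partial>\<mu>)"
    proof (rule integral_mono_AE)
      show "AE t in \<mu>. \<bar>1 / (y - t) - 1 / (x - t)\<bar> \<le> \<bar>y - x\<bar> / d\<^sup>2"
        using AE_bulk_le[OF d(2)]
        by eventually_elim (rule inverse_diff_bound; use x y d in simp)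
    qed (use int[OF y] int[OF x] in auto)
    finally show ?thesis using prob_space by simp
  qed
  have "((\<lambda>y. hilbert_transform \<mu> y - hilbert_transform \<mu> x) \<longlongrightarrow> 0) (at x)"
  proof (rule Lim_null_comparison)
    have "((\<lambda>y. \<bar>y - x\<bar> / d\<^sup>2) \<longlongrightarrow> \<bar>x - x\<bar> / d\<^sup>2) (at x)" using d by (intro tendsto_intros) auto
    then show "((\<lambda>y. \<bar>y - x\<bar> / d\<^sup>2) \<longlongrightarrow> 0) (at x)" by simp
    have "\<forall>\<^sub>F y in at x. m + d < y" using d by (intro order_tendstoD(1)[OF tendsto_ident_at]) auto
    then show "\<forall>\<^sub>F y in at x. norm (hilbert_transform \<mu> y - hilbert_transform \<mu> x) \<le> \<bar>y - x\<bar> / d\<^sup>2"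
      by eventually_elim (simp add: bound)
  qed
  then show ?thesis unfolding isCont_def by (simp add: LIM_zero_iff)
qed

end

section \<open>Limits of the overlaps\<close>

context gibbs_sequence
begin

text \<open>The mean x = E \<open>A i i\<close> satisfies x^2 \<le> E \<open>(A i i)\<^sup>2\<close>
  \<le> (1 - h) x + o(1), so it cannot exceed the larger root of x^2 = (1 - h) x
  asymptotically.\<close>

lemma diag_upper:
  assumes gap: "0 < g" "\<forall>\<^sub>F p in sequentially. \<forall>i<k. \<forall>j. k \<le> j \<longrightarrow> j < p \<longrightarrow> g \<le> lam p i - lam p j"
    and shift: "(\<lambda>p. shift_seq lam p k i) \<longlonglongrightarrow> h" and i: "i < k" and \<epsilon>: "0 < \<epsilon>"
  shows "\<forall>\<^sub>F p in sequentially. gibbs_mean lam p (\<lambda>x. A p x i i) \<le> max (1 - h) 0 + \<epsilon>"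
proof -
  have "(\<lambda>p. 1 - shift_seq lam p k i) \<longlonglongrightarrow> 1 - h" by (intro tendsto_intros shift)
  moreover have "1 - h < max (1 - h) 0 + \<epsilon> / 2" using \<epsilon> by simp
  ultimately have c: "\<forall>\<^sub>F p in sequentially. 1 - shift_seq lam p k i < max (1 - h) 0 + \<epsilon> / 2"
    by (rule order_tendstoD)
  have "0 < (\<epsilon> / 2)\<^sup>2" using \<epsilon> by simp
  with null_gap[of "real k" g] have r: "\<forall>\<^sub>F p in sequentially. real k / (real p * b p * g) < (\<epsilon> / 2)\<^sup>2"
    by (rule order_tendstoD)
  show ?thesis
    using c r gap(2) b_pos eventually_gt_at_top[of k]
  proof eventually_elim
    case (elim p)
    interpret R: rotation_invariant_projection "M p" p k "A p" by (rule rip[OF elim(5)])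
    let ?x = "gibbs_mean lam p (\<lambda>x. A p x i i)" and ?C = "max (1 - h) 0 + \<epsilon> / 2"
    have x0: "0 \<le> ?x" unfolding gibbs_mean_def using elim i by (intro R.integral_diag_nonneg) auto
    have "?x\<^sup>2 \<le> gibbs_mean lam p (\<lambda>x. (A p x i i)\<^sup>2)"
      unfolding gibbs_mean_def using elim i by (intro R.square_integral_tilted_le R.bdd_entry) auto
    also have "\<dots> \<le> (\<Sum>l<k. gibbs_mean lam p (\<lambda>x. (A p x i l)\<^sup>2))"
      using i by (intro member_le_sum[of i "{..<k}" "\<lambda>l. gibbs_mean lam p (\<lambda>x. (A p x i l)\<^sup>2)"]) (auto simp: gibbs_mean_def)
    also have "\<dots> \<le> (1 - shift_seq lam p k i) * ?x + real k / (real p * b p * g)"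
      unfolding gibbs_mean_def shift_seq_def R.shift_def[symmetric]
      using elim i gap(1) by (intro R.overlap_bounds(2)) auto
    also have "\<dots> \<le> ?C * ?x + (\<epsilon> / 2)\<^sup>2"
      using elim x0 by (intro add_mono mult_right_mono) auto
    finally have le: "?x * ?x \<le> ?C * ?x + (\<epsilon> / 2)\<^sup>2" by (simp add: power2_eq_square)
    show ?case
    proof (rule ccontr)
      assume "\<not> ?thesis"
      then have x: "?C + \<epsilon> / 2 < ?x" by simp
      then have "\<epsilon> / 2 < ?x" using \<epsilon> by linarith
      then have "\<epsilon> / 2 * (\<epsilon> / 2) < \<epsilon> / 2 * ?x" using \<epsilon> by (intro mult_strict_left_mono) auto
      moreover have "(?C + \<epsilon> / 2) * ?x < ?x * ?x" using x \<epsilon> by (intro mult_strict_right_mono) auto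
      ultimately show False using le by (simp add: power2_eq_square distrib_right)
    qed
  qed
qed

lemma overlap_sum_limit:
  assumes gap: "0 < g" "\<forall>\<^sub>F p in sequentially. \<forall>i<k. \<forall>j. k \<le> j \<longrightarrow> j < p \<longrightarrow> g \<le> lam p i - lam p j"
    and shift: "(\<lambda>p. shift_seq lam p k i) \<longlonglongrightarrow> h" and i: "i < k"
    and diag: "(\<lambda>p. gibbs_mean lam p (\<lambda>x. A p x i i)) \<longlonglongrightarrow> e"
  shows "(\<lambda>p. \<Sum>l<k. gibbs_mean lam p (\<lambda>x. (A p x i l)\<^sup>2)) \<longlonglongrightarrow> (1 - h) * e"
proof (rule tendsto_sandwich)
  show low: "(\<lambda>p. (1 - shift_seq lam p k i) * gibbs_mean lam p (\<lambda>x. A p x i i)) \<longlonglongrightarrow> (1 - h) * e"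
    by (intro tendsto_intros shift diag)
  show "(\<lambda>p. (1 - shift_seq lam p k i) * gibbs_mean lam p (\<lambda>x. A p x i i) + real k / (real p * b p * g)) \<longlonglongrightarrow> (1 - h) * e"
    using tendsto_add[OF low null_gap[of "real k" g]] by simp
  have ev: "\<forall>\<^sub>F p in sequentially.
      (1 - shift_seq lam p k i) * gibbs_mean lam p (\<lambda>x. A p x i i) \<le> (\<Sum>l<k. gibbs_mean lam p (\<lambda>x. (A p x i l)\<^sup>2)) \<and>
      (\<Sum>l<k. gibbs_mean lam p (\<lambda>x. (A p x i l)\<^sup>2)) \<le> (1 - shift_seq lam p k i) * gibbs_mean lam p (\<lambda>x. A p x i i) + real k / (real p * b p * g)"
    using gap(2) b_pos eventually_gt_at_top[of k]
  proof eventually_elim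
    case (elim p)
    interpret R: rotation_invariant_projection "M p" p k "A p" by (rule rip[OF elim(3)])
    show ?case unfolding gibbs_mean_def shift_seq_def R.shift_def[symmetric]
      using R.overlap_bounds[of i k "b p" g "lam p"] elim i gap(1) by auto
  qed
  show "\<forall>\<^sub>F p in sequentially.
      (1 - shift_seq lam p k i) * gibbs_mean lam p (\<lambda>x. A p x i i) \<le> (\<Sum>l<k. gibbs_mean lam p (\<lambda>x. (A p x i l)\<^sup>2))"
    "\<forall>\<^sub>F p in sequentially. (\<Sum>l<k. gibbs_mean lam p (\<lambda>x. (A p x i l)\<^sup>2))
       \<le> (1 - shift_seq lam p k i) * gibbs_mean lam p (\<lambda>x. A p x i i) + real k / (real p * b p * g)"
    using ev by (auto elim: eventually_mono)
qed

text \<open>The diagonal entry is at least the pivot, whose limit \<open>schur_limit\<close>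
  provides if h l < 1 for all l \<le> i; \<open>mono\<close> reduces this to h i < 1. For h i \<ge>
  1 the bound only says that the mean is nonnegative.\<close>

lemma diag_lower_separated:
  assumes gap: "0 < g" "0 < \<Lambda>" "\<forall>\<^sub>F p in sequentially. \<forall>i<k. \<forall>j. i < j \<longrightarrow> j < p \<longrightarrow>
      g \<le> lam p i - lam p j \<and> lam p i - lam p j \<le> \<Lambda>"
    and shift: "\<And>i. i < k \<Longrightarrow> (\<lambda>p. shift_seq lam p k i) \<longlonglongrightarrow> h i"
    and mono: "\<And>l. l \<le> i \<Longrightarrow> h l \<le> h i" and i: "i < k" and \<epsilon>: "0 < \<epsilon>"
  shows "\<forall>\<^sub>F p in sequentially. max (1 - h i) 0 - \<epsilon> \<le> gibbs_mean lam p (\<lambda>x. A p x i i)"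
proof (cases "h i < 1")
  case False
  show ?thesis
    using eventually_gt_at_top[of k]
  proof eventually_elim
    case (elim p)
    interpret R: rotation_invariant_projection "M p" p k "A p" by (rule rip[OF elim])
    have "0 \<le> gibbs_mean lam p (\<lambda>x. A p x i i)" unfolding gibbs_mean_def using elim i by (intro R.integral_diag_nonneg) auto
    then show ?case using False \<epsilon> by simp
  qed
next
  case True
  have hl: "h l < 1" if "l \<le> i" for l using mono[OF that] True by simp
  have "0 < \<epsilon>\<^sup>2" using \<epsilon> by simp
  with schur_limit[OF gap shift i hl]
  have "\<forall>\<^sub>F p in sequentially. gibbs_mean lam p (\<lambda>x. (schur (A p x) i i i - (1 - h i))\<^sup>2) < \<epsilon>\<^sup>2"
    by (auto dest!: order_tendstoD(2))
  then show ?thesis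
    using eventually_gt_at_top[of k]
  proof eventually_elim
    case (elim p)
    interpret R: rotation_invariant_projection "M p" p k "A p" by (rule rip[OF elim(2)])
    have bs: "R.bdd (\<lambda>x. schur (A p x) i i i)" and bA: "R.bdd (\<lambda>x. A p x i i)"
      using elim i by (auto intro!: R.bdd_schur R.bdd_entry)
    have "(gibbs_mean lam p (\<lambda>x. schur (A p x) i i i) - (1 - h i))\<^sup>2 = (gibbs_mean lam p (\<lambda>x. schur (A p x) i i i - (1 - h i)))\<^sup>2"
      unfolding gibbs_mean_def by (subst R.integral_tilted_diff) (simp_all add: bs R.bdd_const)
    also have "\<dots> \<le> gibbs_mean lam p (\<lambda>x. (schur (A p x) i i i - (1 - h i))\<^sup>2)"
      unfolding gibbs_mean_def by (intro R.square_integral_tilted_le R.bdd_intros bs)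
    also have "\<dots> < \<epsilon>\<^sup>2" by (rule elim(1))
    finally have "\<bar>gibbs_mean lam p (\<lambda>x. schur (A p x) i i i) - (1 - h i)\<bar> < \<epsilon>"
      using \<epsilon> by (intro power2_less_imp_less[of "\<bar>_\<bar>"]) (auto simp: power2_abs)
    moreover have "gibbs_mean lam p (\<lambda>x. schur (A p x) i i i) \<le> gibbs_mean lam p (\<lambda>x. A p x i i)"
      unfolding gibbs_mean_def using elim i
      by (intro R.integral_tilted_mono bs bA proj_mat.schur_diag_le[OF R.proj]) auto
    ultimately show ?case using True by simp
  qed
qed

end

section \<open>Spikes whose limits may coincide\<close>

locale spiked_gibbs_sequence = gibbs_sequence k M A b \<beta>
  for k :: nat and M :: "nat \<Rightarrow> 'v measure" and A b \<beta> +
  fixes lam :: "nat \<Rightarrow> nat \<Rightarrow> real" and \<gamma> :: "nat \<Rightarrow> real" and \<mu> :: "real measure"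
  assumes k_pos: "1 \<le> k"
    and sorted: "\<And>p i j. i \<le> j \<Longrightarrow> j < p \<Longrightarrow> lam p j \<le> lam p i"
    and nonneg: "\<And>p j. j < p \<Longrightarrow> 0 \<le> lam p j"
    and lam_lim: "\<And>i. i \<le> k \<Longrightarrow> (\<lambda>p. lam p i) \<longlonglongrightarrow> \<gamma> i"
    and spectral_gap: "\<gamma> k < \<gamma> (k - 1)"
    and \<mu>: "real_distribution \<mu>" "weak_conv_m (\<lambda>p. bulk_distribution p k (lam p)) \<mu>"
begin

definition gap :: real where "gap = \<gamma> (k - 1) - \<gamma> k"

text \<open>The amount by which a spike is lowered grows with its index in steps of \<eta>, so any
  two lowered spikes are at least \<eta> apart whatever their limits are.\<close>

definition perturbed :: "real \<Rightarrow> nat \<Rightarrow> nat \<Rightarrow> real" where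
  "perturbed \<eta> p i = (if i < k then lam p i - \<eta> * (real i + 1) else lam p i)"

lemma gap_pos: "0 < gap" using spectral_gap by (simp add: gap_def)

lemma \<gamma>_ge: "i < k \<Longrightarrow> \<gamma> k + gap \<le> \<gamma> i"
proof -
  assume i: "i < k"
  have "\<gamma> (k - 1) \<le> \<gamma> i"
  proof (rule tendsto_le[OF sequentially_bot lam_lim lam_lim])
    show "\<forall>\<^sub>F p in sequentially. lam p (k - 1) \<le> lam p i"
      using eventually_gt_at_top[of k] by eventually_elim (use i in \<open>auto intro: sorted\<close>)
  qed (use i in auto)
  then show ?thesis by (simp add: gap_def)
qed

text \<open>The distance between spikes and bulk is eventually more than gap / 2, and the lowering
  takes at most gap / 4 of it. The case \<eta> = 0 serves the original spectrum.\<close>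

lemma perturbed_gap:
  assumes "0 \<le> \<eta>" "\<eta> * real k \<le> gap / 4"
  shows "\<forall>\<^sub>F p in sequentially. \<forall>i<k. \<forall>j. k \<le> j \<longrightarrow> j < p \<longrightarrow> gap / 4 \<le> perturbed \<eta> p i - perturbed \<eta> p j"
proof -
  have "(\<lambda>p. lam p (k - 1) - lam p k) \<longlonglongrightarrow> gap"
    unfolding gap_def using k_pos by (intro tendsto_intros lam_lim) auto
  moreover have "gap / 2 < gap" using gap_pos by simp
  ultimately have "\<forall>\<^sub>F p in sequentially. gap / 2 < lam p (k - 1) - lam p k" by (rule order_tendstoD)
  then show ?thesis using eventually_gt_at_top[of k]
  proof eventually_elim
    case (elim p)
    show ?case
    proof (intro allI impI)
      fix i j assume ij: "i < k" "k \<le> j" "j < p"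
      have "lam p (k - 1) \<le> lam p i" "lam p j \<le> lam p k" using ij elim by (auto intro!: sorted)
      moreover have "\<eta> * (real i + 1) \<le> \<eta> * real k" using ij assms by (intro mult_left_mono) auto
      ultimately show "gap / 4 \<le> perturbed \<eta> p i - perturbed \<eta> p j"
        using elim assms(2) ij by (simp add: perturbed_def)
    qed
  qed
qed

text \<open>Upper bound: eventually \<open>lam p 0\<close> is below \<bar>\<gamma> 0\<bar> + 1, the
  subtracted eigenvalue is nonnegative, and its own lowering adds at most gap / 4.\<close>

lemma perturbed_separated:
  assumes \<eta>: "0 < \<eta>" "\<eta> * real k \<le> gap / 4"
  shows "\<forall>\<^sub>F p in sequentially. \<forall>i<k. \<forall>j. i < j \<longrightarrow> j < p \<longrightarrow>
      min \<eta> (gap / 4) \<le> perturbed \<eta> p i - perturbed \<eta> p j \<and> perturbed \<eta> p i - perturbed \<eta> p j \<le> \<bar>\<gamma> 0\<bar> + 1 + gap"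
proof -
  have "\<forall>\<^sub>F p in sequentially. lam p 0 < \<bar>\<gamma> 0\<bar> + 1"
    using lam_lim[of 0] by (rule order_tendstoD) auto
  then show ?thesis using perturbed_gap[OF less_imp_le[OF \<eta>(1)] \<eta>(2)] eventually_gt_at_top[of k]
  proof eventually_elim
    case (elim p)
    show ?case
    proof (intro allI impI)
      fix i j assume ij: "i < k" "i < j" "j < p"
      have l: "lam p j \<le> lam p i" "0 \<le> lam p j" "lam p i \<le> lam p 0"
        using ij elim by (auto intro!: sorted nonneg)
      have e0: "0 \<le> \<eta> * (real i + 1)" using \<eta> by simp
      show "min \<eta> (gap / 4) \<le> perturbed \<eta> p i - perturbed \<eta> p j \<and> perturbed \<eta> p i - perturbed \<eta> p j \<le> \<bar>\<gamma> 0\<bar> + 1 + gap"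
      proof (cases "j < k")
        case True
        have "\<eta> * (real i + 1 + 1) \<le> \<eta> * (real j + 1)" using ij \<eta> by (intro mult_left_mono) auto
        moreover have "\<eta> * (real j + 1) \<le> \<eta> * real k" using True \<eta> by (intro mult_left_mono) auto
        moreover have "perturbed \<eta> p i - perturbed \<eta> p j = lam p i - lam p j + \<eta> * (real j + 1) - \<eta> * (real i + 1)"
          using True ij by (simp add: perturbed_def)
        moreover have "\<eta> * (real i + 1 + 1) = \<eta> * (real i + 1) + \<eta>" by (simp add: algebra_simps)
        moreover have "min \<eta> (gap / 4) \<le> \<eta>" by simp
        ultimately show ?thesis
          using l elim(1) e0 \<eta> gap_pos by linarith
      next
        case False
        then have "gap / 4 \<le> perturbed \<eta> p i - perturbed \<eta> p j" using elim(2) ij by auto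
        then show ?thesis using False l elim(1) e0 gap_pos ij by (simp add: perturbed_def)
      qed
    qed
  qed
qed

lemma perturbed_shift:
  assumes "0 \<le> \<eta>" "\<eta> * real k \<le> gap / 4" "i < k"
  shows "(\<lambda>p. shift_seq (perturbed \<eta>) p k i) \<longlonglongrightarrow> hilbert_transform \<mu> (\<gamma> i - \<eta> * (real i + 1)) / \<beta>"
proof -
  have "\<eta> * (real i + 1) \<le> \<eta> * real k" using assms by (intro mult_left_mono) auto
  then have "\<gamma> k < \<gamma> i - \<eta> * (real i + 1)" using assms \<gamma>_ge[of i] gap_pos by simp
  then have "(\<lambda>p. (\<Sum>j\<in>{k..<p}. 1 / ((lam p i - \<eta> * (real i + 1)) - lam p j)) / real p)
      \<longlonglongrightarrow> hilbert_transform \<mu> (\<gamma> i - \<eta> * (real i + 1))"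
    using assms by (intro bulk_hilbert[OF \<mu> sorted lam_lim] tendsto_intros lam_lim) auto
  from tendsto_divide[OF this b_lim] \<beta>_pos
  show ?thesis using assms by (simp add: shift_seq_def perturbed_def)
qed

lemma perturbed_0: "perturbed 0 = lam" by (simp add: perturbed_def fun_eq_iff)

definition limit_overlap :: "nat \<Rightarrow> real" where
  "limit_overlap i = max (1 - hilbert_transform \<mu> (\<gamma> i) / \<beta>) 0"

text \<open>
  The log-partition function is convex in \<open>lam\<close>, so its directional derivative
  \<open>\<Sum>i<k. (i + 1) E A\<^sub>i\<^sub>i\<close> can only decrease when \<open>lam i\<close> is lowered by \<open>\<eta> (i + 1)\<close>. The lowered
  spikes are separated even where the limits \<open>\<gamma> i\<close> coincide.
\<close>

lemma diag_sum_lower: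
  assumes \<epsilon>: "0 < \<epsilon>"
  shows "\<forall>\<^sub>F p in sequentially. (\<Sum>i<k. (real i + 1) * limit_overlap i) - \<epsilon>
    \<le> (\<Sum>i<k. (real i + 1) * gibbs_mean lam p (\<lambda>x. A p x i i))"
proof -
  define H where "H \<eta> i = hilbert_transform \<mu> (\<gamma> i - \<eta> * (real i + 1)) / \<beta>" for \<eta> i
  have H_lim: "((\<lambda>\<eta>. H \<eta> i) \<longlongrightarrow> hilbert_transform \<mu> (\<gamma> i) / \<beta>) (at_right 0)" if "i < k" for i
  proof -
    have "((\<lambda>\<eta>. \<gamma> i - \<eta> * (real i + 1)) \<longlongrightarrow> \<gamma> i - 0 * (real i + 1)) (at_right 0)" by (intro tendsto_intros)
    then have "((\<lambda>\<eta>. \<gamma> i - \<eta> * (real i + 1)) \<longlongrightarrow> \<gamma> i) (at_right 0)" by simp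
    moreover have "isCont (hilbert_transform \<mu>) (\<gamma> i)"
      using \<gamma>_ge[OF that] gap_pos by (intro isCont_hilbert_transform[OF \<mu> sorted lam_lim]) auto
    ultimately have "((\<lambda>\<eta>. hilbert_transform \<mu> (\<gamma> i - \<eta> * (real i + 1))) \<longlongrightarrow> hilbert_transform \<mu> (\<gamma> i)) (at_right 0)"
      by (rule isCont_tendsto_compose[rotated])
    then show ?thesis unfolding H_def using \<beta>_pos by (intro tendsto_intros) auto
  qed
  have "((\<lambda>\<eta>. \<Sum>i<k. (real i + 1) * max (1 - H \<eta> i) 0) \<longlongrightarrow> (\<Sum>i<k. (real i + 1) * limit_overlap i)) (at_right 0)"
    unfolding limit_overlap_def by (intro tendsto_intros tendsto_max H_lim) auto
  then have "\<forall>\<^sub>F \<eta> in at_right 0. (\<Sum>i<k. (real i + 1) * limit_overlap i) - \<epsilon> / 2 < (\<Sum>i<k. (real i + 1) * max (1 - H \<eta> i) 0)"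
    by (rule order_tendstoD) (use \<epsilon> in auto)
  moreover have "\<forall>\<^sub>F \<eta> in at_right 0. \<eta> * real k < gap / 4"
  proof -
    have "((\<lambda>\<eta>. \<eta> * real k) \<longlongrightarrow> 0 * real k) (at_right 0)" by (intro tendsto_intros)
    then show ?thesis by (rule order_tendstoD) (use gap_pos in auto)
  qed
  moreover have "\<forall>\<^sub>F \<eta> in at_right 0. (0::real) < \<eta>" by (auto simp: eventually_at_right_less)
  ultimately have "\<forall>\<^sub>F \<eta> in at_right 0. 0 < \<eta> \<and> \<eta> * real k < gap / 4 \<and>
      (\<Sum>i<k. (real i + 1) * limit_overlap i) - \<epsilon> / 2 < (\<Sum>i<k. (real i + 1) * max (1 - H \<eta> i) 0)"
    by eventually_elim auto
  \<comment> \<open>\<eta> is fixed here, before p grows; continuity of the Hilbert transform makes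
    the loss in the limiting sum less than \<epsilon> / 2.\<close>
  from eventually_happens'[OF trivial_limit_at_right_real this]
  obtain \<eta> where \<eta>: "0 < \<eta>" "\<eta> * real k \<le> gap / 4"
    and close: "(\<Sum>i<k. (real i + 1) * limit_overlap i) - \<epsilon> / 2 < (\<Sum>i<k. (real i + 1) * max (1 - H \<eta> i) 0)"
    by (auto intro: less_imp_le)
  define \<Lambda> where "\<Lambda> = \<bar>\<gamma> 0\<bar> + 1 + gap"
  have g: "0 < min \<eta> (gap / 4)" "0 < \<Lambda>" using \<eta> gap_pos by (auto simp: \<Lambda>_def)
  note sep = perturbed_separated[OF \<eta>, folded \<Lambda>_def]
  have shift: "(\<lambda>p. shift_seq (perturbed \<eta>) p k i) \<longlonglongrightarrow> H \<eta> i" if "i < k" for i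
    unfolding H_def using \<eta> that by (intro perturbed_shift) auto
  \<comment> \<open>The order of the limits is inherited from finite p, where a lower spike has
    larger reciprocal distances to the bulk.\<close>
  have H_mono: "H \<eta> l \<le> H \<eta> i" if li: "l \<le> i" "i < k" for l i
  proof (rule tendsto_le[OF sequentially_bot shift shift])
    show "\<forall>\<^sub>F p in sequentially. shift_seq (perturbed \<eta>) p k l \<le> shift_seq (perturbed \<eta>) p k i"
      using sep b_pos perturbed_gap[OF less_imp_le[OF \<eta>(1)] \<eta>(2)] eventually_gt_at_top[of k]
    proof eventually_elim
      case (elim p)
      have "perturbed \<eta> p i \<le> perturbed \<eta> p l"
        using elim(1)[rule_format, of l i] li elim(4) g(1) by (cases "l = i") auto
      moreover have "0 < perturbed \<eta> p i - perturbed \<eta> p j" "0 < perturbed \<eta> p l - perturbed \<eta> p j" if "j \<in> {k..<p}" for j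
      proof -
        have "gap / 4 \<le> perturbed \<eta> p i - perturbed \<eta> p j" "gap / 4 \<le> perturbed \<eta> p l - perturbed \<eta> p j"
          using elim(3) li that by auto
        then show "0 < perturbed \<eta> p i - perturbed \<eta> p j" "0 < perturbed \<eta> p l - perturbed \<eta> p j"
          using gap_pos by auto
      qed
      ultimately show ?case
        unfolding shift_seq_def using elim(2)
        by (intro divide_right_mono sum_mono divide_left_mono) auto
    qed
  qed (use li in auto)
  define s where "s = (\<Sum>i<k. real i + 1)"
  have s: "0 < s" unfolding s_def using k_pos by (intro sum_pos) (auto simp: lessThan_empty_iff)
  \<comment> \<open>The tolerance per spike: summed with the weights i + 1 it uses up the other
    \<epsilon> / 2.\<close>
  define e where "e = \<epsilon> / 2 / s"
  have e: "0 < e" "s * e = \<epsilon> / 2" using \<epsilon> s by (auto simp: e_def)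
  have "\<forall>\<^sub>F p in sequentially. \<forall>i\<in>{..<k}. max (1 - H \<eta> i) 0 - e \<le> gibbs_mean (perturbed \<eta>) p (\<lambda>x. A p x i i)"
  proof (intro eventually_ball_finite ballI)
    fix i assume "i \<in> {..<k}"
    then show "\<forall>\<^sub>F p in sequentially. max (1 - H \<eta> i) 0 - e \<le> gibbs_mean (perturbed \<eta>) p (\<lambda>x. A p x i i)"
      using e by (intro diag_lower_separated[OF g sep shift] H_mono) auto
  qed simp
  then show ?thesis
    using b_pos eventually_gt_at_top[of k]
  proof eventually_elim
    case (elim p)
    interpret R: rotation_invariant_projection "M p" p k "A p" by (rule rip[OF elim(3)])
    define \<tau> where "\<tau> l = (if l < k then real l + 1 else 0)" for l
    have lam_eq: "lam p = (\<lambda>l. perturbed \<eta> p l + \<eta> * \<tau> l)"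
      by (auto simp: fun_eq_iff perturbed_def \<tau>_def)
    have T: "(\<integral>x. (\<Sum>l<p. \<tau> l * A p x l l) \<partial>R.tilted (b p) (lam' p)) = (\<Sum>l<k. (real l + 1) * gibbs_mean lam' p (\<lambda>x. A p x l l))" for lam'
    proof -
      have "(\<Sum>l<p. \<tau> l * A p x l l) = (\<Sum>l<k. (real l + 1) * A p x l l)" for x
        using elim by (intro sum.mono_neutral_cong_right) (auto simp: \<tau>_def)
      then show ?thesis
        unfolding gibbs_mean_def using elim(3) R.integral_tilted_sum[of "{..<k}" "\<lambda>l x. (real l + 1) * A p x l l" "b p" "lam' p"]
        by (simp add: R.bdd_mult R.bdd_const R.bdd_entry)
    qed
    have "(\<Sum>i<k. (real i + 1) * (max (1 - H \<eta> i) 0 - e)) \<le> (\<Sum>i<k. (real i + 1) * gibbs_mean (perturbed \<eta>) p (\<lambda>x. A p x i i))"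
      using elim by (intro sum_mono mult_left_mono) auto
    also have "\<dots> \<le> (\<Sum>i<k. (real i + 1) * gibbs_mean lam p (\<lambda>x. A p x i i))"
      unfolding T[symmetric] using elim \<eta> by (subst lam_eq) (intro R.tilted_monotone; simp)
    finally have "(\<Sum>i<k. (real i + 1) * max (1 - H \<eta> i) 0) - s * e \<le> (\<Sum>i<k. (real i + 1) * gibbs_mean lam p (\<lambda>x. A p x i i))"
      by (simp only: right_diff_distrib sum_subtractf s_def sum_distrib_right)
    then show ?case using close e by simp
  qed
qed

text \<open>Each mean is asymptotically at most its limit, and a sum with positive weights is
  asymptotically at least its limit; so none of the means can fall short.\<close>

lemma diag_limit:
  assumes i: "i < k"
  shows "(\<lambda>p. gibbs_mean lam p (\<lambda>x. A p x i i)) \<longlonglongrightarrow> limit_overlap i"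
proof (rule tendstoI)
  fix \<epsilon> :: real assume \<epsilon>: "0 < \<epsilon>"
  define s where "s = (\<Sum>i<k. real i + 1)"
  have s: "0 < s" unfolding s_def using k_pos by (intro sum_pos) (auto simp: lessThan_empty_iff)
  \<comment> \<open>The weighted deficit at i is at most \<delta> from the lower bound on the sum
    plus s \<delta> from the upper bounds at the other indices.\<close>
  define \<delta> where "\<delta> = \<epsilon> / 2 / (1 + s)"
  have "\<delta> * (1 + s) = \<epsilon> / 2" using s by (simp add: \<delta>_def del: divide_divide_eq_left)
  then have \<delta>: "0 < \<delta>" "\<delta> * (1 + s) < \<epsilon>" using \<epsilon> s by (auto simp: \<delta>_def intro!: divide_pos_pos)
  have "0 < gap / 4" using gap_pos by simp
  have "\<forall>\<^sub>F p in sequentially. \<forall>l\<in>{..<k}. gibbs_mean lam p (\<lambda>x. A p x l l) \<le> limit_overlap l + \<delta>"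
  proof (intro eventually_ball_finite ballI)
    fix l assume "l \<in> {..<k}"
    then show "\<forall>\<^sub>F p in sequentially. gibbs_mean lam p (\<lambda>x. A p x l l) \<le> limit_overlap l + \<delta>"
      unfolding limit_overlap_def using \<delta> gap_pos perturbed_gap[of 0] perturbed_shift[of 0 l]
      by (intro diag_upper[of "gap / 4"]) (auto simp: perturbed_0)
  qed simp
  then show "\<forall>\<^sub>F p in sequentially. dist (gibbs_mean lam p (\<lambda>x. A p x i i)) (limit_overlap i) < \<epsilon>"
    using diag_sum_lower[OF \<delta>(1)]
  proof eventually_elim
    case (elim p)
    let ?e = "\<lambda>l. gibbs_mean lam p (\<lambda>x. A p x l l)"
    have split: "sum f {..<k} = f i + sum f ({..<k} - {i})" for f :: "nat \<Rightarrow> real"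
      using i by (simp add: sum.remove)
    have "(\<Sum>l\<in>{..<k} - {i}. (real l + 1) * ?e l) \<le> (\<Sum>l\<in>{..<k} - {i}. (real l + 1) * (limit_overlap l + \<delta>))"
      using elim(1) by (intro sum_mono mult_left_mono) auto
    also have "\<dots> = (\<Sum>l\<in>{..<k} - {i}. (real l + 1) * limit_overlap l) + (\<Sum>l\<in>{..<k} - {i}. real l + 1) * \<delta>"
      by (subst sum_distrib_right) (simp only: distrib_left sum.distrib)
    also have "(\<Sum>l\<in>{..<k} - {i}. real l + 1) * \<delta> \<le> s * \<delta>"
      using \<delta> unfolding s_def by (intro mult_right_mono sum_mono2) auto
    finally have "(real i + 1) * (limit_overlap i - ?e i) \<le> \<delta> * (1 + s)"
      using elim(2) unfolding split by (simp add: algebra_simps)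
    then have "(real i + 1) * (limit_overlap i - ?e i) < \<epsilon>" using \<delta> by linarith
    moreover have "limit_overlap i - ?e i \<le> (real i + 1) * (limit_overlap i - ?e i)" if "0 \<le> limit_overlap i - ?e i"
      using that by (simp add: distrib_right)
    ultimately have "limit_overlap i - ?e i < \<epsilon>" using \<epsilon> by linarith
    moreover have "?e i - limit_overlap i < \<epsilon>"
    proof -
      have "\<delta> * 1 < \<delta> * (1 + s)" using \<delta> s by (intro mult_strict_left_mono) auto
      moreover have "?e i \<le> limit_overlap i + \<delta>" using elim(1) i by auto
      ultimately show ?thesis using \<delta> by linarith
    qed
    ultimately show ?case by (simp add: dist_real_def)
  qed
qed

text \<open>With m the limit of E \<open>A i i\<close> and c = 1 - H(\<gamma> i) / \<beta>, the
  squares in row i sum to a quantity with limit c m - 2 m^2 + m^2. This is 0 because m = max c 0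
  satisfies c m = m^2.\<close>

lemma overlap_limit:
  "(\<lambda>p. \<Sum>i<k. \<Sum>l<k. gibbs_mean lam p (\<lambda>x. (A p x i l - (if i = l then limit_overlap i else 0))\<^sup>2)) \<longlonglongrightarrow> 0"
proof (rule tendsto_null_sum)
  fix i assume "i \<in> {..<k}"
  then have i: "i < k" by simp
  let ?m = "limit_overlap i" and ?S = "\<lambda>p. \<Sum>l<k. gibbs_mean lam p (\<lambda>x. (A p x i l)\<^sup>2)"
  let ?c = "1 - hilbert_transform \<mu> (\<gamma> i) / \<beta>"
  have "?S \<longlonglongrightarrow> ?c * ?m"
    using gap_pos perturbed_gap[of 0] perturbed_shift[of 0 i] i
    by (intro overlap_sum_limit[of "gap / 4"] diag_limit) (auto simp: perturbed_0)
  then have "(\<lambda>p. ?S p - 2 * ?m * gibbs_mean lam p (\<lambda>x. A p x i i) + ?m\<^sup>2) \<longlonglongrightarrow> ?c * ?m - 2 * ?m * ?m + ?m\<^sup>2"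
    by (intro tendsto_intros diag_limit i)
  moreover have "?c * ?m - 2 * ?m * ?m + ?m\<^sup>2 = 0"
    by (auto simp: limit_overlap_def max_def power2_eq_square)
  moreover have "\<forall>\<^sub>F p in sequentially. ?S p - 2 * ?m * gibbs_mean lam p (\<lambda>x. A p x i i) + ?m\<^sup>2
      = (\<Sum>l<k. gibbs_mean lam p (\<lambda>x. (A p x i l - (if i = l then ?m else 0))\<^sup>2))"
    using eventually_gt_at_top[of k]
  proof eventually_elim
    case (elim p)
    interpret R: rotation_invariant_projection "M p" p k "A p" by (rule rip[OF elim])
    have bA: "R.bdd (\<lambda>x. A p x i i)" using elim i by (intro R.bdd_entry) auto
    have "gibbs_mean lam p (\<lambda>x. (A p x i i - ?m)\<^sup>2) = gibbs_mean lam p (\<lambda>x. (A p x i i)\<^sup>2 - 2 * ?m * A p x i i + ?m\<^sup>2)"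
      unfolding gibbs_mean_def by (intro Bochner_Integration.integral_cong refl) (simp add: power2_eq_square algebra_simps)
    also have "\<dots> = gibbs_mean lam p (\<lambda>x. (A p x i i)\<^sup>2) - 2 * ?m * gibbs_mean lam p (\<lambda>x. A p x i i) + ?m\<^sup>2"
      unfolding gibbs_mean_def by (simp only: R.integral_tilted_add R.integral_tilted_diff R.bdd_intros bA) simp
    finally have eq: "gibbs_mean lam p (\<lambda>x. (A p x i i - ?m)\<^sup>2)
        = gibbs_mean lam p (\<lambda>x. (A p x i i)\<^sup>2) - 2 * ?m * gibbs_mean lam p (\<lambda>x. A p x i i) + ?m\<^sup>2" .
    have "(\<Sum>l\<in>{..<k} - {i}. gibbs_mean lam p (\<lambda>x. (A p x i l - (if i = l then ?m else 0))\<^sup>2))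
        = (\<Sum>l\<in>{..<k} - {i}. gibbs_mean lam p (\<lambda>x. (A p x i l)\<^sup>2))"
      by (intro sum.cong) auto
    then show ?case using eq i by (simp add: sum.remove[of "{..<k}" i])
  qed
  ultimately show "(\<lambda>p. \<Sum>l<k. gibbs_mean lam p (\<lambda>x. (A p x i l - (if i = l then ?m else 0))\<^sup>2)) \<longlonglongrightarrow> 0"
    by (auto intro: Lim_transform_eventually)
qed

end

text \<open>The squares in row i sum to at most \<open>A i i\<close>, whose mean is at most (k + p b
  lam i) / (p - k); this tends to 0 with b.\<close>

lemma overlap_limit_high_temperature:
  fixes M :: "nat \<Rightarrow> 'v measure"
  assumes rip: "\<And>p. k < p \<Longrightarrow> rotation_invariant_projection (M p) p k (A p)"
    and b: "b \<longlonglongrightarrow> 0" "\<And>p. 0 \<le> b p"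
    and nonneg: "\<And>p j. j < p \<Longrightarrow> 0 \<le> lam p j"
    and lam_lim: "\<And>i. i < k \<Longrightarrow> (\<lambda>p. lam p i) \<longlonglongrightarrow> \<gamma> i"
  shows "(\<lambda>p. \<Sum>i<k. \<Sum>l<k. \<integral>x. (A p x i l)\<^sup>2
    \<partial>rotation_invariant_projection.tilted (M p) p (A p) (b p) (lam p)) \<longlonglongrightarrow> 0"
proof (rule tendsto_null_sum)
  fix i assume "i \<in> {..<k}"
  then have i: "i < k" by simp
  let ?E = "\<lambda>p f. \<integral>x. f x \<partial>rotation_invariant_projection.tilted (M p) p (A p) (b p) (lam p)"
  show "(\<lambda>p. \<Sum>l<k. ?E p (\<lambda>x. (A p x i l)\<^sup>2)) \<longlonglongrightarrow> 0"
  proof (rule tendsto_sandwich)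
    show "\<forall>\<^sub>F p in sequentially. 0 \<le> (\<Sum>l<k. ?E p (\<lambda>x. (A p x i l)\<^sup>2))" by (simp add: sum_nonneg)
    have "(\<lambda>p. real p / (real p - real k)) \<longlonglongrightarrow> 1" "(\<lambda>p. real k / (real p - real k)) \<longlonglongrightarrow> 0"
      by real_asymp+
    from tendsto_add[OF this(2) tendsto_mult[OF this(1) tendsto_mult[OF b(1) lam_lim[OF i]]]]
    show "(\<lambda>p. real k / (real p - real k) + real p / (real p - real k) * (b p * lam p i)) \<longlonglongrightarrow> 0" by simp
    show "\<forall>\<^sub>F p in sequentially. (\<Sum>l<k. ?E p (\<lambda>x. (A p x i l)\<^sup>2))
        \<le> real k / (real p - real k) + real p / (real p - real k) * (b p * lam p i)"
      using eventually_gt_at_top[of k]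
    proof eventually_elim
      case (elim p)
      interpret R: rotation_invariant_projection "M p" p k "A p" by (rule rip[OF elim])
      have "(\<Sum>l<k. ?E p (\<lambda>x. (A p x i l)\<^sup>2)) \<le> ?E p (\<lambda>x. A p x i i)"
        using R.integral_row[of i k "b p" "lam p"] elim i
          sum_nonneg[of "{k..<p}" "\<lambda>j. ?E p (\<lambda>x. (A p x i j)\<^sup>2)"] by simp
      also have "\<dots> \<le> (real k + real p * b p * lam p i) / (real p - real k)"
        using R.diag_bound_high_temperature[of i "b p" "lam p"] elim i b nonneg
        by (simp add: le_divide_eq mult.commute)
      finally show ?case by (simp add: add_divide_distrib mult_ac)
    qed
  qed simp
qed

section \<open>The Stiefel manifold\<close>

lemma rot_sum: "rot i j t (\<lambda>r. \<Sum>c\<in>I. f c r) r = (\<Sum>c\<in>I. rot i j t (f c) r)"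
  by (simp add: rot_def sum.distrib sum_subtractf sum_distrib_left)

lemma rot_mult_right: "rot i j t (\<lambda>r. x r * c) r = rot i j t x r * c"
  by (auto simp: rot_def algebra_simps)

lemma rot_mult_left: "rot i j t (\<lambda>r. c * x r) r = c * rot i j t x r"
  by (auto simp: rot_def algebra_simps)

lemma rot_inner:
  assumes "i < j" "j < p"
  shows "(\<Sum>r<p. rot i j t x r * rot i j t y r) = (\<Sum>r<p. x r * y r)"
proof -
  have split: "sum f {..<p} = f i + f j + sum f ({..<p} - {i} - {j})" for f :: "nat \<Rightarrow> real"
    using assms by (simp add: sum.remove[of "{..<p}" i] sum.remove[of "{..<p} - {i}" j])
  have rest: "(\<Sum>r\<in>{..<p} - {i} - {j}. rot i j t x r * rot i j t y r) = (\<Sum>r\<in>{..<p} - {i} - {j}. x r * y r)"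
    by (intro sum.cong) (auto simp: rot_def)
  have "rot i j t x i * rot i j t y i + rot i j t x j * rot i j t y j
      = x i * y i + x j * y j"
  proof -
    have "(c * a + s * b) * (c * a' + s * b') + (c * b - s * a) * (c * b' - s * a') = (s\<^sup>2 + c\<^sup>2) * (a * a' + b * b')"
      for c s a b a' b' :: real by (simp add: power2_eq_square algebra_simps)
    from this[of "cos t" "x i" "sin t" "x j" "y i" "y j"] show ?thesis using assms by (simp add: rot_def)
  qed
  then show ?thesis unfolding split rest by simp
qed

text \<open>The columns are the rotated unit vectors, so left multiplication acts as
  \<open>rot\<close> on every column.\<close>

definition givens :: "nat \<Rightarrow> nat \<Rightarrow> nat \<Rightarrow> real \<Rightarrow> real Matrix.mat" where
  "givens p i j t = Matrix.mat p p (\<lambda>(r, s). rot i j t (\<lambda>m. if m = s then 1 else 0) r)"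

lemma givens_carrier [simp]: "givens p i j t \<in> carrier_mat p p"
  by (simp add: givens_def)

lemma index_mult_mat_sum:
  assumes "B \<in> carrier_mat n m" "C \<in> carrier_mat m q" "r < n" "c < q"
  shows "(B * C) $$ (r, c) = (\<Sum>s<m. B $$ (r, s) * C $$ (s, c))"
  using assms by (auto simp: scalar_prod_def atLeast0LessThan intro!: sum.cong)

lemma givens_mult:
  assumes "i < j" "j < p" "V \<in> carrier_mat p q" "r < p" "c < q"
  shows "(givens p i j t * V) $$ (r, c) = rot i j t (\<lambda>r. V $$ (r, c)) r"
proof -
  have "(givens p i j t * V) $$ (r, c) = (\<Sum>s<p. rot i j t (\<lambda>m. if m = s then 1 else 0) r * V $$ (s, c))"
    unfolding index_mult_mat_sum[OF givens_carrier assms(3-5)] using assms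
    by (intro sum.cong) (auto simp: givens_def)
  also have "\<dots> = rot i j t (\<lambda>m. \<Sum>s<p. (if m = s then 1 else 0) * V $$ (s, c)) r"
    by (simp only: rot_sum rot_mult_right)
  also have "\<dots> = rot i j t (\<lambda>r. V $$ (r, c)) r"
    using assms by (auto simp: rot_def if_distrib[of "\<lambda>x. x * _"] cong: if_cong)
  finally show ?thesis .
qed

lemma stiefelI:
  assumes "V \<in> carrier_mat p k"
    and "\<And>c d. c < k \<Longrightarrow> d < k \<Longrightarrow> (\<Sum>r<p. V $$ (r, c) * V $$ (r, d)) = (if c = d then 1 else 0)"
  shows "V \<in> stiefel p k"
proof -
  have "transpose_mat V * V = 1\<^sub>m k"
  proof (rule eq_matI)
    fix c d assume "c < dim_row (1\<^sub>m k)" "d < dim_col (1\<^sub>m k)"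
    then have cd: "c < k" "d < k" by auto
    have "(transpose_mat V * V) $$ (c, d) = (\<Sum>r<p. V $$ (r, c) * V $$ (r, d))"
      using assms(1) cd by (subst index_mult_mat_sum[of _ k p _ k]) auto
    then show "(transpose_mat V * V) $$ (c, d) = (1\<^sub>m k) $$ (c, d)" using assms(2) cd by simp
  qed (use assms(1) in auto)
  then show ?thesis using assms(1) by (simp add: stiefel_def)
qed

lemma stiefel_carrier: "V \<in> stiefel p k \<Longrightarrow> V \<in> carrier_mat p k"
  by (simp add: stiefel_def)

lemma stiefel_orthonormal:
  assumes "V \<in> stiefel p k" "c < k" "d < k"
  shows "(\<Sum>r<p. V $$ (r, c) * V $$ (r, d)) = (if c = d then 1 else 0)"
proof -
  have "(\<Sum>r<p. V $$ (r, c) * V $$ (r, d)) = (transpose_mat V * V) $$ (c, d)"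
    using assms stiefel_carrier[OF assms(1)] by (subst index_mult_mat_sum[of _ k p _ k]) auto
  then show ?thesis using assms by (simp add: stiefel_def)
qed

lemma givens_stiefel: "i < j \<Longrightarrow> j < p \<Longrightarrow> givens p i j t \<in> stiefel p p"
proof (rule stiefelI)
  fix c d assume *: "i < j" "j < p" "c < p" "d < p"
  have "(\<Sum>r<p. givens p i j t $$ (r, c) * givens p i j t $$ (r, d))
      = (\<Sum>r<p. rot i j t (\<lambda>m. if m = c then 1 else 0) r * rot i j t (\<lambda>m. if m = d then 1 else 0) r)"
    using * by (intro sum.cong) (auto simp: givens_def)
  also have "\<dots> = (\<Sum>r<p. (if r = c then 1 else 0) * (if r = d then 1 else 0))"
    using * by (intro rot_inner)
  also have "\<dots> = (if c = d then 1 else 0)"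
    using * by (auto simp: if_distrib[of "\<lambda>x. x * _"] cong: if_cong)
  finally show "(\<Sum>r<p. givens p i j t $$ (r, c) * givens p i j t $$ (r, d)) = (if c = d then 1 else 0)" .
qed simp

lemma stiefel_mult:
  assumes "R \<in> stiefel p p" "V \<in> stiefel p k" shows "R * V \<in> stiefel p k"
proof -
  have c: "R \<in> carrier_mat p p" "V \<in> carrier_mat p k" and o: "transpose_mat R * R = 1\<^sub>m p" "transpose_mat V * V = 1\<^sub>m k"
    using assms by (auto simp: stiefel_def)
  have "transpose_mat (R * V) * (R * V) = transpose_mat V * transpose_mat R * (R * V)"
    using c by (simp add: transpose_mult)
  also have "\<dots> = transpose_mat V * (transpose_mat R * (R * V))"
    using c by (intro assoc_mult_mat[of _ k p _ p _ k]) auto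
  also have "transpose_mat R * (R * V) = transpose_mat R * R * V"
    using c by (intro assoc_mult_mat[symmetric, of _ p p _ p _ k]) auto
  finally show ?thesis using c o by (simp add: stiefel_def)
qed

lemma stiefel_square_right_inverse:
  assumes "Q \<in> stiefel p p" shows "Q * transpose_mat Q = 1\<^sub>m p"
  using assms mat_mult_left_right_inverse[of "transpose_mat Q" p Q] by (auto simp: stiefel_def)

lemma stiefel_transpose: "Q \<in> stiefel p p \<Longrightarrow> transpose_mat Q \<in> stiefel p p"
  using stiefel_square_right_inverse[of Q p] by (simp add: stiefel_def)

lemma space_stiefel_space: "space (stiefel_space p k) = stiefel p k"
  by (auto simp: stiefel_space_def borel_mat_def space_restrict_space stiefel_def)

lemma measurable_mat_entry:
  assumes "i < p" "c < k" shows "(\<lambda>V. V $$ (i, c)) \<in> borel_measurable (stiefel_space p k)"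
proof -
  let ?I = "{..<p} \<times> {..<k}"
  have "(\<lambda>V. restrict (\<lambda>ij. V $$ ij) ?I) \<in> borel_mat p k \<rightarrow>\<^sub>M (\<Pi>\<^sub>M ij\<in>?I. borel :: real measure)"
    unfolding borel_mat_def by (rule measurable_vimage_algebra1) (auto simp: space_PiM)
  from measurable_compose[OF this measurable_component_singleton[of "(i, c)"]]
  have "(\<lambda>V. restrict (\<lambda>ij. V $$ ij) ?I (i, c)) \<in> borel_measurable (borel_mat p k)" using assms by auto
  then have "(\<lambda>V. V $$ (i, c)) \<in> borel_measurable (borel_mat p k)" using assms by simp
  then show ?thesis unfolding stiefel_space_def by (rule measurable_restrict_space1)
qed

text \<open>The Borel sets of matrices come from the entries, so measurability can be checked on the
  entries of the product, which are linear in those of V.\<close>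

lemma measurable_mult_left:
  assumes R: "R \<in> stiefel p p"
  shows "(\<lambda>V. R * V) \<in> stiefel_space p k \<rightarrow>\<^sub>M stiefel_space p k"
proof -
  let ?I = "{..<p} \<times> {..<k}"
  have comp: "(\<lambda>V. (R * V) $$ ij) \<in> borel_measurable (stiefel_space p k)" if ij_in: "ij \<in> ?I" for ij
  proof -
    obtain r c where ij: "ij = (r, c)" "r < p" "c < k" using ij_in by auto
    have "(\<lambda>V. \<Sum>s<p. R $$ (r, s) * V $$ (s, c)) \<in> borel_measurable (stiefel_space p k)"
      using ij measurable_mat_entry by (intro borel_measurable_sum borel_measurable_times) auto
    then show ?thesis
      unfolding ij(1)
      by (rule measurable_cong[THEN iffD1, rotated])
        (use ij stiefel_carrier[OF R] in \<open>auto simp: space_stiefel_space dest!: stiefel_carrier intro!: index_mult_mat_sum[symmetric]\<close>)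
  qed
  have "(\<lambda>V. R * V) \<in> stiefel_space p k \<rightarrow>\<^sub>M borel_mat p k"
    unfolding borel_mat_def
  proof (rule measurable_vimage_algebra2)
    show "(\<lambda>V. R * V) \<in> space (stiefel_space p k) \<rightarrow> carrier_mat p k"
      by (auto simp: space_stiefel_space intro!: stiefel_carrier stiefel_mult[OF R])
    show "(\<lambda>V. restrict (\<lambda>ij. (R * V) $$ ij) ?I) \<in> stiefel_space p k \<rightarrow>\<^sub>M (\<Pi>\<^sub>M ij\<in>?I. borel)"
      by (rule measurable_restrict) (rule comp)
  qed
  then show ?thesis
    using stiefel_mult[OF R] unfolding stiefel_space_def[of p k]
    by (intro measurable_restrict_space2) (auto simp: stiefel_space_def[symmetric] space_stiefel_space)
qed

text \<open>The matrix of V V^T in the orthonormal basis Q. The value 0 outside the p x p block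
  makes symmetry hold for all indices and makes \<open>overlap_givens\<close> an equality of
  functions.\<close>

definition overlap :: "nat \<Rightarrow> nat \<Rightarrow> real Matrix.mat \<Rightarrow> real Matrix.mat \<Rightarrow> nat \<Rightarrow> nat \<Rightarrow> real" where
  "overlap p k Q V r s = (if r < p \<and> s < p then
     \<Sum>c<k. (transpose_mat Q * V) $$ (r, c) * (transpose_mat Q * V) $$ (s, c) else 0)"

text \<open>W = Q^T V again has k orthonormal columns, so W W^T is the orthogonal projection onto
  their span.\<close>

lemma overlap_proj:
  assumes Q: "Q \<in> stiefel p p" and V: "V \<in> stiefel p k"
  shows "proj_mat p k (overlap p k Q V)"
proof -
  define w where "w r c = (transpose_mat Q * V) $$ (r, c)" for r c
  have on: "(\<Sum>r<p. w r c * w r d) = (if c = d then 1 else 0)" if "c < k" "d < k" for c d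
    unfolding w_def using stiefel_orthonormal[OF stiefel_mult[OF stiefel_transpose[OF Q] V] that] .
  have ov: "overlap p k Q V r s = (if r < p \<and> s < p then \<Sum>c<k. w r c * w s c else 0)" for r s
    by (simp add: overlap_def w_def)
  show ?thesis
  proof
    show "overlap p k Q V r s = overlap p k Q V s r" for r s by (auto simp: ov mult.commute)
    show "(\<Sum>m<p. overlap p k Q V r m * overlap p k Q V m s) = overlap p k Q V r s" if "r < p" "s < p" for r s
    proof -
      have "(\<Sum>m<p. overlap p k Q V r m * overlap p k Q V m s) = (\<Sum>m<p. \<Sum>c<k. \<Sum>d<k. w r c * w s d * (w m c * w m d))"
        using that by (intro sum.cong) (auto simp: ov sum_product mult_ac)
      also have "\<dots> = (\<Sum>c<k. \<Sum>m<p. \<Sum>d<k. w r c * w s d * (w m c * w m d))" by (rule sum.swap)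
      also have "\<dots> = (\<Sum>c<k. \<Sum>d<k. \<Sum>m<p. w r c * w s d * (w m c * w m d))" by (intro sum.cong refl sum.swap)
      also have "\<dots> = (\<Sum>c<k. \<Sum>d<k. w r c * w s d * (if c = d then 1 else 0))"
        by (intro sum.cong refl) (simp add: sum_distrib_left[symmetric] on)
      also have "\<dots> = (\<Sum>c<k. w r c * w s c)" by (simp add: if_distrib[of "\<lambda>x. _ * x"] cong: if_cong)
      finally show ?thesis using that by (simp add: ov)
    qed
    have "(\<Sum>r<p. overlap p k Q V r r) = (\<Sum>r<p. \<Sum>c<k. w r c * w r c)" by (intro sum.cong) (auto simp: ov)
    also have "\<dots> = (\<Sum>c<k. \<Sum>r<p. w r c * w r c)" by (rule sum.swap)
    also have "\<dots> = real k" by (simp add: on)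
    finally show "(\<Sum>r<p. overlap p k Q V r r) = real k" .
  qed
qed

text \<open>Conjugation by Q carries the coordinate rotation G into the basis Q: Q^T (Q G Q^T V) = G
  (Q^T V). Since Q G Q^T is orthogonal, it preserves the uniform measure.\<close>

lemma overlap_givens:
  assumes Q: "Q \<in> stiefel p p" and V: "V \<in> stiefel p k" and ij: "i < j" "j < p"
  shows "overlap p k Q (Q * givens p i j t * transpose_mat Q * V) = rot2 i j t (overlap p k Q V)"
proof (intro ext)
  fix r s
  let ?G = "givens p i j t" and ?B = "transpose_mat Q * V"
  have c: "Q \<in> carrier_mat p p" "V \<in> carrier_mat p k" "?G \<in> carrier_mat p p" using Q V by (auto dest: stiefel_carrier)
  have B: "?B \<in> carrier_mat p k" using c by auto
  have "transpose_mat Q * (Q * ?G * transpose_mat Q * V) = transpose_mat Q * Q * (?G * ?B)"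
  proof -
    have "Q * ?G * transpose_mat Q * V = Q * ?G * ?B" using c by (intro assoc_mult_mat[of _ p p _ p _ k]) auto
    also have "\<dots> = Q * (?G * ?B)" using c B by (intro assoc_mult_mat[of _ p p _ p _ k]) auto
    finally have "transpose_mat Q * (Q * ?G * transpose_mat Q * V) = transpose_mat Q * (Q * (?G * ?B))"
      by (rule arg_cong)
    also have "\<dots> = transpose_mat Q * Q * (?G * ?B)"
      by (rule assoc_mult_mat[symmetric, OF _ c(1) mult_carrier_mat[OF c(3) B]]) (use c in auto)
    finally show ?thesis .
  qed
  also have "\<dots> = ?G * ?B" using Q left_mult_one_mat[OF mult_carrier_mat[OF c(3) B]] by (simp add: stiefel_def)
  finally have eq: "transpose_mat Q * (Q * ?G * transpose_mat Q * V) = ?G * ?B" .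
  show "overlap p k Q (Q * ?G * transpose_mat Q * V) r s = rot2 i j t (overlap p k Q V) r s"
  proof (cases "r < p \<and> s < p")
    case True
    have "overlap p k Q (Q * ?G * transpose_mat Q * V) r s
        = (\<Sum>c<k. rot i j t (\<lambda>r. ?B $$ (r, c)) r * rot i j t (\<lambda>r. ?B $$ (r, c)) s)"
      unfolding overlap_def eq using True ij B by (auto simp: givens_mult intro!: sum.cong)
    also have "\<dots> = rot i j t (\<lambda>r. rot i j t (\<lambda>s. \<Sum>c<k. ?B $$ (r, c) * ?B $$ (s, c)) s) r"
      by (simp only: rot_sum rot_mult_right rot_mult_left)
    also have "\<dots> = rot2 i j t (overlap p k Q V) r s"
      using True ij by (auto simp: rot2_def rot_def overlap_def)
    finally show ?thesis .
  next
    case False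
    then show ?thesis using ij by (auto simp: rot2_def rot_def overlap_def)
  qed
qed

lemma uniform_stiefel_rotation_invariant:
  assumes \<xi>: "uniform_stiefel p k \<xi>" and Q: "Q \<in> stiefel p p"
  shows "rotation_invariant_projection \<xi> p k (overlap p k Q)"
proof -
  have sets: "sets \<xi> = sets (stiefel_space p k)" and prob: "prob_space \<xi>"
    and inv: "R \<in> stiefel p p \<Longrightarrow> distr \<xi> \<xi> (\<lambda>V. R * V) = \<xi>" for R
    using \<xi> by (auto simp: uniform_stiefel_def)
  have space: "space \<xi> = stiefel p k" using sets_eq_imp_space_eq[OF sets] by (simp add: space_stiefel_space)
  have meas_eq: "borel_measurable \<xi> = borel_measurable (stiefel_space p k)" "\<xi> \<rightarrow>\<^sub>M \<xi> = stiefel_space p k \<rightarrow>\<^sub>M stiefel_space p k"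
    by (rule measurable_cong_sets; simp add: sets)+
  interpret prob_space \<xi> by (rule prob)
  show ?thesis
  proof (intro rotation_invariant_projection.intro rotation_invariant_projection_axioms.intro prob)
    show "proj_mat p k (overlap p k Q V)" if "V \<in> space \<xi>" for V
      using overlap_proj[OF Q] that by (simp add: space)
    show "(\<lambda>V. overlap p k Q V r s) \<in> borel_measurable \<xi>" for r s
    proof (cases "r < p \<and> s < p")
      case True
      have entry: "(\<lambda>V. (transpose_mat Q * V) $$ (r, c)) \<in> borel_measurable (stiefel_space p k)" if "r < p" "c < k" for r c
        using measurable_compose[OF measurable_mult_left[OF stiefel_transpose[OF Q]] measurable_mat_entry[OF that]] .
      show ?thesis unfolding meas_eq overlap_def using True entry by (auto intro!: borel_measurable_sum borel_measurable_times)
    next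
      case False
      then have "(\<lambda>V. overlap p k Q V r s) = (\<lambda>V. 0)" by (auto simp: overlap_def)
      then show ?thesis by simp
    qed
    fix i j :: nat and t :: real assume ij: "i < j" "j < p"
    define R where "R = Q * givens p i j t * transpose_mat Q"
    have R: "R \<in> stiefel p p" unfolding R_def
      using Q ij by (intro stiefel_mult[of _ p _ p] givens_stiefel stiefel_transpose)
    show "\<exists>T. T \<in> \<xi> \<rightarrow>\<^sub>M \<xi> \<and> distr \<xi> \<xi> T = \<xi> \<and> (\<forall>V\<in>space \<xi>. overlap p k Q (T V) = rot2 i j t (overlap p k Q V))"
      using measurable_mult_left[OF R] inv[OF R] overlap_givens[OF Q _ ij, of _ k t]
      by (intro exI[of _ "\<lambda>V. R * V"]) (auto simp: meas_eq space R_def)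
  qed
qed

section \<open>The Gibbs measure in the eigenbasis\<close>

definition eigenbasis :: "nat \<Rightarrow> (nat \<Rightarrow> real Matrix.vec) \<Rightarrow> real Matrix.mat" where
  "eigenbasis p u = mat_of_cols p (map u [0..<p])"

lemma eigenbasis_index: "r < p \<Longrightarrow> c < p \<Longrightarrow> eigenbasis p u $$ (r, c) = u c $ r"
  by (simp add: eigenbasis_def mat_of_cols_index)

lemma eigenbasis_carrier [simp]: "eigenbasis p u \<in> carrier_mat p p"
  using mat_of_cols_carrier(1)[of p "map u [0..<p]"] by (simp add: eigenbasis_def)

lemma eigenbasis_stiefel:
  assumes "ordered_eigensystem p S lam u" shows "eigenbasis p u \<in> stiefel p p"
proof (rule stiefelI)
  fix c d assume cd: "c < p" "d < p"
  then have "u d \<in> carrier_vec p" using assms by (simp add: ordered_eigensystem_def)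
  then have "scalar_prod (u c) (u d) = (\<Sum>r<p. u c $ r * u d $ r)"
    by (simp add: scalar_prod_def atLeast0LessThan)
  also have "\<dots> = (\<Sum>r<p. eigenbasis p u $$ (r, c) * eigenbasis p u $$ (r, d))"
    using cd by (intro sum.cong) (auto simp: eigenbasis_index)
  finally have "(\<Sum>r<p. eigenbasis p u $$ (r, c) * eigenbasis p u $$ (r, d)) = scalar_prod (u c) (u d)" ..
  then show "(\<Sum>r<p. eigenbasis p u $$ (r, c) * eigenbasis p u $$ (r, d)) = (if c = d then 1 else 0)"
    using assms cd by (simp add: ordered_eigensystem_def)
qed simp

lemma eigenbasis_diagonalizes:
  assumes "ordered_eigensystem p S lam u" "S \<in> carrier_mat p p"
  shows "S * eigenbasis p u = eigenbasis p u * mat_diag p lam"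
proof (rule eq_matI)
  fix r c assume "r < dim_row (eigenbasis p u * mat_diag p lam)" "c < dim_col (eigenbasis p u * mat_diag p lam)"
  then have rc: "r < p" "c < p" by (auto simp: eigenbasis_def mat_diag_def)
  have uc: "u c \<in> carrier_vec p" "S *\<^sub>v u c = lam c \<cdot>\<^sub>v u c"
    using assms rc by (auto simp: ordered_eigensystem_def)
  have "col (eigenbasis p u) c = u c" unfolding eigenbasis_def using rc uc by (subst col_mat_of_cols) auto
  then have "(S * eigenbasis p u) $$ (r, c) = (S *\<^sub>v u c) $ r"
    using rc assms(2) by (simp add: eigenbasis_def)
  also have "\<dots> = lam c * u c $ r" using uc rc by simp
  also have "\<dots> = (eigenbasis p u * mat_diag p lam) $$ (r, c)"
    using rc by (simp add: mat_diag_mult_right[of _ p p] eigenbasis_index)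
  finally show "(S * eigenbasis p u) $$ (r, c) = (eigenbasis p u * mat_diag p lam) $$ (r, c)" .
qed (use assms(2) in \<open>auto simp: eigenbasis_def mat_diag_def\<close>)

lemma mat_trace_eigenbasis:
  assumes eig: "ordered_eigensystem p S lam u" and S: "S \<in> carrier_mat p p" and V: "V \<in> stiefel p k"
  shows "mat_trace (transpose_mat V * S * V) = (\<Sum>l<p. lam l * overlap p k (eigenbasis p u) V l l)"
proof -
  let ?Q = "eigenbasis p u" and ?D = "mat_diag p lam"
  define B where "B = transpose_mat ?Q * V"
  have Q: "?Q \<in> stiefel p p" by (rule eigenbasis_stiefel[OF eig])
  have c: "V \<in> carrier_mat p k" "B \<in> carrier_mat p k"
    unfolding B_def using stiefel_carrier[OF V] by (auto intro!: mult_carrier_mat[of _ p p _ k])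
  have DB: "?D * B \<in> carrier_mat p k" by (rule mult_carrier_mat[OF _ c(2)]) simp
  have VQB: "V = ?Q * B"
  proof -
    have "?Q * B = ?Q * transpose_mat ?Q * V"
      unfolding B_def by (rule assoc_mult_mat[symmetric, OF eigenbasis_carrier _ c(1)]) simp
    then show ?thesis using stiefel_square_right_inverse[OF Q] c by simp
  qed
  have SV: "S * V = ?Q * (?D * B)"
  proof -
    have "S * V = S * ?Q * B" by (subst VQB) (rule assoc_mult_mat[symmetric, OF S _ c(2)], simp)
    also have "\<dots> = ?Q * ?D * B" by (simp only: eigenbasis_diagonalizes[OF eig S])
    also have "\<dots> = ?Q * (?D * B)" by (rule assoc_mult_mat[OF eigenbasis_carrier _ c(2)]) simp
    finally show ?thesis .
  qed
  have "transpose_mat V * S * V = transpose_mat V * (S * V)"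
    by (rule assoc_mult_mat[OF _ S c(1)]) (use c in auto)
  also have "\<dots> = transpose_mat V * ?Q * (?D * B)"
    unfolding SV by (rule assoc_mult_mat[symmetric, OF _ eigenbasis_carrier DB]) (use c in auto)
  also have "transpose_mat V * ?Q = transpose_mat B"
    unfolding B_def using c by (simp add: transpose_mult[of _ p p _ k])
  finally have eq: "transpose_mat V * S * V = transpose_mat B * (?D * B)" .
  have "mat_trace (transpose_mat V * S * V) = (\<Sum>c<k. \<Sum>l<p. lam l * (B $$ (l, c) * B $$ (l, c)))"
    unfolding mat_trace_def eq using c DB
    by (intro sum.cong) (auto simp: mat_diag_mult_left[of _ p k] scalar_prod_def atLeast0LessThan mult_ac)
  also have "\<dots> = (\<Sum>l<p. \<Sum>c<k. lam l * (B $$ (l, c) * B $$ (l, c)))" by (rule sum.swap)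
  also have "\<dots> = (\<Sum>l<p. lam l * overlap p k ?Q V l l)"
    by (intro sum.cong) (auto simp: overlap_def B_def sum_distrib_left)
  finally show ?thesis .
qed

lemma data_cov_carrier [simp]: "data_cov p X \<in> carrier_mat p p"
  by (simp add: data_cov_def)

text \<open>The eigenvalue is the value of the quadratic form at a unit eigenvector, an average of
  squared inner products with the data. The induction runs over the unnormalized form; for an empty
  dataset the division by 0 gives 0.\<close>

lemma data_cov_eigenvalue_nonneg:
  assumes eig: "ordered_eigensystem p (data_cov p X) lam u" and j: "j < p"
  shows "0 \<le> lam j"
proof -
  define w where "w a = u j $ a" for a
  have uj: "u j \<in> carrier_vec p" "data_cov p X *\<^sub>v u j = lam j \<cdot>\<^sub>v u j" "scalar_prod (u j) (u j) = 1"
    using eig j by (auto simp: ordered_eigensystem_def)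
  have "0 \<le> (\<Sum>a<p. w a * (\<Sum>c<p. (\<Sum>x\<in>#X. vec_index x a * vec_index x c) * w c))"
  proof (induction X)
    case (add x X)
    have "(\<Sum>a<p. w a * (\<Sum>c<p. (vec_index x a * vec_index x c) * w c)) = (\<Sum>a<p. vec_index x a * w a)\<^sup>2"
      by (simp add: power2_eq_square sum_product sum_distrib_left mult_ac)
    then show ?case using add by (simp add: distrib_right distrib_left sum.distrib)
  qed simp
  then have "0 \<le> (\<Sum>a<p. w a * (\<Sum>c<p. (\<Sum>x\<in>#X. vec_index x a * vec_index x c) * w c)) / real (size X)" by simp
  also have "\<dots> = (\<Sum>a<p. w a * (data_cov p X *\<^sub>v u j) $ a)"
    using uj(1) by (simp add: data_cov_def scalar_prod_def atLeast0LessThan w_def sum_divide_distrib sum_distrib_left)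
  also have "\<dots> = lam j * scalar_prod (u j) (u j)"
    unfolding uj(2) using uj(1) by (simp add: scalar_prod_def atLeast0LessThan w_def sum_distrib_left mult_ac)
  finally show ?thesis using uj(3) by simp
qed

lemma gibbs_eq_tilted:
  assumes \<xi>: "uniform_stiefel p k \<xi>" and eig: "ordered_eigensystem p S lam u" and S: "S \<in> carrier_mat p p"
  shows "gibbs \<xi> p S b = rotation_invariant_projection.tilted \<xi> p (overlap p k (eigenbasis p u)) b lam"
proof -
  interpret R: rotation_invariant_projection \<xi> p k "overlap p k (eigenbasis p u)"
    by (rule uniform_stiefel_rotation_invariant[OF \<xi> eigenbasis_stiefel[OF eig]])
  have space: "space \<xi> = stiefel p k"
    using \<xi> sets_eq_imp_space_eq[of \<xi>] by (auto simp: uniform_stiefel_def space_stiefel_space)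
  have weight: "gibbs_weight p S b V = exp (R.energy b lam V)" if "V \<in> space \<xi>" for V
    using mat_trace_eigenbasis[OF eig S, of V k] that by (simp add: space gibbs_weight_def R.energy_def)
  have Z: "(LINT W|\<xi>. gibbs_weight p S b W) = R.partition_fun b lam"
    unfolding R.partition_fun_def by (intro Bochner_Integration.integral_cong weight refl)
  have meas: "(\<lambda>V. ennreal (exp (R.energy b lam V) / R.partition_fun b lam)) \<in> borel_measurable \<xi>"
    using R.bdd_energy[of b lam] by (auto simp: R.bdd_def)
  then have "(\<lambda>V. ennreal (gibbs_weight p S b V / R.partition_fun b lam)) \<in> borel_measurable \<xi>"
    by (subst measurable_cong[OF arg_cong[OF weight]]) auto
  then show ?thesis
    unfolding gibbs_def R.tilted_def Z using meas
    by (rule density_cong) (simp add: weight)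
qed

text \<open>The k given columns are the first k columns of the eigenbasis, so the product is the
  upper left block of the projection in that basis.\<close>

lemma overlap_matrix_index:
  assumes "V \<in> carrier_mat p k" "k \<le> p" "i < k" "l < k"
  shows "(transpose_mat (mat_of_cols p (map u [0..<k])) * V * transpose_mat V * mat_of_cols p (map u [0..<k])) $$ (i, l)
    = overlap p k (eigenbasis p u) V i l"
proof -
  let ?U = "mat_of_cols p (map u [0..<k])"
  define C where "C = transpose_mat ?U * V"
  have U: "?U \<in> carrier_mat p k" using mat_of_cols_carrier(1)[of p "map u [0..<k]"] by simp
  have C: "C \<in> carrier_mat k k" using assms by (auto simp: C_def)
  have "C * transpose_mat V * ?U = C * (transpose_mat V * ?U)"
    by (rule assoc_mult_mat[OF C _ U]) (use assms in auto)
  also have "transpose_mat V * ?U = transpose_mat C"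
    unfolding C_def by (subst transpose_mult[of _ k p _ k]) (use U assms in auto)
  finally have "(C * transpose_mat V * ?U) $$ (i, l) = (\<Sum>c<k. C $$ (i, c) * C $$ (l, c))"
    using C assms by (simp only:) (subst index_mult_mat_sum[of _ k k _ k], auto)
  also have "\<dots> = overlap p k (eigenbasis p u) V i l"
  proof -
    have "C $$ (r, c) = (transpose_mat (eigenbasis p u) * V) $$ (r, c)" if "r < k" "c < k" for r c
    proof -
      have "C $$ (r, c) = (\<Sum>s<p. ?U $$ (s, r) * V $$ (s, c))"
        unfolding C_def using assms that by (subst index_mult_mat_sum[of _ k p _ k]) auto
      also have "\<dots> = (\<Sum>s<p. eigenbasis p u $$ (s, r) * V $$ (s, c))"
        using assms that by (intro sum.cong) (auto simp: mat_of_cols_index eigenbasis_index)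
      also have "\<dots> = (transpose_mat (eigenbasis p u) * V) $$ (r, c)"
        using assms that by (subst index_mult_mat_sum[of _ p p _ k]) (auto simp: eigenbasis_def)
      finally show ?thesis .
    qed
    then show ?thesis using assms by (simp add: overlap_def)
  qed
  finally show ?thesis unfolding C_def .
qed

section \<open>From convergence in mean square to convergence in probability\<close>

theorem theorem1:
  fixes k :: nat
    and X :: "nat \<Rightarrow> real Matrix.vec multiset"
    and \<theta> :: real
    and lam :: "nat \<Rightarrow> nat \<Rightarrow> real"
    and u :: "nat \<Rightarrow> nat \<Rightarrow> real Matrix.vec"
    and \<gamma> :: "nat \<Rightarrow> real"
    and \<mu> :: "real measure"
    and b :: "nat \<Rightarrow> real" and \<beta> :: real
    and \<xi> :: "nat \<Rightarrow> real Matrix.mat measure"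
    and M :: "nat \<Rightarrow> 'w measure"
    and V :: "nat \<Rightarrow> 'w \<Rightarrow> real Matrix.mat"
    and Ustar :: "nat \<Rightarrow> real Matrix.mat"
  assumes k_pos: "1 \<le> k"
    and data: "\<And>p. set_mset (X p) \<subseteq> carrier_vec p"
    and size: "(\<lambda>p. real (size (X p)) / real p powr (3/2)) \<longlonglongrightarrow> \<theta>" "\<theta> > 0"
    and eigensystem: "\<And>p. ordered_eigensystem p (data_cov p (X p)) (lam p) (u p)"
    and top: "\<And>i. i < k + 1 \<Longrightarrow> (\<lambda>p. lam p i) \<longlonglongrightarrow> \<gamma> i"
      "\<And>i. i < k + 1 \<Longrightarrow> \<gamma> i \<ge> 0"
    and gap: "\<gamma> (k - 1) - \<gamma> k > 0"
    and bulk: "real_distribution \<mu>"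
      "weak_conv_m (\<lambda>p. bulk_distribution p k (lam p)) \<mu>"
    and bounded: "\<And>p x. x \<in># X p \<Longrightarrow> euclid_norm x \<le> sqrt (real p)"
    and beta: "\<And>p. b p \<ge> 0" "b \<longlonglongrightarrow> \<beta>" "\<beta> \<ge> 0"
    and haar: "\<And>p. k \<le> p \<Longrightarrow> uniform_stiefel p k (\<xi> p)"
    and Ustar: "\<And>p. k \<le> p \<Longrightarrow> Ustar p = mat_of_cols p (map (u p) [0..<k])"
    and prob: "\<And>p. k \<le> p \<Longrightarrow> prob_space (M p)"
    and V_rv: "\<And>p. k \<le> p \<Longrightarrow> V p \<in> measurable (M p) (stiefel_space p k)"
    and V_law: "\<And>p. k \<le> p \<Longrightarrow>
      distr (M p) (stiefel_space p k) (V p) = gibbs (\<xi> p) p (data_cov p (X p)) (b p)"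
  shows "tendsto_in_prob M
     (\<lambda>p \<omega>. transpose_mat (Ustar p) * V p \<omega> * transpose_mat (V p \<omega>) * Ustar p)
     (if \<beta> = 0 then 0\<^sub>m k k
      else diag_pos_part (mat_diag k (\<lambda>i. 1 - hilbert_transform \<mu> (\<gamma> i) / \<beta>)))"
proof -
  define A where "A p = overlap p k (eigenbasis p (u p))" for p
  \<comment> \<open>The case distinction matters: for \<beta> = 0 the convention x / 0 = 0 would
    turn the formula into 1.\<close>
  define m where "m i = (if \<beta> = 0 then 0 else max (1 - hilbert_transform \<mu> (\<gamma> i) / \<beta>) 0)" for i
  define D where "D = (if \<beta> = 0 then 0\<^sub>m k k
      else diag_pos_part (mat_diag k (\<lambda>i. 1 - hilbert_transform \<mu> (\<gamma> i) / \<beta>)))"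
  define N where "N p = rotation_invariant_projection.tilted (\<xi> p) p (A p) (b p) (lam p)" for p
  define err where "err p V = (\<Sum>i<k. \<Sum>l<k. (A p V i l - (if i = l then m i else 0))\<^sup>2)" for p V
  have rip: "rotation_invariant_projection (\<xi> p) p k (A p)" if "k < p" for p
    unfolding A_def using that
    by (intro uniform_stiefel_rotation_invariant haar eigenbasis_stiefel[OF eigensystem]) auto
  have sorted: "lam p j \<le> lam p i" if "i \<le> j" "j < p" for p i j
    using eigensystem[of p] that by (auto simp: ordered_eigensystem_def)
  have nonneg: "0 \<le> lam p j" if "j < p" for p j
    using data_cov_eigenvalue_nonneg[OF eigensystem that] .
  have lim: "(\<lambda>p. \<Sum>i<k. \<Sum>l<k. \<integral>V. (A p V i l - (if i = l then m i else 0))\<^sup>2 \<partial>N p) \<longlonglongrightarrow> 0"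
  proof (cases "\<beta> = 0")
    case True
    then have "(if i = l then m i else 0) = 0" for i l by (simp add: m_def)
    then show ?thesis
      unfolding N_def using True overlap_limit_high_temperature[of k \<xi> A b lam \<gamma>] rip beta nonneg top
      by simp
  next
    case False
    interpret spiked_gibbs_sequence k \<xi> A b \<beta> lam \<gamma> \<mu>
      by (intro spiked_gibbs_sequence.intro gibbs_sequence.intro spiked_gibbs_sequence_axioms.intro
          rip beta sorted nonneg k_pos bulk) (use beta False gap top(1) in auto)
    have m_eq: "m = limit_overlap" using False by (simp add: fun_eq_iff m_def limit_overlap_def)
    show ?thesis using overlap_limit unfolding gibbs_mean_def N_def m_eq .
  qed
  have D_index: "D $$ (i, l) = (if i = l then m i else 0)" if "i < k" "l < k" for i l
    using that by (simp add: D_def m_def diag_pos_part_def mat_diag_def)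
  have D_carrier: "D \<in> carrier_mat k k" by (simp add: D_def diag_pos_part_def mat_diag_def)
  show ?thesis
    unfolding tendsto_in_prob_def D_def[symmetric]
  proof (intro allI impI)
    fix \<epsilon> :: real assume \<epsilon>: "0 < \<epsilon>"
    let ?Y = "\<lambda>p \<omega>. transpose_mat (Ustar p) * V p \<omega> * transpose_mat (V p \<omega>) * Ustar p"
    let ?P = "\<lambda>p. measure (M p) {\<omega> \<in> space (M p). \<epsilon> < frobenius_norm (?Y p \<omega> - D)}"
    show "?P \<longlonglongrightarrow> 0"
    proof (rule tendsto_sandwich)
      show "\<forall>\<^sub>F p in sequentially. 0 \<le> ?P p" by simp
      show "(\<lambda>p. (\<Sum>i<k. \<Sum>l<k. \<integral>V. (A p V i l - (if i = l then m i else 0))\<^sup>2 \<partial>N p) / \<epsilon>\<^sup>2) \<longlonglongrightarrow> 0"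
        using tendsto_divide[OF lim tendsto_const, of "\<epsilon>\<^sup>2"] \<epsilon> by simp
      show "\<forall>\<^sub>F p in sequentially. ?P p \<le> (\<Sum>i<k. \<Sum>l<k. \<integral>V. (A p V i l - (if i = l then m i else 0))\<^sup>2 \<partial>N p) / \<epsilon>\<^sup>2"
        using eventually_gt_at_top[of k]
      proof eventually_elim
        case (elim p)
        then have kp: "k \<le> p" by simp
        interpret R: rotation_invariant_projection "\<xi> p" p k "A p" by (rule rip[OF elim])
        have law: "distr (M p) (stiefel_space p k) (V p) = N p"
          unfolding V_law[OF kp] N_def A_def by (rule gibbs_eq_tilted[OF haar[OF kp] eigensystem]) simp
        have spaceN: "space (N p) = stiefel p k"
          unfolding law[symmetric] by (simp add: space_stiefel_space)
        interpret NP: prob_space "N p" unfolding N_def by (rule R.prob_space_tilted)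
        have berr: "R.bdd (err p)"
          unfolding err_def[abs_def] using elim by (intro R.bdd_intros) auto
        have err_meas: "err p \<in> borel_measurable (stiefel_space p k)"
        proof -
          have "err p \<in> borel_measurable (N p)" using berr by (simp add: R.bdd_def N_def)
          then show ?thesis unfolding law[symmetric] by simp
        qed
        have err0: "0 \<le> err p W" for W by (simp add: err_def sum_nonneg)
        have frob: "frobenius_norm (?Y p \<omega> - D) = sqrt (err p (V p \<omega>))" if "\<omega> \<in> space (M p)" for \<omega>
        proof -
          have "V p \<omega> \<in> carrier_mat p k"
            using measurable_space[OF V_rv[OF kp] that] by (simp add: space_stiefel_space stiefel_def)
          note Y = overlap_matrix_index[OF this kp, of _ _ "u p", folded Ustar[OF kp] A_def]
          have entry: "(?Y p \<omega> - D) $$ (i, l) = A p (V p \<omega>) i l - (if i = l then m i else 0)"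
            if "i < k" "l < k" for i l
          proof -
            have "(?Y p \<omega> - D) $$ (i, l) = ?Y p \<omega> $$ (i, l) - D $$ (i, l)"
              using D_carrier that by (intro index_minus_mat(1)) auto
            then show ?thesis by (simp only: Y[OF that] D_index[OF that])
          qed
          have dim: "dim_row (?Y p \<omega> - D) = k" "dim_col (?Y p \<omega> - D) = k" using D_carrier by auto
          show ?thesis
            unfolding frobenius_norm_def dim err_def
            by (intro arg_cong[of _ _ sqrt] sum.cong refl) (simp only: entry lessThan_iff)
        qed
        \<comment> \<open>The event is enlarged to a preimage under \<open>V p\<close>, whose
          measurability follows from that of \<open>err p\<close> and whose probability is computed
          from the law of \<open>V p\<close>.\<close>
        have "?P p \<le> measure (M p) (V p -` {W \<in> space (stiefel_space p k). \<epsilon>\<^sup>2 \<le> err p W} \<inter> space (M p))"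
        proof (rule finite_measure.finite_measure_mono)
          show "finite_measure (M p)" using prob[OF kp] by (simp add: prob_space_def)
          show "{\<omega> \<in> space (M p). \<epsilon> < frobenius_norm (?Y p \<omega> - D)}
              \<subseteq> V p -` {W \<in> space (stiefel_space p k). \<epsilon>\<^sup>2 \<le> err p W} \<inter> space (M p)"
          proof
            fix \<omega> assume "\<omega> \<in> {\<omega> \<in> space (M p). \<epsilon> < frobenius_norm (?Y p \<omega> - D)}"
            then have \<omega>: "\<omega> \<in> space (M p)" "\<epsilon> < sqrt (err p (V p \<omega>))" using frob by auto
            have "\<epsilon>\<^sup>2 \<le> (sqrt (err p (V p \<omega>)))\<^sup>2" using \<omega>(2) \<epsilon> by (intro power_mono) auto
            also have "\<dots> = err p (V p \<omega>)" by (simp add: err0)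
            finally show "\<omega> \<in> V p -` {W \<in> space (stiefel_space p k). \<epsilon>\<^sup>2 \<le> err p W} \<inter> space (M p)"
              using \<omega>(1) measurable_space[OF V_rv[OF kp]] by auto
          qed
          show "V p -` {W \<in> space (stiefel_space p k). \<epsilon>\<^sup>2 \<le> err p W} \<inter> space (M p) \<in> sets (M p)"
            using err_meas by (intro measurable_sets[OF V_rv[OF kp]]) measurable
        qed
        also have "\<dots> = measure (N p) {W \<in> space (N p). \<epsilon>\<^sup>2 \<le> err p W}"
          unfolding law[symmetric] using err_meas V_rv[OF kp] by (subst measure_distr) auto
        also have "\<dots> \<le> (\<integral>W. err p W \<partial>N p) / \<epsilon>\<^sup>2"
          using \<epsilon> R.integrable_tilted[OF berr]
          by (intro integral_Markov_inequality_measure[where A = "{}"]) (auto simp: N_def err0)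
        also have "(\<integral>W. err p W \<partial>N p) = (\<Sum>i<k. \<Sum>l<k. \<integral>V. (A p V i l - (if i = l then m i else 0))\<^sup>2 \<partial>N p)"
        proof -
          have bd: "R.bdd (\<lambda>V. (A p V i l - (if i = l then m i else 0))\<^sup>2)" if "i < k" "l < k" for i l
            using that elim by (intro R.bdd_intros) auto
          have "(\<integral>W. err p W \<partial>N p) = (\<Sum>i<k. \<integral>V. (\<Sum>l<k. (A p V i l - (if i = l then m i else 0))\<^sup>2) \<partial>N p)"
            unfolding err_def N_def by (intro R.integral_tilted_sum R.bdd_sum bd) auto
          also have "\<dots> = (\<Sum>i<k. \<Sum>l<k. \<integral>V. (A p V i l - (if i = l then m i else 0))\<^sup>2 \<partial>N p)"
            unfolding N_def by (intro sum.cong refl R.integral_tilted_sum bd) auto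
          finally show ?thesis .
        qed
        finally show ?case .
      qed
    qed simp
  qed
qed

end
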